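(* For every $r\ge 3$ and $\ell\ge 2$ there exist $K,c>0$ such that the following holds for all sufficiently large $n$ and all $t\ge K(\log n)^{r-2}$. Given an $r$-graph $H$ with $n$ vertices and $tn^{1+1/\ell}$ edges, there exists a collection $\mathcal{S}$ of copies of members of $\mathcal{B}^r_{2\ell}$ in $H$ such that for all $1\le j\le 2\ell$, $$\Delta_j(\mathcal{S})\le\frac{c|\mathcal{S}|(\log n)^{r-2}}{tn^{1+1/\ell}}\left(\max\left\{\left(\frac{t}{(\log n)^{r-2}}\right)^{-\frac{2(r-1)\ell^2-r\ell}{2(r-1)\ell^2-(r+2)\ell+2}},\ \left(\frac{t}{(\log n)^{r-2}}\right)^{-1}n^{-\frac{\ell-1}{\ell(2\ell-1)}}\right\}\right)^{j-1}.$$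
   Context: An $r$-graph is an $r$-uniform hypergraph. For $k\ge2$, $\mathcal{B}^r_k$ (Berge cycles of length $k$) is the family of $r$-graphs with $k$ distinct edges $e_1,\dots,e_k$ for which there are $k$ distinct vertices $v_1,\dots,v_k$ with $v_{i-1},v_i\in e_i$ for $1\le i\le k$, where $v_0=v_k$. For a collection $\mathcal{S}$ of such subgraphs of $H$, $\Delta_j(\mathcal{S})$ is the maximum, over all sets $J$ of $j$ edges of $H$, of the number of members of $\mathcal{S}$ containing all edges of $J$. *)

theory Defs
  imports Complex_Main
begin

definition r_graph :: "nat \<Rightarrow> 'a set \<Rightarrow> 'a set set \<Rightarrow> bool" where
  "r_graph r V E \<longleftrightarrow> finite V \<and> (\<forall>e\<in>E. e \<subseteq> V \<and> card e = r)"

text \<open>A member of the family of Berge cycles is represented by its set of edges.  The family is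
  closed under relabelling of vertices, so the copies of its members in an \<open>r\<close>-graph with edge
  set \<open>E\<close> are exactly its members contained in \<open>E\<close>.\<close>

definition berge_cycles :: "nat \<Rightarrow> nat \<Rightarrow> 'a set set set" where
  "berge_cycles r k = {C. (\<forall>e\<in>C. card e = r) \<and>
     (\<exists>(e :: nat \<Rightarrow> 'a set) (v :: nat \<Rightarrow> 'a).
        bij_betw e {1..k} C \<and> inj_on v {1..k} \<and> v 0 = v k \<and>
        (\<forall>i\<in>{1..k}. v (i - 1) \<in> e i \<and> v i \<in> e i))}"

definition berge_copies :: "nat \<Rightarrow> nat \<Rightarrow> 'a set set \<Rightarrow> 'a set set set" where
  "berge_copies r k E = {C \<in> berge_cycles r k. C \<subseteq> E}"

text \<open>Meaningful when \<open>E\<close> is finite with at least \<open>j\<close> edges; otherwise \<open>Max\<close> is unspecified.\<close>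

definition max_codegree :: "'a set set \<Rightarrow> nat \<Rightarrow> 'a set set set \<Rightarrow> nat" where
  "max_codegree E j S = Max {card {C \<in> S. J \<subseteq> C} | J. J \<subseteq> E \<and> card J = j}"

end

(* Loose 2l-cycles in an s-graph lift to Berge cycles through any map that sends each r-edge e
   to an s-subset of e, so it suffices to produce balanced families of loose cycles at a
   suitable uniformity s.

   Balancedness comes from a greedy argument in the style of Ferber, McKinley and Samotij: take
   a maximal family obeying the codegree bounds.  If it is too small, then few edge sets are
   saturated, so in a random vertex subset of density p one can delete an edge from each
   saturated set and from each cycle already chosen and still find a new cycle, contradicting
   maximality.

   For s = 2 the cycle is found by spectral counting: with the normalised adjacency matrix of a
   graph of minimum degree d on m vertices, the trace of the 2l-th power is at least 1, and
   log-convexity of the even moments shows that the closed walks with a repeated vertex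
   contribute at most an O(m^(1/l)/d) fraction of it.  For s >= 3 the cycle is found greedily
   as soon as the number of edges is a large multiple of the number of (s-1)-sets in the shadow.

   Starting from s = r, either the shadow is small on half of the edges, or half of the edges
   can be assigned to (s-1)-subsets with few edges each.  In the second case a dyadic pigeonhole,
   which costs one factor log n, reduces s by one.  The threshold for "few" depends on the
   multiplicity W accumulated so far and is chosen so that the first case gives exactly
   the exponent of the theorem; if s = 2 is reached then W is small enough for the
   graph case to give it. *)
theory Submission
  imports Defs "HOL-Analysis.Convex"
    "HOL-Library.Disjoint_Sets" "HOL-Library.FuncSet"
begin


section \<open>Short cycles in graphs of large minimum degree\<close>

text \<open>The density \<open>p\<close> and the ratio \<open>\<sigma>\<close>, the gain from each
  further prescribed edge, meet two conditions. Fewer than \<open>k\<close> edges of a loose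
  \<open>k\<close>-cycle, say \<open>j\<close>, span at least \<open>j * (s - 1) + 1\<close>
  vertices, which asks for \<open>p ^ (s - 1) \<le> \<sigma>\<close>. A whole cycle spans only
  \<open>k * (s - 1)\<close>, one vertex fewer than this pattern, and removing the old cycles asks
  for \<open>4 * \<mu> * p ^ (k * (s - 1)) \<le> \<sigma> ^ (k - 1) * p ^ s\<close>. Over a small
  shadow \<open>\<mu> = 1\<close> and the second condition dictates \<open>\<sigma>\<close>. For
  graphs the abundance of cycles gives a \<open>\<mu>\<close> that decreases with the size of the
  random set, and the two conditions become the two terms of the maximum. With A = t / (log
  n)^(r-2), the scale of the thresholds is \<open>D = A powr y\<close>, and \<open>W\<close> is at
  most \<open>D ^ (r - 2)\<close> when \<open>s = 2\<close> is reached. A larger \<open>y\<close>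
  improves the ratio over a small shadow but leaves a sparser graph at the end; \<open>y\<close> is
  the value at which both exponents agree. Every one of the r - 2 reductions costs a logarithm,
  hence the power of log n.\<close>

lemma log_convex_prod_le:
  fixes q :: "nat \<Rightarrow> real"
  assumes pos: "\<And>i. q i > 0" and lc: "\<And>i. q (Suc i) ^ 2 \<le> q i * q (Suc (Suc i))"
    and i: "1 \<le> i" and j: "1 \<le> j"
  shows "q i * q j \<le> q 1 * q (i + j - 1)"
proof -
  have step: "q (Suc i) / q i \<le> q (Suc (Suc i)) / q (Suc i)" for i
    using lc[of i] pos[of i] pos[of "Suc i"] by (simp add: field_simps power2_eq_square)
  have mono: "q (Suc i) / q i \<le> q (Suc k) / q k" if "i \<le> k" for i k
    using that
  proof (induction k rule: dec_induct)
    case base then show ?case by simp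
  next
    case (step n) then show ?case using \<open>\<And>i. q (Suc i) / q i \<le> q (Suc (Suc i)) / q (Suc i)\<close>[of n] by linarith
  qed
  show ?thesis using i
  proof (induction i rule: dec_induct)
    case base then show ?case by simp
  next
    case (step n)
    \<comment> \<open>Passing from \<open>n\<close> to \<open>Suc n\<close> multiplies the left side
      by the ratio at \<open>n\<close> and the right side by the ratio at \<open>n + j - 1\<close>,
      which is no smaller because the ratios of a log-convex sequence increase.\<close>
    have "n \<le> n + j - 1" using j by simp
    from mono[OF this] have r: "q (Suc n) / q n \<le> q (n + j) / q (n + j - 1)"
      using j by (simp add: Suc_diff_le)
    have "q (Suc n) * q j = (q (Suc n) / q n) * (q n * q j)" using pos[of n] by simp
    also have "\<dots> \<le> (q (n + j) / q (n + j - 1)) * (q 1 * q (n + j - 1))"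
      by (rule mult_mono) (use r step(3) less_imp_le[OF pos] in auto)
    also have "\<dots> = q 1 * q (n + j)" using pos[of "n+j-1"] by simp
    finally show ?case by simp
  qed
qed

text \<open>This is log-convexity at \<open>i\<close> between \<open>0\<close> and
  \<open>Suc i\<close>, with the roots cleared so that each induction step is one
  cancellation.\<close>

lemma log_convex_ratio:
  fixes T :: "nat \<Rightarrow> real"
  assumes pos: "\<And>i. T i > 0" and lc: "\<And>i. T (Suc i) ^ 2 \<le> T i * T (Suc (Suc i))"
  shows "T i ^ Suc i \<le> T 0 * T (Suc i) ^ i"
proof (induction i)
  case 0 then show ?case by simp
next
  case (Suc i)
  have "T (Suc i) ^ i * T (Suc i) ^ Suc (Suc i) = (T (Suc i) ^ 2) ^ Suc i"
    by (simp add: power_mult[symmetric] power_add[symmetric] mult_2)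
  also have "\<dots> \<le> (T i * T (Suc (Suc i))) ^ Suc i"
    using lc by (intro power_mono) auto
  also have "\<dots> = T i ^ Suc i * T (Suc (Suc i)) ^ Suc i" by (rule power_mult_distrib)
  also have "\<dots> \<le> (T 0 * T (Suc i) ^ i) * T (Suc (Suc i)) ^ Suc i"
    using Suc pos by (intro mult_right_mono) (auto intro!: zero_le_power less_imp_le)
  finally have "T (Suc i) ^ i * T (Suc i) ^ Suc (Suc i) \<le> T (Suc i) ^ i * (T 0 * T (Suc (Suc i)) ^ Suc i)"
    by (simp add: mult_ac)
  then show ?case using pos[of "Suc i"] by (meson mult_le_cancel_left_pos zero_less_power)
qed

section \<open>Sums over vertex sequences of a fixed length\<close>

definition lists_of :: "'a set \<Rightarrow> nat \<Rightarrow> 'a list set" where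
  "lists_of V i = {xs. set xs \<subseteq> V \<and> length xs = i}"

lemma finite_lists_of: "finite V \<Longrightarrow> finite (lists_of V i)"
  unfolding lists_of_def by (rule finite_lists_length_eq)

lemma sum_lists_of_Suc:
  "(\<Sum>xs\<in>lists_of V (Suc i). f xs) = (\<Sum>x\<in>V. \<Sum>xs\<in>lists_of V i. f (x # xs))"
proof -
  have "bij_betw (\<lambda>(x, xs). x # xs) (V \<times> lists_of V i) (lists_of V (Suc i))"
  proof (rule bij_betw_imageI)
    show "(\<lambda>(x, xs). x # xs) ` (V \<times> lists_of V i) = lists_of V (Suc i)"
      unfolding lists_of_def lists_length_Suc_eq by force
  qed (auto simp: inj_on_def)
  from sum.reindex_bij_betw[OF this, of f] show ?thesis
    by (simp add: sum.cartesian_product case_prod_unfold)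
qed

lemma sum_UN_le:
  fixes f :: "'b \<Rightarrow> real"
  assumes "finite I" "\<And>i. i \<in> I \<Longrightarrow> finite (B i)" "\<And>x. 0 \<le> f x"
  shows "(\<Sum>x\<in>(\<Union>i\<in>I. B i). f x) \<le> (\<Sum>i\<in>I. \<Sum>x\<in>B i. f x)"
  using assms(1,2)
proof (induction I rule: finite_induct)
  case (insert i I)
  have "(\<Sum>x\<in>(\<Union>i\<in>insert i I. B i). f x) \<le> (\<Sum>x\<in>B i. f x) + (\<Sum>x\<in>(\<Union>i\<in>I. B i). f x)"
    using insert assms(3) by (simp add: sum_Un sum_nonneg)
  also have "\<dots> \<le> (\<Sum>x\<in>B i. f x) + (\<Sum>i\<in>I. \<Sum>x\<in>B i. f x)"
    using insert by simp
  finally show ?case using insert by simp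
qed simp


section \<open>Powers of the normalised adjacency matrix\<close>

locale min_degree_graph =
  fixes V :: "'a set" and adj :: "'a \<Rightarrow> 'a \<Rightarrow> bool" and \<delta> :: real
  assumes fin: "finite V" and ne: "V \<noteq> {}"
    and adj_sym: "adj x y \<Longrightarrow> adj y x" and irrefl: "\<not> adj x x"
    and deg: "x \<in> V \<Longrightarrow> \<delta> \<le> real (card {y\<in>V. adj x y})" and \<delta>: "\<delta> > 0"
begin

definition vdeg :: "'a \<Rightarrow> real" where "vdeg x = real (card {y\<in>V. adj x y})"

text \<open>With this normalisation the vector of square roots of the degrees has eigenvalue 1, so only
  the minimum degree matters and no almost regular subgraph has to be extracted.\<close>

definition wt :: "'a \<Rightarrow> 'a \<Rightarrow> real" where
  "wt x y = (if adj x y then 1 / sqrt (vdeg x * vdeg y) else 0)"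

fun walk :: "nat \<Rightarrow> 'a \<Rightarrow> 'a \<Rightarrow> real" where
  "walk 0 x y = (if x = y then 1 else 0)"
| "walk (Suc i) x y = (\<Sum>z\<in>V. wt x z * walk i z y)"

lemma vdeg_ge: "x \<in> V \<Longrightarrow> \<delta> \<le> vdeg x" unfolding vdeg_def by (rule deg)
lemma vdeg_pos: "x \<in> V \<Longrightarrow> 0 < vdeg x" using vdeg_ge \<delta> by force
lemma wt_sym: "wt x y = wt y x" unfolding wt_def using adj_sym by (auto simp: mult.commute)
lemma vdeg_nonneg: "0 \<le> vdeg x" by (simp add: vdeg_def)
lemma wt_nonneg: "0 \<le> wt x y" unfolding wt_def using vdeg_nonneg by simp
lemma walk_nonneg: "0 \<le> walk i x y" by (induction i arbitrary: x) (auto intro!: sum_nonneg mult_nonneg_nonneg wt_nonneg)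

lemma wt_le: assumes "x \<in> V" "y \<in> V" shows "wt x y \<le> 1 / \<delta>"
proof -
  have "\<delta> ^ 2 \<le> vdeg x * vdeg y" using vdeg_ge[OF assms(1)] vdeg_ge[OF assms(2)] \<delta>
    unfolding power2_eq_square by (intro mult_mono) auto
  then have "\<delta> \<le> sqrt (vdeg x * vdeg y)" by (rule real_le_rsqrt)
  then show ?thesis unfolding wt_def using \<delta> by (auto intro!: divide_left_mono mult_pos_pos vdeg_pos assms)
qed

lemma walk_add: assumes "x \<in> V" shows "walk (i + j) x y = (\<Sum>z\<in>V. walk i x z * walk j z y)"
  using assms
proof (induction i arbitrary: x)
  case 0 then show ?case using fin by (simp add: if_distrib[of "\<lambda>t. t * _"] sum.delta' cong: if_cong)
next
  case (Suc i)
  have "walk (Suc i + j) x y = (\<Sum>u\<in>V. wt x u * (\<Sum>z\<in>V. walk i u z * walk j z y))"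
    using Suc.IH by (auto intro!: sum.cong)
  also have "\<dots> = (\<Sum>z\<in>V. walk (Suc i) x z * walk j z y)"
    by (simp add: sum_distrib_left sum_distrib_right mult.assoc) (rule sum.swap)
  finally show ?case .
qed

lemma walk_1: "x \<in> V \<Longrightarrow> y \<in> V \<Longrightarrow> walk 1 x y = wt x y"
  using fin by (simp add: if_distrib[of "\<lambda>t. _ * t"] sum.delta cong: if_cong)

lemma walk_sym: assumes "x \<in> V" "y \<in> V" shows "walk i x y = walk i y x"
  using assms
proof (induction i arbitrary: x y)
  case 0 then show ?case by simp
next
  case (Suc i)
  have "walk (Suc i) x y = (\<Sum>z\<in>V. walk i y z * walk 1 z x)"
    unfolding walk.simps
  proof (rule sum.cong)
    fix z assume z: "z \<in> V"
    show "wt x z * walk i z y = walk i y z * walk 1 z x"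
      unfolding walk_1[OF z Suc.prems(1)] Suc.IH[OF z Suc.prems(2)] wt_sym[of x z] by (rule mult.commute)
  qed simp
  also have "\<dots> = walk (i + 1) y x" using Suc by (intro walk_add[symmetric])
  finally show ?case by simp
qed

lemma walk_diag: assumes "x \<in> V" shows "walk (i + j) x x = (\<Sum>z\<in>V. walk i x z * walk j x z)"
  unfolding walk_add[OF assms] by (rule sum.cong) (simp_all only: walk_sym[OF _ assms])

lemma walk_even: assumes "x \<in> V" shows "walk (i + i) x x = (\<Sum>z\<in>V. (walk i x z)\<^sup>2)"
  unfolding walk_diag[OF assms] power2_eq_square ..

text \<open>By symmetry \<open>walk (i + j) x x\<close> is the inner product of the rows at
  \<open>x\<close> of the \<open>i\<close>-th and \<open>j\<close>-th powers of \<open>wt\<close>.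
  Cauchy-Schwarz then controls odd closed walks by even ones as well.\<close>

lemma walk_CS: assumes "x \<in> V"
  shows "(walk (i + j) x x)\<^sup>2 \<le> walk (i + i) x x * walk (j + j) x x"
  unfolding walk_even[OF assms] walk_diag[OF assms, of i j] by (rule Cauchy_Schwarz_ineq_sum)

text \<open>Only even powers are recorded: their diagonal entries are squared norms of rows, hence
  positive and log-convex in \<open>i\<close>.\<close>

definition ret :: "'a \<Rightarrow> nat \<Rightarrow> real" where "ret x i = walk (i + i) x x"

definition tr :: "nat \<Rightarrow> real" where "tr i = (\<Sum>x\<in>V. ret x i)"

lemma ret_lc: assumes "x \<in> V" shows "(ret x (Suc i))\<^sup>2 \<le> ret x i * ret x (Suc (Suc i))"
proof -
  have "Suc i + Suc i = i + Suc (Suc i)" by simp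
  then show ?thesis unfolding ret_def using walk_CS[OF assms, of i "Suc (Suc i)"] by (metis)
qed

lemma ret_0: "ret x 0 = 1" by (simp add: ret_def)

lemma walk_1_self: "x \<in> V \<Longrightarrow> walk 1 x x = 0" using walk_1[of x x] by (simp add: wt_def irrefl)

lemma ret_1: assumes x: "x \<in> V" shows "0 < ret x 1" "ret x 1 \<le> 1 / \<delta>"
proof -
  have ret: "ret x 1 = (\<Sum>y\<in>V. (wt x y)\<^sup>2)" unfolding ret_def walk_even[OF x] using x by (intro sum.cong) (simp_all add: walk_1 del: One_nat_def)
  also have "\<dots> = (\<Sum>y\<in>{y\<in>V. adj x y}. 1 / (vdeg x * vdeg y))"
    using fin by (intro sum.mono_neutral_cong_right) (auto simp: wt_def power_divide vdeg_nonneg)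
  finally have e: "ret x 1 = (\<Sum>y\<in>{y\<in>V. adj x y}. 1 / (vdeg x * vdeg y))" .
  have "{y\<in>V. adj x y} \<noteq> {}" using vdeg_pos[OF x] unfolding vdeg_def by (metis card.empty of_nat_0 less_irrefl)
  then show "0 < ret x 1" unfolding e using fin x by (intro sum_pos) (auto intro!: vdeg_pos mult_pos_pos)
  have "ret x 1 \<le> (\<Sum>y\<in>{y\<in>V. adj x y}. 1 / (vdeg x * \<delta>))"
    unfolding e using \<delta> x vdeg_pos vdeg_ge by (intro sum_mono divide_left_mono mult_left_mono mult_pos_pos) (auto intro: less_imp_le)
  also have "\<dots> = 1 / \<delta>" using vdeg_pos[OF x] by (simp add: vdeg_def[symmetric])
  finally show "ret x 1 \<le> 1 / \<delta>" .
qed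

lemma ret_nonneg: "0 \<le> ret x i" unfolding ret_def by (rule walk_nonneg)

lemma ret_pos: assumes "x \<in> V" shows "0 < ret x i"
proof -
  have "0 < ret x i \<and> 0 < ret x (Suc i)"
  proof (induction i)
    case 0 then show ?case using ret_1[OF assms] ret_0 by simp
  next
    case (Suc i)
    then have "0 < (ret x (Suc i))\<^sup>2" by simp
    then have "0 < ret x i * ret x (Suc (Suc i))" using ret_lc[OF assms, of i] by linarith
    with Suc show ?case by (simp add: zero_less_mult_iff)
  qed
  then show ?thesis ..
qed

text \<open>A closed walk of length \<open>2 * l\<close> that revisits \<open>x\<close> after
  \<open>a\<close> steps is a pair of closed walks at \<open>x\<close>, of lengths of equal parity.
  Even ones are values of \<open>ret\<close>, odd ones lie below geometric means of neighbouring
  values, and log-convexity pushes the indices out to 1 and \<open>l - 1\<close>. The factor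
  \<open>ret x 1\<close> is what supplies \<open>1 / \<delta>\<close> later.\<close>

lemma walk_split_le:
  assumes x: "x \<in> V" and a: "1 \<le> a" and b: "1 \<le> b" and ab: "a + b = 2 * l"
  shows "walk a x x * walk b x x \<le> ret x 1 * ret x (l - 1)"
proof (cases "even a")
  case True
  then obtain i j where "a = i + i" "b = j + j" using ab
    by (metis add_right_imp_eq dvd_add_right_iff dvd_triv_left evenE mult_2)
  then have "walk a x x * walk b x x = ret x i * ret x j" "1 \<le> i" "1 \<le> j" "l = i + j" using a b ab by (auto simp: ret_def)
  then show ?thesis using log_convex_prod_le[of "ret x" i j] ret_pos[OF x] ret_lc[OF x] by simp
next
  case False
  then have "odd a" "odd b" using ab by (auto) presburger
  then obtain i j where ij: "a = i + Suc i" "b = j + Suc j" by (metis mult_2 oddE add_Suc_right Suc_eq_plus1)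
  \<comment> \<open>Log-convexity is applied to indices that are at least 1. In the remaining case
    one of the two walks has length 1, and its weight is 0 because there are no loops.\<close>
  show ?thesis
  proof (cases "i = 0 \<or> j = 0")
    case True
    then have "walk a x x * walk b x x = 0" using ij walk_1_self[OF x] by auto
    then show ?thesis using ret_nonneg[of x] by (metis mult_nonneg_nonneg)
  next
    case False
    have 1: "(walk a x x)\<^sup>2 \<le> ret x i * ret x (Suc i)" "(walk b x x)\<^sup>2 \<le> ret x j * ret x (Suc j)"
      using walk_CS[OF x, of i "Suc i"] walk_CS[OF x, of j "Suc j"] ij unfolding ret_def by auto
    have l: "l - 1 = i + Suc j - 1" "l - 1 = Suc i + j - 1" using ij ab by auto
    have 2: "ret x i * ret x (Suc j) \<le> ret x 1 * ret x (l - 1)" unfolding l(1)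
      using False ret_pos[OF x] ret_lc[OF x] by (intro log_convex_prod_le) auto
    have 3: "ret x (Suc i) * ret x j \<le> ret x 1 * ret x (l - 1)" unfolding l(2)
      using False ret_pos[OF x] ret_lc[OF x] by (intro log_convex_prod_le) auto
    have "(walk a x x * walk b x x)\<^sup>2 \<le> (ret x i * ret x (Suc i)) * (ret x j * ret x (Suc j))"
      unfolding power_mult_distrib by (rule mult_mono) (use 1 ret_nonneg in auto)
    also have "\<dots> = (ret x i * ret x (Suc j)) * (ret x (Suc i) * ret x j)" by simp
    also have "\<dots> \<le> (ret x 1 * ret x (l - 1))\<^sup>2" unfolding power2_eq_square
      by (rule mult_mono) (use 2 3 ret_nonneg in auto)
    finally show ?thesis by (rule power2_le_imp_le) (simp add: ret_nonneg)
  qed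
qed

section \<open>Traces of the even powers\<close>

lemma tr_eq: "tr i = (\<Sum>x\<in>V. \<Sum>z\<in>V. (walk i x z)\<^sup>2)"
  unfolding tr_def ret_def by (auto intro!: sum.cong simp: walk_even)

lemma tr_lc: "(tr (Suc i))\<^sup>2 \<le> tr i * tr (Suc (Suc i))"
proof -
  have e: "ret x (Suc i) = (\<Sum>z\<in>V. walk i x z * walk (Suc (Suc i)) x z)" if "x \<in> V" for x
  proof -
    have "ret x (Suc i) = walk (i + Suc (Suc i)) x x" by (simp only: ret_def add_Suc add_Suc_right)
    also have "\<dots> = (\<Sum>z\<in>V. walk i x z * walk (Suc (Suc i)) x z)"
      by (rule walk_diag[OF that])
    finally show ?thesis .
  qed
  have "tr (Suc i) = (\<Sum>x\<in>V. \<Sum>z\<in>V. walk i x z * walk (Suc (Suc i)) x z)"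
    unfolding tr_def by (intro sum.cong e) auto
  then show ?thesis unfolding tr_eq[of i] tr_eq[of "Suc (Suc i)"] sum.cartesian_product
    using Cauchy_Schwarz_ineq_sum[of "\<lambda>(x,z). walk i x z" "\<lambda>(x,z). walk (Suc (Suc i)) x z" "V \<times> V"]
    by (simp add: case_prod_unfold del: walk.simps)
qed

lemma tr_pos: "0 < tr i" unfolding tr_def using fin ne ret_pos by (intro sum_pos) auto

lemma tr_0: "tr 0 = real (card V)" by (simp add: tr_def ret_0)

lemma wt_sqrt: assumes "x \<in> V" shows "(\<Sum>y\<in>V. wt x y * sqrt (vdeg y)) = sqrt (vdeg x)"
proof -
  have "(\<Sum>y\<in>V. wt x y * sqrt (vdeg y)) = (\<Sum>y\<in>{y\<in>V. adj x y}. 1 / sqrt (vdeg x))"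
  proof (intro sum.mono_neutral_cong_right)
    fix y assume "y \<in> {y\<in>V. adj x y}"
    then have "0 < vdeg y" "adj x y" using vdeg_pos by auto
    then show "wt x y * sqrt (vdeg y) = 1 / sqrt (vdeg x)" using vdeg_pos[OF assms] by (simp add: wt_def real_sqrt_mult)
  qed (use fin in \<open>auto simp: wt_def\<close>)
  also have "\<dots> = vdeg x / sqrt (vdeg x)" by (simp add: vdeg_def)
  also have "\<dots> = sqrt (vdeg x)" using vdeg_nonneg by (simp add: real_div_sqrt)
  finally show ?thesis .
qed

lemma walk_sqrt: "x \<in> V \<Longrightarrow> (\<Sum>y\<in>V. walk i x y * sqrt (vdeg y)) = sqrt (vdeg x)"
proof (induction i arbitrary: x)
  case 0 then show ?case using fin by (simp add: if_distrib[of "\<lambda>t. t * _"] sum.delta' cong: if_cong)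
next
  case (Suc i)
  have "(\<Sum>y\<in>V. walk (Suc i) x y * sqrt (vdeg y)) = (\<Sum>z\<in>V. wt x z * (\<Sum>y\<in>V. walk i z y * sqrt (vdeg y)))"
    by (simp add: sum_distrib_left sum_distrib_right mult.assoc) (rule sum.swap)
  also have "\<dots> = sqrt (vdeg x)" using Suc wt_sqrt[of x] by (simp cong: sum.cong)
  finally show ?case .
qed

text \<open>The vector of square roots of the degrees is fixed by every power, so the quadratic form
  of the power at this vector is its squared norm \<open>s\<close>. Cauchy-Schwarz on
  \<open>V \<times> V\<close> bounds this by \<open>s\<close> times the Hilbert-Schmidt norm of the
  power, whose square is \<open>tr i\<close>. No spectral decomposition is involved.\<close>

lemma tr_ge_1: "1 \<le> tr i"
proof -
  define s where "s = (\<Sum>x\<in>V. vdeg x)"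
  have s: "0 < s" unfolding s_def using fin ne vdeg_pos by (intro sum_pos) auto
  have "s = (\<Sum>x\<in>V. sqrt (vdeg x) * (\<Sum>y\<in>V. walk i x y * sqrt (vdeg y)))"
    unfolding s_def by (intro sum.cong) (auto simp: walk_sqrt vdeg_nonneg)
  also have "\<dots> = (\<Sum>(x,y)\<in>V\<times>V. walk i x y * (sqrt (vdeg x) * sqrt (vdeg y)))"
    unfolding sum.cartesian_product[symmetric] by (simp add: sum_distrib_left mult_ac)
  finally have "s\<^sup>2 \<le> (\<Sum>(x,y)\<in>V\<times>V. (walk i x y)\<^sup>2) * (\<Sum>(x,y)\<in>V\<times>V. (sqrt (vdeg x) * sqrt (vdeg y))\<^sup>2)"
    using Cauchy_Schwarz_ineq_sum[of "\<lambda>(x,y). walk i x y" "\<lambda>(x,y). sqrt (vdeg x) * sqrt (vdeg y)" "V\<times>V"]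
    by (simp add: case_prod_unfold)
  also have "(\<Sum>(x,y)\<in>V\<times>V. (walk i x y)\<^sup>2) = tr i" unfolding tr_eq sum.cartesian_product ..
  also have "(\<Sum>(x,y)\<in>V\<times>V. (sqrt (vdeg x) * sqrt (vdeg y))\<^sup>2) = s\<^sup>2"
    unfolding sum.cartesian_product[symmetric] s_def power2_eq_square sum_product
    by (intro sum.cong) (auto simp: vdeg_nonneg algebra_simps simp flip: real_sqrt_mult)
  finally show ?thesis using s by simp
qed

text \<open>Log-convexity is started at \<open>tr 0 = card V\<close>, and
  \<open>1 \<le> tr l\<close> allows the exponent \<open>l - 1\<close> to be raised to
  \<open>l\<close> before the root is taken. This root is the source of the density threshold
  n^(1/l).\<close>

lemma tr_ratio: assumes "1 \<le> l" shows "tr (l - 1) \<le> root l (real (card V)) * tr l"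
proof -
  obtain k where k: "l = Suc k" using assms by (cases l) auto
  have "tr k ^ Suc k \<le> real (card V) * tr (Suc k) ^ k"
    using log_convex_ratio[of tr k, OF tr_pos tr_lc] by (simp add: tr_0)
  also have "\<dots> \<le> real (card V) * tr (Suc k) ^ Suc k"
    using tr_ge_1[of "Suc k"] by (intro mult_left_mono power_increasing) auto
  finally have "root (Suc k) (tr k ^ Suc k) \<le> root (Suc k) (real (card V) * tr (Suc k) ^ Suc k)"
    by (subst real_root_le_iff) auto
  then show ?thesis using tr_pos[of k] tr_pos[of "Suc k"] 
    by (simp add: real_root_mult real_root_power_cancel less_imp_le k del: power_Suc)
qed



section \<open>Closed walks as cyclic vertex lists\<close>

fun path_wt :: "'a list \<Rightarrow> real" where
  "path_wt (x # y # ys) = wt x y * path_wt (y # ys)"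
| "path_wt _ = 1"

text \<open>Appending the first vertex closes the walk. The value is invariant under rotation, and
  over all lists of a positive length the values add up to a trace.\<close>

definition closed_wt :: "'a list \<Rightarrow> real" where "closed_wt xs = path_wt (xs @ [hd xs])"

lemma path_wt_nonneg: "0 \<le> path_wt xs"
  by (induction xs rule: path_wt.induct) (auto simp: wt_nonneg)

lemma path_wt_append: "path_wt (xs @ y # ys) = path_wt (xs @ [y]) * path_wt (y # ys)"
  by (induction xs rule: path_wt.induct) auto

lemma sum_path_wt: "x \<in> V \<Longrightarrow> y \<in> V \<Longrightarrow> (\<Sum>us\<in>lists_of V i. path_wt (x # us @ [y])) = walk (Suc i) x y"
proof (induction i arbitrary: x)
  case 0
  have "lists_of V 0 = {[]}" by (auto simp: lists_of_def)
  then show ?case using walk_1[OF 0] by simp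
next
  case (Suc i)
  then show ?case unfolding sum_lists_of_Suc walk.simps(2)[of "Suc i"]
    by (auto simp: sum_distrib_left[symmetric] simp del: walk.simps)
qed

lemma sum_closed_wt: "(\<Sum>xs\<in>lists_of V (Suc i). closed_wt xs) = (\<Sum>x\<in>V. walk (Suc i) x x)"
  unfolding sum_lists_of_Suc closed_wt_def by (intro sum.cong) (simp_all add: sum_path_wt del: walk.simps)

lemma closed_wt_rotate1: "closed_wt (rotate1 xs) = closed_wt xs"
proof (cases xs)
  case (Cons x ys)
  show ?thesis
  proof (cases ys)
    case (Cons y zs)
    have "closed_wt (rotate1 xs) = path_wt ((y # zs @ [x]) @ [y])" using \<open>xs = x # ys\<close> Cons by (simp add: closed_wt_def)
    also have "\<dots> = path_wt ((y # zs) @ x # [y])" by simp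
    also have "\<dots> = path_wt (y # zs @ [x]) * wt x y" by (subst path_wt_append) simp
    also have "\<dots> = closed_wt xs" using \<open>xs = x # ys\<close> Cons by (simp add: closed_wt_def)
    finally show ?thesis .
  qed (use Cons in simp)
qed simp

lemma closed_wt_rotate: "closed_wt (rotate n xs) = closed_wt xs"
  by (induction n) (auto simp: closed_wt_rotate1)

lemma closed_wt_nonneg: "0 \<le> closed_wt xs" unfolding closed_wt_def by (rule path_wt_nonneg)

text \<open>Rotating to the first of two equal entries brings the repetition to the positions 0 and
  \<open>a\<close>. Only the shift and the gap have to be recorded, a cost that depends on
  \<open>k\<close> alone.\<close>

lemma not_distinct_rotate:
  assumes "\<not> distinct xs" and len: "length xs = k"
  shows "\<exists>i<k. \<exists>a\<in>{1..<k}. \<exists>x us vs. length us = a - 1 \<and> length vs = k - a - 1 \<and> rotate i xs = x # us @ x # vs"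
proof -
  obtain ys y zs us where xs: "xs = ys @ [y] @ zs @ [y] @ us" using not_distinct_decomp[OF assms(1)] by blast
  have "rotate (length ys) xs = y # zs @ y # (us @ ys)" using rotate_append[of ys "[y] @ zs @ [y] @ us"] xs by simp
  moreover have "length ys < k" "Suc (length zs) \<in> {1..<k}" "length zs = Suc (length zs) - 1"
     "length (us @ ys) = k - Suc (length zs) - 1" using xs len by auto
  ultimately show ?thesis by blast
qed

text \<open>Cutting at position \<open>a\<close> factorises the weight into those of two closed
  walks at \<open>x\<close>, so the total is a sum over \<open>x\<close> of products of diagonal
  entries.\<close>

lemma sum_split_walk:
  assumes a: "1 \<le> a" "a < 2 * l"
  defines "D \<equiv> {xs \<in> lists_of V (2 * l). \<exists>x us vs. length us = a - 1 \<and> length vs = 2 * l - a - 1 \<and> xs = x # us @ x # vs}"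
  shows "(\<Sum>xs\<in>D. closed_wt xs) \<le> tr (l - 1) / \<delta>"
proof -
  define b where "b = 2 * l - a"
  define I where "I = V \<times> lists_of V (a - 1) \<times> lists_of V (b - 1)"
  define f where "f = (\<lambda>(x, us, vs). x # us @ x # vs :: 'a list)"
  have finI: "finite I" unfolding I_def using fin finite_lists_of by blast
  have "D \<subseteq> f ` I"
  proof
    fix xs assume "xs \<in> D"
    then obtain x us vs where xs: "xs \<in> lists_of V (2 * l)" "length us = a - 1" "length vs = 2 * l - a - 1" "xs = x # us @ x # vs"
      unfolding D_def by blast
    then have "(x, us, vs) \<in> I" "xs = f (x, us, vs)" by (auto simp: I_def lists_of_def b_def f_def)
    then show "xs \<in> f ` I" by blast
  qed
  then have "(\<Sum>xs\<in>D. closed_wt xs) \<le> (\<Sum>xs\<in>f ` I. closed_wt xs)"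
    using finI by (intro sum_mono2) (auto simp: closed_wt_nonneg)
  also have "\<dots> \<le> (\<Sum>i\<in>I. closed_wt (f i))"
    using sum_image_le[OF finI, of closed_wt f] closed_wt_nonneg by simp
  also have "\<dots> = (\<Sum>x\<in>V. \<Sum>us\<in>lists_of V (a - 1). \<Sum>vs\<in>lists_of V (b - 1). path_wt (x # us @ [x]) * path_wt (x # vs @ [x]))"
    unfolding I_def sum.cartesian_product
  proof (intro sum.cong refl)
    fix i assume "i \<in> V \<times> lists_of V (a - 1) \<times> lists_of V (b - 1)"
    obtain x us vs where i: "i = (x, us, vs)" by (cases i)
    have "closed_wt (f i) = path_wt ((x # us) @ x # (vs @ [x]))" by (simp add: i f_def closed_wt_def)
    also have "\<dots> = path_wt ((x # us) @ [x]) * path_wt (x # (vs @ [x]))" by (rule path_wt_append)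
    finally
    show "closed_wt (f i) = (case i of (x, y) \<Rightarrow> case y of (us, vs) \<Rightarrow> path_wt (x # us @ [x]) * path_wt (x # vs @ [x]))"
      by (simp add: i)
  qed
  also have "\<dots> = (\<Sum>x\<in>V. walk a x x * walk b x x)"
  proof (intro sum.cong refl)
    fix x assume x: "x \<in> V"
    have "Suc (a - 1) = a" "Suc (b - 1) = b" using a b_def by auto
    then have "walk a x x = (\<Sum>us\<in>lists_of V (a - 1). path_wt (x # us @ [x]))" "walk b x x = (\<Sum>us\<in>lists_of V (b - 1). path_wt (x # us @ [x]))"
      using sum_path_wt[OF x x] by metis+
    then show "(\<Sum>us\<in>lists_of V (a - 1). \<Sum>vs\<in>lists_of V (b - 1). path_wt (x # us @ [x]) * path_wt (x # vs @ [x])) = walk a x x * walk b x x"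
      by (simp add: sum_product)
  qed
  also have "\<dots> \<le> (\<Sum>x\<in>V. 1 / \<delta> * ret x (l - 1))"
  proof (rule sum_mono)
    fix x assume x: "x \<in> V"
    have "walk a x x * walk b x x \<le> ret x 1 * ret x (l - 1)" using a b_def by (intro walk_split_le x) auto
    also have "\<dots> \<le> 1 / \<delta> * ret x (l - 1)" by (rule mult_right_mono) (use ret_1(2)[OF x] ret_nonneg in auto)
    finally show "walk a x x * walk b x x \<le> 1 / \<delta> * ret x (l - 1)" .
  qed
  also have "\<dots> = tr (l - 1) / \<delta>" by (simp add: tr_def sum_divide_distrib)
  finally show ?thesis .
qed

lemma sum_not_distinct:
  "(\<Sum>xs\<in>{xs \<in> lists_of V (2 * l). \<not> distinct xs}. closed_wt xs) \<le> (2 * real l)\<^sup>2 * (tr (l - 1) / \<delta>)"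
proof -
  define D where "D a = {xs \<in> lists_of V (2 * l). \<exists>x us vs. length us = a - 1 \<and> length vs = 2 * l - a - 1 \<and> xs = x # us @ x # vs}" for a
  define B where "B = (\<lambda>(i, a). {xs \<in> lists_of V (2 * l). rotate i xs \<in> D a})"
  define I where "I = {..<2*l} \<times> {1..<2*l}"
  have fl: "finite (lists_of V (2 * l))" by (rule finite_lists_of[OF fin])
  have "{xs \<in> lists_of V (2 * l). \<not> distinct xs} \<subseteq> (\<Union>p\<in>I. B p)"
  proof
    fix xs assume xs: "xs \<in> {xs \<in> lists_of V (2 * l). \<not> distinct xs}"
    then have "rotate i xs \<in> lists_of V (2*l)" for i by (auto simp: lists_of_def)
    moreover have "\<not> distinct xs" "length xs = 2 * l" using xs by (auto simp: lists_of_def)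
    ultimately show "xs \<in> (\<Union>p\<in>I. B p)"
      using not_distinct_rotate[of xs "2 * l"] xs unfolding B_def I_def D_def by fastforce
  qed
  then have "(\<Sum>xs\<in>{xs \<in> lists_of V (2 * l). \<not> distinct xs}. closed_wt xs) \<le> (\<Sum>xs\<in>(\<Union>p\<in>I. B p). closed_wt xs)"
    using fl by (intro sum_mono2) (auto simp: closed_wt_nonneg I_def B_def)
  also have "\<dots> \<le> (\<Sum>p\<in>I. \<Sum>xs\<in>B p. closed_wt xs)"
    using fl by (intro sum_UN_le) (auto simp: closed_wt_nonneg I_def B_def)
  also have "\<dots> \<le> (\<Sum>p\<in>I. tr (l - 1) / \<delta>)"
  proof (rule sum_mono)
    fix p assume "p \<in> I"
    then obtain i a where p: "p = (i, a)" "1 \<le> a" "a < 2 * l" by (auto simp: I_def)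
    have inj: "inj (rotate i :: 'a list \<Rightarrow> 'a list)" unfolding rotate_def using inj_rotate1 by (rule inj_fn)
    have "(\<Sum>xs\<in>B p. closed_wt xs) = (\<Sum>xs\<in>rotate i ` B p. closed_wt xs)"
      using inj by (subst sum.reindex) (auto simp: closed_wt_rotate intro: inj_on_subset)
    also have "\<dots> \<le> (\<Sum>xs\<in>D a. closed_wt xs)"
      using fl by (intro sum_mono2) (auto simp: closed_wt_nonneg D_def B_def p)
    also have "\<dots> \<le> tr (l - 1) / \<delta>" unfolding D_def using p by (intro sum_split_walk) auto
    finally show "(\<Sum>xs\<in>B p. closed_wt xs) \<le> tr (l - 1) / \<delta>" .
  qed
  also have "\<dots> = real (card I) * (tr (l - 1) / \<delta>)" by simp
  also have "\<dots> \<le> (2 * real l)\<^sup>2 * (tr (l - 1) / \<delta>)"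
  proof (rule mult_right_mono)
    have "card I \<le> (2*l) * (2*l)" by (simp add: I_def)
    then have "real (card I) \<le> real ((2*l) * (2*l))" by (rule of_nat_mono)
    then show "real (card I) \<le> (2 * real l)\<^sup>2" by (simp add: power2_eq_square)
  qed (use tr_pos \<delta> in \<open>auto intro: less_imp_le\<close>)
  finally show ?thesis .
qed

section \<open>From the total weight to the number of cycles\<close>

definition cycles :: "nat \<Rightarrow> 'a list set" where
  "cycles k = {xs \<in> lists_of V k. distinct xs \<and> (\<forall>i<k. adj (xs ! i) (xs ! (Suc i mod k)))}"

lemma path_wt_le: "set xs \<subseteq> V \<Longrightarrow> path_wt xs \<le> (1 / \<delta>) ^ (length xs - 1)"
proof (induction xs rule: path_wt.induct)
  case (1 x y ys)
  then have "wt x y * path_wt (y # ys) \<le> 1 / \<delta> * (1 / \<delta>) ^ (length (y # ys) - 1)"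
    using \<delta> by (intro mult_mono wt_le) (auto simp: wt_nonneg path_wt_nonneg)
  then show ?case by simp
qed (auto)

lemma path_wt_nonzero: "path_wt xs \<noteq> 0 \<Longrightarrow> Suc i < length xs \<Longrightarrow> adj (xs ! i) (xs ! Suc i)"
proof (induction xs arbitrary: i rule: path_wt.induct)
  case (1 x y ys)
  then have "wt x y \<noteq> 0" "path_wt (y # ys) \<noteq> 0" by auto
  then show ?case using 1 by (cases i) (auto simp: wt_def split: if_splits)
qed auto

lemma closed_wt_nonzero_cycle:
  assumes "xs \<in> lists_of V k" "distinct xs" "closed_wt xs \<noteq> 0"
  shows "xs \<in> cycles k"
proof -
  have len: "length xs = k" using assms(1) by (simp add: lists_of_def)
  have "adj (xs ! i) (xs ! (Suc i mod k))" if i: "i < k" for i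
  proof -
    have "adj ((xs @ [hd xs]) ! i) ((xs @ [hd xs]) ! Suc i)"
      using assms(3) i len unfolding closed_wt_def by (intro path_wt_nonzero) auto
    moreover have "(xs @ [hd xs]) ! i = xs ! i" using i len by (simp add: nth_append)
    moreover have "(xs @ [hd xs]) ! Suc i = xs ! (Suc i mod k)"
      using i len by (cases "xs = []"; cases "Suc i = k") (auto simp: nth_append hd_conv_nth)
    ultimately show ?thesis by simp
  qed
  with assms show ?thesis by (simp add: cycles_def)
qed

lemma closed_wt_le: assumes "xs \<in> lists_of V k" "k > 0" shows "closed_wt xs \<le> (1 / \<delta>) ^ k"
proof -
  have "hd xs \<in> set xs" using assms by (auto simp: lists_of_def)
  then show ?thesis using path_wt_le[of "xs @ [hd xs]"] assms by (auto simp: lists_of_def closed_wt_def)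
qed

text \<open>The constant 8 makes the factor
  \<open>(2 * l)\<^sup>2 * root l (card V) / \<delta>\<close> of the lists with a repetition at most
  1/2. The other lists carry weight at least 1/2, and each of them weighs at most
  \<open>(1 / \<delta>) ^ (2 * l)\<close>.\<close>

theorem many_cycles:
  assumes l: "1 \<le> l" and big: "8 * (real l)\<^sup>2 * root l (real (card V)) \<le> \<delta>"
  shows "\<delta> ^ (2 * l) / 2 \<le> real (card (cycles (2 * l)))"
proof -
  let ?A = "lists_of V (2 * l)"
  have fl: "finite ?A" by (rule finite_lists_of[OF fin])
  have "tr l = (\<Sum>xs\<in>?A. closed_wt xs)"
    using sum_closed_wt[of "2 * l - 1"] l by (simp add: tr_def ret_def mult_2)
  also have "\<dots> = (\<Sum>xs\<in>{xs\<in>?A. distinct xs}. closed_wt xs) + (\<Sum>xs\<in>{xs\<in>?A. \<not> distinct xs}. closed_wt xs)"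
    using fl by (subst sum.union_disjoint[symmetric]) (auto intro!: sum.cong)
  also have "(\<Sum>xs\<in>{xs\<in>?A. \<not> distinct xs}. closed_wt xs) \<le> tr l / 2"
  proof -
    have "(\<Sum>xs\<in>{xs\<in>?A. \<not> distinct xs}. closed_wt xs) \<le> (2 * real l)\<^sup>2 * (tr (l - 1) / \<delta>)"
      by (rule sum_not_distinct)
    also have "\<dots> \<le> (2 * real l)\<^sup>2 * ((root l (real (card V)) * tr l) / \<delta>)"
      using tr_ratio[OF l] \<delta> by (intro mult_left_mono divide_right_mono) auto
    also have "\<dots> = (8 * (real l)\<^sup>2 * root l (real (card V))) * tr l / (2 * \<delta>)"
      by (simp add: power2_eq_square)
    also have "\<dots> \<le> \<delta> * tr l / (2 * \<delta>)"
      using big tr_pos[of l] \<delta> by (intro divide_right_mono mult_right_mono) auto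
    also have "\<dots> = tr l / 2" using \<delta> by simp
    finally show ?thesis .
  qed
  finally have "1 / 2 \<le> (\<Sum>xs\<in>{xs\<in>?A. distinct xs}. closed_wt xs)" using tr_ge_1[of l] by linarith
  also have "\<dots> = (\<Sum>xs\<in>cycles (2 * l). closed_wt xs)"
    using fl by (intro sum.mono_neutral_right) (auto simp: closed_wt_nonzero_cycle[of _ "2 * l"] cycles_def dest: closed_wt_nonzero_cycle)
  also have "\<dots> \<le> (\<Sum>xs\<in>cycles (2 * l). (1 / \<delta>) ^ (2 * l))"
    using l by (intro sum_mono closed_wt_le) (auto simp: cycles_def)
  also have "\<dots> = real (card (cycles (2 * l))) / \<delta> ^ (2 * l)" by (simp add: power_divide)
  finally show ?thesis using \<delta> by (simp add: field_simps)
qed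

end

section \<open>Loose cycles\<close>

text \<open>The values of \<open>v\<close> are the core vertices, shared by consecutive edges, and
  \<open>W i\<close> holds the \<open>s - 2\<close> vertices private to edge \<open>i\<close>. For
  \<open>s = 2\<close> and \<open>k \<ge> 3\<close> this is the edge set of an ordinary
  cycle.\<close>

definition loose_cycle :: "nat \<Rightarrow> nat \<Rightarrow> 'a set set \<Rightarrow> bool" where
  "loose_cycle s k C \<longleftrightarrow> (\<exists>v W. inj_on v {..<k} \<and>
     (\<forall>i<k. finite (W i) \<and> card (W i) = s - 2 \<and> W i \<inter> v ` {..<k} = {}) \<and>
     disjoint_family_on W {..<k} \<and>
     C = (\<lambda>i. {v i, v (Suc i mod k)} \<union> W i) ` {..<k})"

lemma loose_cycleE:
  assumes "loose_cycle s k C"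
  obtains v W where "inj_on v {..<k}"
    "\<And>i. i < k \<Longrightarrow> finite (W i)" "\<And>i. i < k \<Longrightarrow> card (W i) = s - 2"
    "\<And>i. i < k \<Longrightarrow> W i \<inter> v ` {..<k} = {}"
    "disjoint_family_on W {..<k}" "C = (\<lambda>i. {v i, v (Suc i mod k)} \<union> W i) ` {..<k}"
proof -
  from assms obtain v W where "inj_on v {..<k} \<and>
     (\<forall>i<k. finite (W i) \<and> card (W i) = s - 2 \<and> W i \<inter> v ` {..<k} = {}) \<and>
     disjoint_family_on W {..<k} \<and> C = (\<lambda>i. {v i, v (Suc i mod k)} \<union> W i) ` {..<k}"
    unfolding loose_cycle_def by blast
  then show ?thesis by (intro that[of v W]) auto
qed

text \<open>Each edge meets the core exactly in its pair of consecutive core vertices, and these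
  pairs differ once \<open>k \<ge> 3\<close>; for \<open>k = 2\<close> they would coincide.\<close>

lemma inj_on_cyclic_edges:
  assumes k: "k \<ge> 3" and v: "inj_on v {..<k}" and W: "\<And>i. i < k \<Longrightarrow> W i \<inter> v ` {..<k} = {}"
  shows "inj_on (\<lambda>i. {v i, v (Suc i mod k)} \<union> W i) {..<k}"
proof (rule inj_onI)
  fix i j assume ij: "i \<in> {..<k}" "j \<in> {..<k}"
    and eq: "{v i, v (Suc i mod k)} \<union> W i = {v j, v (Suc j mod k)} \<union> W j"
  have s: "Suc i mod k < k" "Suc j mod k < k" using k by auto
  have "({v i, v (Suc i mod k)} \<union> W i) \<inter> v ` {..<k} = v ` {i, Suc i mod k}" if "i < k" for i
    using W[OF that] that k by auto
  then have "v ` {i, Suc i mod k} = v ` {j, Suc j mod k}" using eq ij by (metis lessThan_iff)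
  then have "{i, Suc i mod k} = {j, Suc j mod k}"
    using ij s by (subst (asm) inj_on_image_eq_iff[OF v]) auto
  then consider "i = j" | "i = Suc j mod k" "j = Suc i mod k" by (auto simp: doubleton_eq_iff)
  then show "i = j"
  proof cases
    case 2
    have "Suc m mod k = (if Suc m = k then 0 else Suc m)" if "m < k" for m using that by auto
    with 2 show ?thesis using ij k by (auto split: if_splits)
  qed
qed

text \<open>A nonempty set of residues closed under the cyclic successor is everything. The element
  gained by a proper set is the additional vertex spanned by an incomplete part of a loose
  cycle.\<close>

lemma card_Un_cyclic_shift:
  assumes "I \<subseteq> {..<k}" "I \<noteq> {}" "I \<noteq> {..<k}"
  shows "card I + 1 \<le> card (I \<union> (\<lambda>i. Suc i mod k) ` I)"
proof (rule ccontr)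
  assume "\<not> ?thesis"
  moreover have fin: "finite I" using assms(1) finite_subset by blast
  ultimately have "I \<union> (\<lambda>i. Suc i mod k) ` I = I"
    using card_mono[of "I \<union> (\<lambda>i. Suc i mod k) ` I" I]
    by (intro card_subset_eq[symmetric]) auto
  then have cl: "Suc i mod k \<in> I" if "i \<in> I" for i using that by blast
  obtain i where i: "i \<in> I" using assms(2) by blast
  have "(i + j) mod k \<in> I" for j
  proof (induction j)
    case 0 then show ?case using i assms(1) by auto
  next
    case (Suc j) then show ?case using cl[OF Suc] by (simp add: mod_Suc_eq)
  qed
  moreover have "x = (i + (x + k - i)) mod k" if "x < k" for x using that i assms(1) by auto
  ultimately have "{..<k} \<subseteq> I" by (metis lessThan_iff subsetI)
  with assms show False by blast
qed

lemma loose_cycle_card: assumes "loose_cycle s k C" "k \<ge> 3" shows "card C = k"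
  using assms(1)
proof (rule loose_cycleE)
  fix v W assume *: "inj_on v {..<k}" "\<And>i. i < k \<Longrightarrow> W i \<inter> v ` {..<k} = {}"
    "C = (\<lambda>i. {v i, v (Suc i mod k)} \<union> W i) ` {..<k}"
  then show ?thesis using inj_on_cyclic_edges[OF assms(2) *(1,2)] by (simp add: card_image)
qed

text \<open>Each edge has \<open>s - 2\<close> private vertices, and the core vertices covered are
  the indices of the chosen edges together with their successors. The additional 1 for
  \<open>J \<noteq> C\<close> keeps saturated sets rare in a random vertex set.\<close>

lemma loose_cycle_span:
  assumes C: "loose_cycle s k C" and k: "k \<ge> 3" and s: "s \<ge> 2" and J: "J \<subseteq> C" "J \<noteq> {}"
  shows "card J * (s - 1) + (if J = C then 0 else 1) \<le> card (\<Union>J)"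
  using C
proof (rule loose_cycleE)
  fix v W assume v: "inj_on v {..<k}" and W: "\<And>i. i < k \<Longrightarrow> finite (W i)" "\<And>i. i < k \<Longrightarrow> card (W i) = s - 2"
    "\<And>i. i < k \<Longrightarrow> W i \<inter> v ` {..<k} = {}" "disjoint_family_on W {..<k}"
    and Ceq: "C = (\<lambda>i. {v i, v (Suc i mod k)} \<union> W i) ` {..<k}"
  define e where "e = (\<lambda>i. {v i, v (Suc i mod k)} \<union> W i)"
  obtain I where I: "I \<subseteq> {..<k}" "J = e ` I" using J(1) unfolding Ceq e_def subset_image_iff by blast
  have fI: "finite I" using I(1) finite_subset by blast
  have inje: "inj_on e {..<k}" unfolding e_def by (rule inj_on_cyclic_edges[OF k v W(3)])
  have cJ: "card J = card I" using I inj_on_subset[OF inje I(1)] by (simp add: card_image)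
  define S where "S = I \<union> (\<lambda>i. Suc i mod k) ` I"
  have S: "S \<subseteq> {..<k}" using I(1) k unfolding S_def by auto
  have fS: "finite S" using S finite_subset by blast
  have "\<Union>J = v ` S \<union> (\<Union>i\<in>I. W i)" unfolding I(2) e_def S_def by auto
  moreover have "v ` S \<inter> (\<Union>i\<in>I. W i) = {}" using S I(1) W(3) by blast
  ultimately have "card (\<Union>J) = card (v ` S) + card (\<Union>i\<in>I. W i)"
    using fS fI W(1) I(1) by (simp add: card_Un_disjoint subset_iff)
  also have "card (v ` S) = card S" using v S by (meson card_image inj_on_subset)
  also have "card (\<Union>i\<in>I. W i) = (\<Sum>i\<in>I. card (W i))"
    using W(1,4) I(1) fI by (intro card_UN_disjoint) (auto simp: disjoint_family_on_def subset_iff)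
  also have "\<dots> = card I * (s - 2)" using W(2) I(1) by (simp add: subset_iff)
  finally have c: "card (\<Union>J) = card S + card I * (s - 2)" .
  have "card I + (if J = C then 0 else 1) \<le> card S"
  proof (cases "J = C")
    case True
    have "card I \<le> card S" unfolding S_def using fI by (intro card_mono) auto
    then show ?thesis using True by simp
  next
    case False
    then have "I \<noteq> {..<k}" using I(2) Ceq e_def by auto
    moreover have "I \<noteq> {}" using J(2) I(2) by auto
    ultimately show ?thesis using card_Un_cyclic_shift[OF I(1)] False unfolding S_def by simp
  qed
  moreover have "s - 1 = Suc (s - 2)" using s by simp
  ultimately show ?thesis using c cJ by simp
qed

lemma loose_cycle_lift_berge:
  assumes C: "loose_cycle s k C" and k: "k \<ge> 3"
    and pi: "inj_on \<pi> D" "\<pi> ` D = C" "\<And>e. e \<in> D \<Longrightarrow> \<pi> e \<subseteq> e" "\<And>e. e \<in> D \<Longrightarrow> card e = r"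
  shows "D \<in> berge_cycles r k"
  using C
proof (rule loose_cycleE)
  fix v W assume v: "inj_on v {..<k}" and W: "\<And>i. i < k \<Longrightarrow> W i \<inter> v ` {..<k} = {}"
    and Ceq: "C = (\<lambda>i. {v i, v (Suc i mod k)} \<union> W i) ` {..<k}"
  define e where "e = (\<lambda>i. {v i, v (Suc i mod k)} \<union> W i)"
  have inje: "inj_on e {..<k}" unfolding e_def by (rule inj_on_cyclic_edges[OF k v W])
  have 1: "bij_betw e {..<k} C" using inje Ceq unfolding e_def bij_betw_def by blast
  have 2: "bij_betw (inv_into D \<pi>) C D" using pi(1,2) by (intro bij_betw_inv_into) (simp add: bij_betw_def)
  have 3: "bij_betw (\<lambda>i::nat. i - 1) {1..k} {..<k}"
    by (rule bij_betw_byWitness[where f' = Suc]) auto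
  \<comment> \<open>Berge cycles are indexed from 1, with edge \<open>i\<close> joining
    \<open>v (i - 1)\<close> to \<open>v i\<close>; loose cycles are indexed from 0, with edge
    \<open>i\<close> joining \<open>v i\<close> to its successor. Hence the shift here and the
    reduction modulo \<open>k\<close> in \<open>u\<close>.\<close>
  define f where "f = (\<lambda>i. inv_into D \<pi> (e (i - 1)))"
  have f: "bij_betw f {1..k} D"
    using bij_betw_trans[OF bij_betw_trans[OF 3 1] 2] unfolding f_def o_def by simp
  define u where "u = (\<lambda>i. v (i mod k))"
  have "inj_on (\<lambda>i. i mod k) {1..k}"
  proof (rule inj_onI)
    fix x y assume "x \<in> {1..k}" "y \<in> {1..k}" "x mod k = y mod k"
    then show "x = y" by (cases "x = k"; cases "y = k") auto
  qed
  moreover have "(\<lambda>i. i mod k) ` {1..k} \<subseteq> {..<k}" using k by auto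
  ultimately have "inj_on (v \<circ> (\<lambda>i. i mod k)) {1..k}"
    by (intro comp_inj_on inj_on_subset[OF v])
  then have u: "inj_on u {1..k}" unfolding u_def o_def .
  have "u (i - 1) \<in> f i \<and> u i \<in> f i" if "i \<in> {1..k}" for i
  proof -
    define j where "j = i - 1"
    have j: "i = Suc j" "j < k" using that by (auto simp: j_def)
    have ej: "e j \<in> C" using j Ceq e_def by auto
    have fi: "f i = inv_into D \<pi> (e j)" by (simp add: f_def j)
    have "e j \<in> \<pi> ` D" using ej pi(2) by simp
    then have "f i \<in> D" "\<pi> (f i) = e j" unfolding fi by (rule inv_into_into, rule f_inv_into_f)
    then have "e j \<subseteq> f i" using pi(3)[of "f i"] by simp
    moreover have "u (i - 1) \<in> e j" "u i \<in> e j" using j by (simp_all add: u_def e_def)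
    ultimately show ?thesis by blast
  qed
  moreover have "u 0 = u k" by (simp add: u_def)
  ultimately show ?thesis unfolding berge_cycles_def using f u pi(4) by blast
qed

section \<open>Cycles in a graph with many edges\<close>

lemma card_Union_graph_edges_le:
  fixes F :: "'a set set"
  assumes "card C \<le> k" "finite C" "\<And>e. e \<in> C \<Longrightarrow> card e = 2"
  shows "finite (\<Union>C)" "card (\<Union>C) \<le> 2 * k"
proof -
  show "finite (\<Union>C)" using assms by (metis card.infinite finite_Union zero_neq_numeral)
  have "card (\<Union>C) \<le> sum card C" by (rule card_Union_le_sum_card)
  also have "\<dots> = 2 * card C" using assms(3) by simp
  finally show "card (\<Union>C) \<le> 2 * k" using assms(1) by linarith
qed

text \<open>A vertex set that maximises the number of inner edges minus \<open>\<delta>\<close>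
  times its size has minimum degree at least \<open>\<delta>\<close>, since deleting a vertex cannot
  increase the value. The factor \<open>(4 * l) ^ (2 * l)\<close> bounds the vertex lists with a
  given edge set: its \<open>2 * l\<close> edges cover at most \<open>4 * l\<close>
  vertices.\<close>

lemma many_loose_graph_cycles:
  fixes F :: "'a set set" and \<delta> :: real
  assumes U: "finite U" and F: "\<And>e. e \<in> F \<Longrightarrow> e \<subseteq> U \<and> card e = 2" and l: "l \<ge> 2" and \<delta>: "\<delta> > 0"
    and dense: "\<delta> * real (card U) < real (card F)"
    and big: "8 * (real l)\<^sup>2 * root l (real (card U)) \<le> \<delta>"
  shows "\<delta> ^ (2 * l) / (2 * (4 * real l) ^ (2 * l)) \<le> real (card {C. C \<subseteq> F \<and> loose_cycle 2 (2 * l) C})"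
proof -
  have finF: "finite F" using U F by (meson PowI finite_Pow_iff finite_subset subsetI)
  define g where "g X = real (card {e\<in>F. e \<subseteq> X}) - \<delta> * real (card X)" for X
  have "Max (g ` Pow U) \<in> g ` Pow U" using U by (intro Max_in) auto
  then obtain V where V: "V \<subseteq> U" "g V = Max (g ` Pow U)" by auto
  have gmax: "g X \<le> g V" if "X \<subseteq> U" for X unfolding V(2) using that U by (intro Max_ge) auto
  have "{e\<in>F. e \<subseteq> U} = F" using F by auto
  then have "0 < g V" using gmax[of U] dense unfolding g_def[of U] by simp
  moreover have "{e\<in>F. e \<subseteq> {}} = {}" using F by force
  then have "g {} = 0" unfolding g_def by simp
  ultimately have Vne: "V \<noteq> {}" by auto
  have finV: "finite V" using V(1) U finite_subset by blast
  define adj where "adj x y \<longleftrightarrow> x \<noteq> y \<and> {x, y} \<in> F" for x y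
  interpret min_degree_graph V adj \<delta>
  proof
    fix x assume x: "x \<in> V"
    have "{e\<in>F. e \<subseteq> V \<and> x \<in> e} \<subseteq> (\<lambda>y. {x, y}) ` {y\<in>V. adj x y}"
    proof
      fix e assume e: "e \<in> {e\<in>F. e \<subseteq> V \<and> x \<in> e}"
      then obtain a b where "e = {a, b}" "a \<noteq> b" using F[of e] by (auto simp: card_2_iff)
      with e obtain y where "e = {x, y}" "x \<noteq> y" by (cases "x = a") (auto simp: insert_commute)
      then show "e \<in> (\<lambda>y. {x, y}) ` {y\<in>V. adj x y}" using e by (auto simp: adj_def)
    qed
    then have 1: "card {e\<in>F. e \<subseteq> V \<and> x \<in> e} \<le> card {y\<in>V. adj x y}"
      using finV by (intro surj_card_le) auto
    have "{e\<in>F. e \<subseteq> V} = {e\<in>F. e \<subseteq> V - {x}} \<union> {e\<in>F. e \<subseteq> V \<and> x \<in> e}" by auto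
    moreover have "{e\<in>F. e \<subseteq> V - {x}} \<inter> {e\<in>F. e \<subseteq> V \<and> x \<in> e} = {}" by auto
    ultimately have "card {e\<in>F. e \<subseteq> V} = card {e\<in>F. e \<subseteq> V - {x}} + card {e\<in>F. e \<subseteq> V \<and> x \<in> e}"
      using finF by (simp add: card_Un_disjoint)
    moreover have "card V = Suc (card (V - {x}))" by (rule card.remove[OF finV x])
    moreover have "g (V - {x}) \<le> g V" using V(1) by (intro gmax) auto
    ultimately have "\<delta> \<le> real (card {e\<in>F. e \<subseteq> V \<and> x \<in> e})"
      unfolding g_def by (simp add: algebra_simps)
    then show "\<delta> \<le> real (card {y\<in>V. adj x y})" using 1 by linarith
  qed (use finV Vne \<delta> in \<open>auto simp: adj_def insert_commute\<close>)
  let ?k = "2 * l"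
  let ?L = "{C. C \<subseteq> F \<and> loose_cycle 2 ?k C}"
  define ed where "ed xs = (\<lambda>i. {xs ! i, xs ! (Suc i mod ?k)}) ` {..<?k}" for xs :: "'a list"
  have "root l (real (card V)) \<le> root l (real (card U))"
    using l card_mono[OF U V(1)] by simp
  then have "8 * (real l)\<^sup>2 * root l (real (card V)) \<le> 8 * (real l)\<^sup>2 * root l (real (card U))"
    by (rule mult_left_mono) simp
  then have "8 * (real l)\<^sup>2 * root l (real (card V)) \<le> \<delta>" using big by linarith
  from many_cycles[OF _ this] l have many: "\<delta> ^ ?k / 2 \<le> real (card (cycles ?k))" by simp
  have finL: "finite ?L" using finF by simp
  have img: "ed ` cycles ?k \<subseteq> ?L"
  proof (rule image_subsetI)
    fix xs assume xs: "xs \<in> cycles ?k"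
    have len: "length xs = ?k" and dist: "distinct xs" using xs by (auto simp: cycles_def lists_of_def)
    have "ed xs \<subseteq> F" using xs by (auto simp: ed_def cycles_def adj_def)
    moreover have "loose_cycle 2 ?k (ed xs)"
      unfolding loose_cycle_def ed_def using len dist
      by (intro exI[of _ "\<lambda>i. xs ! i"] exI[of _ "\<lambda>_. {}"]) (auto simp: inj_on_def nth_eq_iff_index_eq disjoint_family_on_def)
    ultimately show "ed xs \<in> ?L" by simp
  qed
  have fib: "card {xs \<in> cycles ?k. ed xs = C} \<le> (4 * l) ^ ?k" if C: "C \<in> ?L" for C
  proof -
    have "card C = ?k" using C loose_cycle_card[of 2 ?k C] l by auto
    moreover have "finite C" using C finF finite_subset by auto
    ultimately have c: "finite (\<Union>C)" "card (\<Union>C) \<le> 2 * ?k" using card_Union_graph_edges_le[of C ?k] C F by auto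
    have "{xs \<in> cycles ?k. ed xs = C} \<subseteq> {xs. set xs \<subseteq> \<Union>C \<and> length xs = ?k}"
      by (auto simp: cycles_def lists_of_def ed_def in_set_conv_nth)
    then have "card {xs \<in> cycles ?k. ed xs = C} \<le> card (\<Union>C) ^ ?k"
      unfolding card_lists_length_eq[OF c(1), of ?k, symmetric] by (rule card_mono[OF finite_lists_length_eq[OF c(1)]])
    also have "\<dots> \<le> (4 * l) ^ ?k" using c(2) by (intro power_mono) auto
    finally show ?thesis .
  qed
  have fc: "finite (cycles ?k)" unfolding cycles_def using finite_lists_of[OF finV] by simp
  have "card (cycles ?k) = (\<Sum>C\<in>?L. card {xs \<in> cycles ?k. ed xs = C})"
    using sum.group[OF fc finL img, of "\<lambda>_. 1::nat"] by simp
  also have "\<dots> \<le> (\<Sum>C\<in>?L. (4 * l) ^ ?k)" using fib by (intro sum_mono) auto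
  also have "\<dots> = card ?L * (4 * l) ^ ?k" by simp
  finally have "real (card (cycles ?k)) \<le> real (card ?L * (4 * l) ^ ?k)" by (rule of_nat_mono)
  then have "\<delta> ^ ?k / 2 \<le> real (card ?L) * (4 * real l) ^ ?k" using many by simp
  then show ?thesis using l by (simp add: field_simps)
qed

section \<open>Loose cycles from a small shadow\<close>

definition shadow :: "'a set set \<Rightarrow> 'a set set" where
  "shadow G = {g. \<exists>f\<in>G. \<exists>x\<in>f. g = f - {x}}"

lemma finite_shadow: assumes "finite G" "\<And>f. f \<in> G \<Longrightarrow> finite f" shows "finite (shadow G)"
proof -
  have "shadow G = (\<Union>f\<in>G. (\<lambda>x. f - {x}) ` f)" unfolding shadow_def by blast
  then show ?thesis using assms by simp
qed

text \<open>A subfamily maximising \<open>card H - m * card (shadow H)\<close> works: deleting all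
  its members above some \<open>g\<close> removes \<open>g\<close> from the shadow and saves
  \<open>m\<close>, so there must be at least \<open>m\<close> of them.\<close>

lemma dense_shadow_core:
  fixes m :: nat
  assumes G: "finite G" "\<And>f. f \<in> G \<Longrightarrow> finite f" and dense: "m * card (shadow G) < card G"
  obtains H where "H \<subseteq> G" "H \<noteq> {}" "\<And>g. g \<in> shadow H \<Longrightarrow> m \<le> card {f\<in>H. g \<subseteq> f}"
proof -
  define h where "h X = int (card X) - int (m * card (shadow X))" for X :: "'a set set"
  have "Max (h ` Pow G) \<in> h ` Pow G" using G by (intro Max_in) auto
  then obtain H where H: "H \<subseteq> G" "h H = Max (h ` Pow G)" by auto
  have hmax: "h X \<le> h H" if "X \<subseteq> G" for X unfolding H(2) using that G by (intro Max_ge) auto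
  have "int (m * card (shadow G)) < int (card G)" using dense by (simp only: of_nat_less_iff)
  then have "0 < h H" using hmax[OF order_refl] unfolding h_def[of G] by linarith
  then have ne: "H \<noteq> {}" by (auto simp: h_def shadow_def)
  have finH: "finite H" using H(1) G(1) finite_subset by blast
  have finf: "finite f" if "f \<in> H" for f using that H(1) G(2) by blast
  have fs: "finite (shadow H)" using finite_shadow[OF finH finf] .
  have "m \<le> card {f\<in>H. g \<subseteq> f}" if g: "g \<in> shadow H" for g
  proof -
    define D where "D = {f\<in>H. g \<subseteq> f}"
    have "shadow (H - D) \<subseteq> shadow H - {g}" unfolding shadow_def D_def by blast
    then have "card (shadow (H - D)) \<le> card (shadow H - {g})" using fs by (intro card_mono) auto
    moreover have "card (shadow H) = Suc (card (shadow H - {g}))" by (rule card.remove[OF fs g])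
    ultimately have "Suc (card (shadow (H - D))) \<le> card (shadow H)" by linarith
    then have "int (m * Suc (card (shadow (H - D)))) \<le> int (m * card (shadow H))" by (intro of_nat_mono mult_le_mono2)
    then have "int (m * card (shadow (H - D))) + int m \<le> int (m * card (shadow H))" by (simp add: algebra_simps)
    moreover have "card H = card (H - D) + card D" using finH unfolding D_def
      by (subst card_Un_disjoint[symmetric]) (auto intro: arg_cong[where f = card])
    moreover have "h (H - D) \<le> h H" using H(1) by (intro hmax) blast
    ultimately have "m \<le> card D" unfolding h_def by linarith
    then show ?thesis by (simp add: D_def)
  qed
  with H(1) ne show ?thesis by (rule that)
qed

text \<open>The members above \<open>f - {y}\<close> are determined by their one further vertex, and
  there are more of them than vertices in \<open>Z\<close>. In effect, a vertex of an edge can be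
  exchanged for one outside \<open>Z\<close>.\<close>

lemma shadow_core_extend:
  assumes G: "finite G" "\<And>f. f \<in> G \<Longrightarrow> card f = s" "s \<ge> 1"
    and core: "\<And>g. g \<in> shadow G \<Longrightarrow> m \<le> card {f\<in>G. g \<subseteq> f}"
    and f: "f \<in> G" "y \<in> f" and Z: "finite Z" "card Z < m"
  shows "\<exists>x. x \<notin> Z \<and> x \<notin> f - {y} \<and> insert x (f - {y}) \<in> G"
proof (rule ccontr)
  assume no: "\<not> ?thesis"
  let ?g = "f - {y}"
  have fin: "finite e" if "e \<in> G" for e using G(2)[OF that] G(3) by (metis card.infinite not_one_le_zero)
  have "{e\<in>G. ?g \<subseteq> e} \<subseteq> (\<lambda>x. insert x ?g) ` Z"
  proof
    fix e assume e: "e \<in> {e\<in>G. ?g \<subseteq> e}"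
    have "card ?g = s - 1" "finite ?g" using f G(2) fin[OF f(1)] by auto
    then have "card (e - ?g) = 1" using e G(2)[of e] G(3) by (auto simp: card_Diff_subset)
    then obtain x where x: "e - ?g = {x}" by (auto simp: card_1_singleton_iff)
    then have ex: "e = insert x ?g" "x \<notin> ?g" using e by auto
    then have "x \<in> Z" using no e by blast
    with ex show "e \<in> (\<lambda>x. insert x ?g) ` Z" by blast
  qed
  then have "card {e\<in>G. ?g \<subseteq> e} \<le> card Z" by (rule surj_card_le[OF Z(1)])
  moreover have "?g \<in> shadow G" unfolding shadow_def using f by blast
  ultimately show False using core[of ?g] Z(2) by linarith
qed

text \<open>Exchanging vertices one at a time suffices. The core grows while an edge through both of
  its ends is maintained, so the cycle closes without further work; afterwards the private vertices
  of each edge are exchanged until they avoid the core and all earlier private vertices.\<close>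

lemma loose_cycle_of_extend:
  assumes G: "G \<noteq> {}" "\<And>f. f \<in> G \<Longrightarrow> card f = s" and s: "s \<ge> 3" and k: "k \<ge> 3"
    and ext: "\<And>f y Z. f \<in> G \<Longrightarrow> y \<in> f \<Longrightarrow> finite Z \<Longrightarrow> card Z \<le> k * s
        \<Longrightarrow> \<exists>x. x \<notin> Z \<and> x \<notin> f - {y} \<and> insert x (f - {y}) \<in> G"
  shows "\<exists>C\<subseteq>G. loose_cycle s k C"
proof -
  have fin: "finite f" if "f \<in> G" for f using G(2)[OF that] s by (metis card.infinite not_numeral_le_zero)
  have path: "\<exists>v f. inj_on v {..Suc i} \<and> f \<in> G \<and> v 0 \<in> f \<and> v (Suc i) \<in> f \<and> (\<forall>j\<le>i. \<exists>f\<in>G. {v j, v (Suc j)} \<subseteq> f)"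
    if "Suc i < k" for i
    using that
  proof (induction i)
    case 0
    obtain f where f: "f \<in> G" using G(1) by blast
    then have "2 \<le> card f" using G(2) s by force
    then obtain T where T: "T \<subseteq> f" "card T = 2" by (rule obtain_subset_with_card_n) blast
    then obtain a b where ab: "a \<in> f" "b \<in> f" "a \<noteq> b" by (auto simp: card_2_iff)
    have "inj_on (\<lambda>i::nat. if i = 0 then a else b) {..Suc 0}" using ab by (auto simp: inj_on_def atMost_Suc)
    then show ?case using f ab by (intro exI[of _ "\<lambda>i::nat. if i = 0 then a else b"] exI[of _ f]) auto
  next
    case (Suc i)
    then obtain v f where v: "inj_on v {..Suc i}" and f: "f \<in> G" "v 0 \<in> f" "v (Suc i) \<in> f"
      and st: "\<And>j. j \<le> i \<Longrightarrow> \<exists>f\<in>G. {v j, v (Suc j)} \<subseteq> f" by auto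
    \<comment> \<open>As \<open>s \<ge> 3\<close>, the edge has a third vertex \<open>y\<close> to
      give up for the new core vertex \<open>x\<close>. The new edge contains \<open>v 0\<close>,
      the old end and \<open>x\<close>, so it is both the next link and the next closing
      edge.\<close>
    have "\<not> f \<subseteq> {v 0, v (Suc i)}"
    proof
      assume "f \<subseteq> {v 0, v (Suc i)}"
      then have "card f \<le> card {v 0, v (Suc i)}" by (intro card_mono) auto
      also have "\<dots> \<le> 2" by (simp add: card_insert_if)
      finally show False using G(2)[OF f(1)] s by simp
    qed
    then obtain y where y: "y \<in> f" "y \<noteq> v 0" "y \<noteq> v (Suc i)" by blast
    have "card (v ` {..Suc i}) \<le> card {..Suc i}" by (rule card_image_le) simp
    also have "\<dots> \<le> k * 1" using Suc.prems by simp
    also have "\<dots> \<le> k * s" using s by (intro mult_le_mono2) simp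
    finally obtain x where x: "x \<notin> v ` {..Suc i}" "insert x (f - {y}) \<in> G"
      using ext[OF f(1) y(1), of "v ` {..Suc i}"] by auto
    define v' where "v' = v(Suc (Suc i) := x)"
    have old: "v' j = v j" if "j \<le> Suc i" for j using that by (simp add: v'_def)
    have new: "v' (Suc (Suc i)) = x" by (simp add: v'_def)
    have "inj_on v' {..Suc i}" using v old by (simp add: inj_on_def)
    moreover have "v' ` {..Suc i} = v ` {..Suc i}" using old by (intro image_cong) auto
    ultimately have "inj_on v' {..Suc (Suc i)}" using x(1) new by (subst atMost_Suc) (simp add: inj_on_insert)
    moreover have mem: "v' 0 \<in> insert x (f - {y})" "v' (Suc (Suc i)) \<in> insert x (f - {y})" "v' (Suc i) \<in> insert x (f - {y})"
      using f y old new by auto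
    moreover have "\<exists>f\<in>G. {v' j, v' (Suc j)} \<subseteq> f" if "j \<le> Suc i" for j
    proof (cases "j = Suc i")
      case True
      then have "{v' j, v' (Suc j)} \<subseteq> insert x (f - {y})" using mem by simp
      then show ?thesis using x(2) by (rule rev_bexI[rotated])
    next
      case False
      then show ?thesis using st[of j] old[of j] old[of "Suc j"] that by simp
    qed
    ultimately show ?case using x(2) by (intro exI[of _ v'] exI[of _ "insert x (f - {y})"]) auto
  qed
  \<comment> \<open>Induction on the number of unwanted vertices: an exchange removes one of them
    and brings in none.\<close>
  have avoid: "\<exists>f'\<in>G. a \<in> f' \<and> b \<in> f' \<and> f' \<inter> Z \<subseteq> {a, b}"
    if "f \<in> G" "a \<in> f" "b \<in> f" "finite Z" "card Z \<le> k * s" for f a b Z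
    using that
  proof (induction "card (f \<inter> Z - {a, b})" arbitrary: f rule: less_induct)
    case less
    show ?case
    proof (cases "f \<inter> Z \<subseteq> {a, b}")
      case True then show ?thesis using less.prems by blast
    next
      case False
      then obtain y where y: "y \<in> f" "y \<in> Z" "y \<noteq> a" "y \<noteq> b" by blast
      obtain x where x: "x \<notin> Z" "insert x (f - {y}) \<in> G" using ext[OF less.prems(1) y(1) less.prems(4,5)] by blast
      have "insert x (f - {y}) \<inter> Z - {a, b} = (f \<inter> Z - {a, b}) - {y}" using x y by blast
      moreover have "y \<in> f \<inter> Z - {a, b}" "finite (f \<inter> Z - {a, b})" using y less.prems(4) by auto
      ultimately have "card (insert x (f - {y}) \<inter> Z - {a, b}) < card (f \<inter> Z - {a, b})"
        by (simp only: card_Diff1_less)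
      from less.hyps[OF this x(2)] show ?thesis using less.prems y by blast
    qed
  qed
  obtain v f where v: "inj_on v {..Suc (k - 2)}" and f: "f \<in> G" "v 0 \<in> f" "v (Suc (k - 2)) \<in> f"
    and st: "\<And>j. j \<le> k - 2 \<Longrightarrow> \<exists>f\<in>G. {v j, v (Suc j)} \<subseteq> f"
  proof -
    have "Suc (k - 2) < k" using k by simp
    from path[OF this] show ?thesis using that by blast
  qed
  have atm: "{..Suc (k - 2)} = {..<k}" using k by auto
  have cyc: "\<exists>f\<in>G. {v j, v (Suc j mod k)} \<subseteq> f" if "j < k" for j
  proof (cases "Suc j = k")
    case True
    then have "j = Suc (k - 2)" using k by simp
    then show ?thesis using f True by (intro bexI[of _ f]) auto
  next
    case False
    then show ?thesis using st[of j] that by auto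
  qed
  have "\<exists>W. (\<forall>i<n. finite (W i) \<and> card (W i) = s - 2 \<and> W i \<inter> v ` {..<k} = {} \<and> {v i, v (Suc i mod k)} \<union> W i \<in> G)
      \<and> disjoint_family_on W {..<n}" if "n \<le> k" for n
    using that
  proof (induction n)
    case 0 then show ?case by (auto simp: disjoint_family_on_def)
  next
    case (Suc n)
    then obtain W where W: "\<And>i. i < n \<Longrightarrow> finite (W i)" "\<And>i. i < n \<Longrightarrow> card (W i) = s - 2"
       "\<And>i. i < n \<Longrightarrow> W i \<inter> v ` {..<k} = {}" "\<And>i. i < n \<Longrightarrow> {v i, v (Suc i mod k)} \<union> W i \<in> G"
       "disjoint_family_on W {..<n}" by auto
    define Z where "Z = v ` {..<k} \<union> (\<Union>i<n. W i)"
    have "card Z \<le> card (v ` {..<k}) + card (\<Union>i<n. W i)" unfolding Z_def by (rule card_Un_le)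
    also have "\<dots> \<le> card {..<k} + (\<Sum>i<n. card (W i))" by (intro add_mono card_image_le card_UN_le) auto
    also have "\<dots> = k + n * (s - 2)" using W(2) by simp
    also have "\<dots> \<le> k + k * (s - 2)" using Suc.prems by simp
    also have "\<dots> = k * Suc (s - 2)" by simp
    also have "\<dots> \<le> k * s" using s by (intro mult_le_mono2) simp
    finally have cZ: "card Z \<le> k * s" .
    have fZ: "finite Z" unfolding Z_def using W(1) by auto
    obtain f where "f \<in> G" "{v n, v (Suc n mod k)} \<subseteq> f" using cyc[of n] Suc.prems by auto
    then obtain f' where f': "f' \<in> G" "v n \<in> f'" "v (Suc n mod k) \<in> f'" "f' \<inter> Z \<subseteq> {v n, v (Suc n mod k)}"
      using avoid[OF _ _ _ fZ cZ, of f "v n" "v (Suc n mod k)"] by auto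
    define A where "A = f' - {v n, v (Suc n mod k)}"
    have "v n \<noteq> v (Suc n mod k)"
      using inj_onD[OF v, of n "Suc n mod k"] Suc.prems k unfolding atm by (auto simp: mod_Suc split: if_splits)
    then have "card A = s - 2" unfolding A_def using f' G(2) by (simp add: card_Diff_subset)
    moreover have "finite A" unfolding A_def using fin[OF f'(1)] by simp
    moreover have "A \<inter> Z = {}" using f'(4) unfolding A_def by blast
    moreover have "{v n, v (Suc n mod k)} \<union> A \<in> G"
    proof -
      have "{v n, v (Suc n mod k)} \<union> A = f'" using f' unfolding A_def by blast
      then show ?thesis using f'(1) by simp
    qed
    ultimately have A: "finite A" "card A = s - 2" "A \<inter> v ` {..<k} = {}" "{v n, v (Suc n mod k)} \<union> A \<in> G"
       "\<And>i. i < n \<Longrightarrow> A \<inter> W i = {}" unfolding Z_def by auto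
    show ?case
    proof (intro exI[of _ "W(n := A)"] conjI[of "\<forall>i<Suc n. _ i"] allI impI)
      fix i assume "i < Suc n"
      then consider "i < n" | "i = n" by (auto simp: less_Suc_eq)
      then show "finite ((W(n := A)) i) \<and> card ((W(n := A)) i) = s - 2 \<and> (W(n := A)) i \<inter> v ` {..<k} = {} \<and>
          {v i, v (Suc i mod k)} \<union> (W(n := A)) i \<in> G"
      proof cases
        case 1
        then have "(W(n := A)) i = W i" by simp
        then show ?thesis using W(1-4)[OF 1] by simp
      next
        case 2
        then have "(W(n := A)) i = A" by simp
        then show ?thesis using A(1-4) 2 by simp
      qed
    next
      show "disjoint_family_on (W(n := A)) {..<Suc n}"
        unfolding disjoint_family_on_def
      proof (intro ballI impI)
        fix i j assume ij: "i \<in> {..<Suc n}" "j \<in> {..<Suc n}" "i \<noteq> j"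
        then consider "i < n" "j < n" | "i = n" "j < n" | "j = n" "i < n" by (auto simp: less_Suc_eq)
        then show "(W(n := A)) i \<inter> (W(n := A)) j = {}"
          by cases (use W(5) A(5) ij(3) in \<open>simp_all add: disjoint_family_on_def Int_commute\<close>)
      qed
    qed
  qed
  from this[of k] obtain W where W: "\<And>i. i < k \<Longrightarrow> finite (W i) \<and> card (W i) = s - 2 \<and> W i \<inter> v ` {..<k} = {}"
      "\<And>i. i < k \<Longrightarrow> {v i, v (Suc i mod k)} \<union> W i \<in> G" "disjoint_family_on W {..<k}" by auto
  have "loose_cycle s k ((\<lambda>i. {v i, v (Suc i mod k)} \<union> W i) ` {..<k})"
    unfolding loose_cycle_def using v W atm by (intro exI[of _ v] exI[of _ W]) auto
  moreover have "(\<lambda>i. {v i, v (Suc i mod k)} \<union> W i) ` {..<k} \<subseteq> G" using W(2) by (auto simp only: image_subset_iff lessThan_iff)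
  ultimately show ?thesis by blast
qed

lemma loose_cycle_of_dense_shadow:
  assumes G: "finite G" "\<And>f. f \<in> G \<Longrightarrow> card f = s" and s: "s \<ge> 3" and k: "k \<ge> 3"
    and dense: "(k * s + 1) * card (shadow G) < card G"
  shows "\<exists>C\<subseteq>G. loose_cycle s k C"
proof -
  have "finite f" if "f \<in> G" for f using G(2)[OF that] s by (metis card.infinite not_numeral_le_zero)
  from dense_shadow_core[OF G(1) this dense]
  obtain H where H: "H \<subseteq> G" "H \<noteq> {}" "\<And>g. g \<in> shadow H \<Longrightarrow> k * s + 1 \<le> card {f\<in>H. g \<subseteq> f}" by blast
  have "finite H" using H(1) G(1) finite_subset by blast
  have "\<exists>C\<subseteq>H. loose_cycle s k C"
  proof (rule loose_cycle_of_extend[OF H(2) _ s k])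
    fix f y and Z :: "'a set" assume "f \<in> H" "y \<in> f" "finite Z" "card Z \<le> k * s"
    then show "\<exists>x. x \<notin> Z \<and> x \<notin> f - {y} \<and> insert x (f - {y}) \<in> H"
      using s H G by (intro shadow_core_extend[OF \<open>finite H\<close>, where s = s and m = "k * s + 1"]) auto
  qed (use H G in auto)
  then show ?thesis using H(1) by blast
qed

section \<open>Random vertex subsets and balanced families\<close>

text \<open>For finite \<open>V\<close>, the expectation of \<open>g U\<close> when \<open>U\<close>
  contains each vertex of \<open>V\<close> independently with probability \<open>p\<close>.\<close>

definition bavg :: "real \<Rightarrow> 'a set \<Rightarrow> ('a set \<Rightarrow> real) \<Rightarrow> real" where
  "bavg p V g = (\<Sum>U\<in>Pow V. p ^ card U * (1 - p) ^ card (V - U) * g U)"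

lemma bavg_diff: "bavg p V (\<lambda>U. f U - g U) = bavg p V f - bavg p V g"
  unfolding bavg_def by (simp add: algebra_simps sum_subtractf)

lemma bavg_add: "bavg p V (\<lambda>U. f U + g U) = bavg p V f + bavg p V g"
  unfolding bavg_def by (simp add: algebra_simps sum.distrib)

lemma bavg_cmult: "bavg p V (\<lambda>U. c * f U) = c * bavg p V f"
  unfolding bavg_def by (simp add: sum_distrib_left mult_ac)

lemma bavg_sum: "bavg p V (\<lambda>U. \<Sum>i\<in>I. f i U) = (\<Sum>i\<in>I. bavg p V (f i))"
  unfolding bavg_def by (simp add: sum_distrib_left sum.swap[of _ I])

lemma bavg_pos_obtain:
  assumes "0 \<le> p" "p \<le> 1" "0 < bavg p V g"
  obtains U where "U \<subseteq> V" "0 < g U"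
proof -
  have "\<exists>U\<in>Pow V. 0 < p ^ card U * (1 - p) ^ card (V - U) * g U"
    using assms(3) unfolding bavg_def by (meson not_le sum_nonpos)
  then obtain U where U: "U \<subseteq> V" "0 < (p ^ card U * (1 - p) ^ card (V - U)) * g U" by auto
  moreover have "0 \<le> p ^ card U * (1 - p) ^ card (V - U)" using assms by simp
  ultimately have "0 < g U" by (metis mult_nonneg_nonpos not_le)
  with U(1) show ?thesis by (rule that)
qed

text \<open>Expanding the product of the terms \<open>p + f x\<close> over \<open>V\<close>, with
  \<open>f\<close> vanishing on \<open>T\<close>, leaves exactly the subsets that contain
  \<open>T\<close>.\<close>

lemma bavg_superset:
  assumes V: "finite V" and T: "T \<subseteq> V"
  shows "bavg p V (\<lambda>U. if T \<subseteq> U then 1 else 0) = p ^ card T"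
proof -
  define f where "f x = (if x \<in> T then 0 else 1 - p)" for x
  have "p ^ card U * (1 - p) ^ card (V - U) * (if T \<subseteq> U then 1 else 0) = (\<Prod>x\<in>U. p) * (\<Prod>x\<in>V - U. f x)"
    if U: "U \<in> Pow V" for U
  proof (cases "T \<subseteq> U")
    case True
    then have "(\<Prod>x\<in>V - U. f x) = (\<Prod>x\<in>V - U. 1 - p)" unfolding f_def by (intro prod.cong) auto
    then show ?thesis using True by simp
  next
    case False
    then obtain x where "x \<in> T" "x \<in> V - U" using T by blast
    then have "(\<Prod>x\<in>V - U. f x) = 0" using V by (intro prod_zero) (auto simp: f_def)
    then show ?thesis using False by simp
  qed
  then have "bavg p V (\<lambda>U. if T \<subseteq> U then 1 else 0) = (\<Prod>x\<in>V. p + f x)"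
    unfolding bavg_def prod_add[OF V] by (intro sum.cong) auto
  also have "\<dots> = (\<Prod>x\<in>V. if x \<in> T then p else 1)" unfolding f_def by (intro prod.cong) auto
  also have "\<dots> = p ^ card T" using V T by (simp add: prod.If_cases Int_absorb1 flip: prod.inter_restrict)
  finally show ?thesis .
qed

lemma bavg_count:
  assumes V: "finite V" and A: "finite A" "\<And>a. a \<in> A \<Longrightarrow> h a \<subseteq> V"
  shows "bavg p V (\<lambda>U. real (card {a\<in>A. h a \<subseteq> U})) = (\<Sum>a\<in>A. p ^ card (h a))"
proof -
  have "real (card {a\<in>A. h a \<subseteq> U}) = (\<Sum>a\<in>A. if h a \<subseteq> U then 1 else 0)" for U
    using A(1) by (simp add: sum.If_cases Int_def)
  then show ?thesis by (simp add: bavg_sum bavg_superset[OF V A(2)])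
qed

section \<open>Greedy choice of a balanced family\<close>

lemma sum_card_containing_le:
  assumes "finite S" "finite \<J>" "\<And>C. C \<in> S \<Longrightarrow> finite C \<and> card C = k"
  shows "(\<Sum>J\<in>\<J>. card {C\<in>S. J \<subseteq> C}) \<le> card S * 2 ^ k"
proof -
  have "(\<Sum>J\<in>\<J>. card {C\<in>S. J \<subseteq> C}) = (\<Sum>J\<in>\<J>. \<Sum>C\<in>S. if J \<subseteq> C then 1 else 0)"
    using assms(1) by (intro sum.cong) (simp_all add: sum.If_cases Int_def)
  also have "\<dots> = (\<Sum>C\<in>S. card {J\<in>\<J>. J \<subseteq> C})"
    using assms(2) by (subst sum.swap) (simp add: sum.If_cases Int_def)
  also have "\<dots> \<le> (\<Sum>C\<in>S. card (Pow C))"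
    using assms by (intro sum_mono card_mono) auto
  also have "\<dots> = card S * 2 ^ k" using assms(3) by (simp add: card_Pow)
  finally show ?thesis .
qed

text \<open>\<open>\<Psi> U\<close> is the number of edges inside \<open>U\<close> that force one cycle, and \<open>\<mu>\<close> the number of further edges
  that compensates for each cycle inside \<open>U\<close> that has been chosen already.\<close>

lemma balanced_family:
  fixes V :: "'a set" and G :: "'a set set" and \<C> :: "'a set set set" and p \<sigma> \<mu> :: real
    and k s :: nat
  defines "B \<equiv> 2 ^ (k + 3) :: real"
  assumes V: "finite V" and G: "\<And>f. f \<in> G \<Longrightarrow> f \<subseteq> V \<and> card f = s" "G \<noteq> {}" and s: "s \<ge> 1"
    and \<C>: "\<And>C. C \<in> \<C> \<Longrightarrow> C \<subseteq> G \<and> card C = k"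
    and span: "\<And>C J. C \<in> \<C> \<Longrightarrow> J \<subseteq> C \<Longrightarrow> J \<noteq> {} \<Longrightarrow>
          card J * (s - 1) + (if J = C then 0 else 1) \<le> card (\<Union>J)"
    and k: "k \<ge> 1"
    and p: "0 < p" "p \<le> 1" and \<sigma>: "0 < \<sigma>" "\<sigma> \<le> 1" "p ^ (s - 1) \<le> \<sigma>"
    and \<mu>: "0 \<le> \<mu>" "4 * \<mu> * p ^ (k * (s - 1)) \<le> \<sigma> ^ (k - 1) * p ^ s"
    and \<Psi>: "4 * bavg p V \<Psi> \<le> p ^ s * real (card G)"
    and find: "\<And>U F S. U \<subseteq> V \<Longrightarrow> F \<subseteq> {f\<in>G. f \<subseteq> U} \<Longrightarrow> S \<subseteq> \<C> \<Longrightarrow>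
        \<Psi> U + \<mu> * real (card {C\<in>S. \<Union>C \<subseteq> U}) < real (card F) \<Longrightarrow> \<exists>C\<in>\<C>. C \<subseteq> F \<and> C \<notin> S"
  shows "\<exists>S\<subseteq>\<C>. real (card G) \<le> \<sigma> ^ (k - 1) * real (card S) \<and>
     (\<forall>J\<subseteq>G. J \<noteq> {} \<longrightarrow> card J \<le> k \<longrightarrow> real (card {C\<in>S. J \<subseteq> C}) * \<sigma> ^ (k - card J) \<le> B)"
proof -
  have finG: "finite G" using V G(1) by (meson PowI finite_Pow_iff finite_subset subsetI)
  have fin\<C>: "finite \<C>" using \<C> finG by (meson PowI finite_Pow_iff finite_subset subsetI)
  \<comment> \<open>Only sets of fewer than \<open>k\<close> edges are constrained. A set of
    \<open>k\<close> edges lies in at most one cycle, so its bound holds automatically.\<close>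
  define ok where "ok S \<longleftrightarrow> S \<subseteq> \<C> \<and> (\<forall>J\<subseteq>G. J \<noteq> {} \<longrightarrow> card J < k \<longrightarrow>
      real (card {C\<in>S. J \<subseteq> C}) * \<sigma> ^ (k - card J) \<le> B)" for S
  have "ok {}" unfolding ok_def B_def by simp
  moreover have "finite {S. ok S}" by (rule finite_subset[of _ "Pow \<C>"]) (use fin\<C> in \<open>auto simp: ok_def\<close>)
  ultimately obtain S where S: "ok S" and max: "\<And>S'. ok S' \<Longrightarrow> S \<subseteq> S' \<Longrightarrow> S = S'"
    using finite_has_maximal[of "{S. ok S}"] by auto
  have SC: "S \<subseteq> \<C>" using S by (simp add: ok_def)
  have finS: "finite S" using SC fin\<C> finite_subset by blast
  have finC: "finite C \<and> card C = k" if "C \<in> \<C>" for C using \<C>[OF that] finG finite_subset by blast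
  \<comment> \<open>The size of \<open>B\<close> lets the saturated sets cost a quarter of the
    expected number of edges. \<open>\<Psi>\<close> and the old cycles cost a quarter each, which
    leaves a positive remainder.\<close>
  have "B = 8 * 2 ^ k" "1 \<le> (2::real) ^ k" by (simp_all add: B_def power_add)
  then have "2 \<le> B" by linarith
  moreover have "2 ^ (k + 1) * (1 / B) = 1 / 4" by (simp add: B_def power_add)
  ultimately have B: "2 \<le> B" "2 ^ (k + 1) * (1 / B) = 1 / 4" .
  have "real (card G) \<le> \<sigma> ^ (k - 1) * real (card S)"
  proof (rule ccontr)
    assume "\<not> ?thesis"
    then have small: "\<sigma> ^ (k - 1) * real (card S) \<le> real (card G)" by simp
    define deg where "deg J = real (card {C\<in>S. J \<subseteq> C})" for J
    \<comment> \<open>Saturated means that one more cycle through \<open>J\<close> would violate its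
      bound.\<close>
    define sat where "sat = {J. J \<subseteq> G \<and> J \<noteq> {} \<and> card J < k \<and> B < (deg J + 1) * \<sigma> ^ (k - card J)}"
    have finsat: "finite sat" by (rule finite_subset[of _ "Pow G"]) (use finG in \<open>auto simp: sat_def\<close>)
    have satV: "\<Union>J \<subseteq> V" if "J \<in> sat" for J using that G(1) unfolding sat_def by blast
    \<comment> \<open>A saturated set lies in some chosen cycle as a proper subset, so it spans the
      additional vertex, and this yields the factor \<open>p ^ s\<close>. Saturation makes
      \<open>(2 / B) * deg J * \<sigma> ^ (k - card J)\<close> at least 1, which turns the
      probability into a degree that double counting can sum.\<close>
    have sat1: "p ^ card (\<Union>J) \<le> p ^ s * \<sigma> ^ (k - 1) * (2 / B) * deg J" if J: "J \<in> sat" for J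
    proof -
      let ?j = "card J"
      have J': "J \<subseteq> G" "J \<noteq> {}" "?j < k" "B < (deg J + 1) * \<sigma> ^ (k - ?j)" using J by (auto simp: sat_def)
      have j1: "1 \<le> ?j" using J'(1,2) finG by (metis Suc_leI card_gt_0_iff finite_subset One_nat_def)
      have "\<sigma> ^ (k - ?j) \<le> 1" using \<sigma> by (intro power_le_one) auto
      then have d: "B / 2 \<le> deg J * \<sigma> ^ (k - ?j)" using J'(4) B(1) by (simp add: algebra_simps)
      then have "deg J \<noteq> 0" using B(1) by auto
      then obtain C where C: "C \<in> S" "J \<subseteq> C" unfolding deg_def by (auto simp: card_eq_0_iff)
      have "J \<noteq> C" using finC C(1) SC J'(3) by blast
      then have "?j * (s - 1) + 1 \<le> card (\<Union>J)" using span[of C J] C SC J'(2) by auto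
      moreover have "?j * (s - 1) + 1 = s + (?j - 1) * (s - 1)" using j1 s by (cases ?j) auto
      ultimately have "p ^ card (\<Union>J) \<le> p ^ (s + (?j - 1) * (s - 1))"
        using p by (intro power_decreasing) auto
      also have "\<dots> = p ^ s * (p ^ (s - 1)) ^ (?j - 1)" by (simp only: power_add power_mult mult.commute[of "?j - 1"])
      also have "\<dots> \<le> p ^ s * \<sigma> ^ (?j - 1)" using \<sigma>(3) p by (intro mult_left_mono power_mono) auto
      also have "\<dots> = p ^ s * \<sigma> ^ (?j - 1) * 1" by simp
      also have "\<dots> \<le> p ^ s * \<sigma> ^ (?j - 1) * ((2 / B) * (deg J * \<sigma> ^ (k - ?j)))"
        using d B(1) p \<sigma> by (intro mult_left_mono) (auto simp: field_simps)
      also have "\<dots> = p ^ s * (\<sigma> ^ (?j - 1) * \<sigma> ^ (k - ?j)) * (2 / B) * deg J" by simp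
      also have "\<sigma> ^ (?j - 1) * \<sigma> ^ (k - ?j) = \<sigma> ^ (k - 1)" using j1 J'(3) by (simp flip: power_add)
      finally show ?thesis .
    qed
    have e1: "bavg p V (\<lambda>U. real (card {f\<in>G. f \<subseteq> U})) = p ^ s * real (card G)"
      using bavg_count[OF V finG, of "\<lambda>f. f"] G(1) by simp
    have "bavg p V (\<lambda>U. real (card {J\<in>sat. \<Union>J \<subseteq> U})) = (\<Sum>J\<in>sat. p ^ card (\<Union>J))"
      by (rule bavg_count[OF V finsat satV])
    also have "\<dots> \<le> (\<Sum>J\<in>sat. p ^ s * \<sigma> ^ (k - 1) * (2 / B) * deg J)" by (intro sum_mono sat1)
    also have "\<dots> = p ^ s * \<sigma> ^ (k - 1) * (2 / B) * real (\<Sum>J\<in>sat. card {C\<in>S. J \<subseteq> C})"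
      by (simp add: deg_def sum_distrib_left)
    also have "\<dots> \<le> p ^ s * \<sigma> ^ (k - 1) * (2 / B) * real (card S * 2 ^ k)"
    proof (rule mult_left_mono)
      show "real (\<Sum>J\<in>sat. card {C\<in>S. J \<subseteq> C}) \<le> real (card S * 2 ^ k)"
        using finC SC by (intro of_nat_mono sum_card_containing_le[OF finS finsat]) auto
    qed (use p \<sigma> B in auto)
    also have "\<dots> = p ^ s * (\<sigma> ^ (k - 1) * real (card S)) * (2 ^ (k + 1) * (1 / B))" by simp
    also have "\<dots> \<le> p ^ s * real (card G) * (2 ^ (k + 1) * (1 / B))"
      using small p B by (intro mult_right_mono mult_left_mono) auto
    finally have e2: "bavg p V (\<lambda>U. real (card {J\<in>sat. \<Union>J \<subseteq> U})) \<le> p ^ s * real (card G) / 4"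
      unfolding B(2) by simp
    have "bavg p V (\<lambda>U. real (card {C\<in>S. \<Union>C \<subseteq> U})) = (\<Sum>C\<in>S. p ^ card (\<Union>C))"
      using SC \<C> G(1) by (intro bavg_count[OF V finS]) blast
    also have "\<dots> \<le> (\<Sum>C\<in>S. p ^ (k * (s - 1)))"
    proof (rule sum_mono)
      fix C assume C: "C \<in> S"
      then have "card C = k" using finC SC by auto
      then have "C \<noteq> {}" using k by auto
      then have "k * (s - 1) \<le> card (\<Union>C)" using span[of C C] C SC \<open>card C = k\<close> by auto
      then show "p ^ card (\<Union>C) \<le> p ^ (k * (s - 1))" using p by (intro power_decreasing) auto
    qed
    finally have "bavg p V (\<lambda>U. real (card {C\<in>S. \<Union>C \<subseteq> U})) \<le> real (card S) * p ^ (k * (s - 1))" by simp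
    then have "\<mu> * bavg p V (\<lambda>U. real (card {C\<in>S. \<Union>C \<subseteq> U})) \<le> \<mu> * (real (card S) * p ^ (k * (s - 1)))"
      using \<mu>(1) by (rule mult_left_mono)
    also have "\<dots> = real (card S) * (4 * \<mu> * p ^ (k * (s - 1))) / 4" by simp
    also have "\<dots> \<le> real (card S) * (\<sigma> ^ (k - 1) * p ^ s) / 4"
      using \<mu>(2) by (intro divide_right_mono mult_left_mono) auto
    also have "\<dots> = p ^ s * (\<sigma> ^ (k - 1) * real (card S)) / 4" by simp
    also have "\<dots> \<le> p ^ s * real (card G) / 4"
      using small p by (intro divide_right_mono mult_left_mono) auto
    finally have e3: "\<mu> * bavg p V (\<lambda>U. real (card {C\<in>S. \<Union>C \<subseteq> U})) \<le> p ^ s * real (card G) / 4" .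
    have "0 < p ^ s * real (card G)" using p G(2) finG by (simp add: card_gt_0_iff)
    define \<phi> where "\<phi> = (\<lambda>U. real (card {f\<in>G. f \<subseteq> U}) - real (card {J\<in>sat. \<Union>J \<subseteq> U})
        - (\<Psi> U + \<mu> * real (card {C\<in>S. \<Union>C \<subseteq> U})))"
    have "0 < bavg p V \<phi>" using \<open>0 < p ^ s * real (card G)\<close>
      unfolding \<phi>_def bavg_diff bavg_add bavg_cmult e1 using e2 e3 \<Psi> by linarith
    then obtain U where U: "U \<subseteq> V" and "0 < \<phi> U"
      using bavg_pos_obtain[of p V \<phi>] p by auto
    then have pos: "0 < real (card {f\<in>G. f \<subseteq> U}) - real (card {J\<in>sat. \<Union>J \<subseteq> U})
        - (\<Psi> U + \<mu> * real (card {C\<in>S. \<Union>C \<subseteq> U}))" by (simp only: \<phi>_def)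
    \<comment> \<open>With one edge of every saturated set inside \<open>U\<close> removed,
      \<open>F\<close> contains no saturated set. A new cycle in \<open>F\<close> could therefore be
      added, against maximality.\<close>
    define pick where "pick J = (SOME f. f \<in> J)" for J :: "'a set set"
    have pick: "pick J \<in> J" if "J \<in> sat" for J
      unfolding pick_def some_in_eq using that by (simp add: sat_def)
    define F where "F = {f\<in>G. f \<subseteq> U} - pick ` {J\<in>sat. \<Union>J \<subseteq> U}"
    have "card {f\<in>G. f \<subseteq> U} - card (pick ` {J\<in>sat. \<Union>J \<subseteq> U}) \<le> card F"
      unfolding F_def using finsat by (intro diff_card_le_card_Diff) auto
    moreover have "card (pick ` {J\<in>sat. \<Union>J \<subseteq> U}) \<le> card {J\<in>sat. \<Union>J \<subseteq> U}"
      using finsat by (intro card_image_le) auto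
    ultimately have "real (card {f\<in>G. f \<subseteq> U}) - real (card {J\<in>sat. \<Union>J \<subseteq> U}) \<le> real (card F)"
      by linarith
    then have "\<Psi> U + \<mu> * real (card {C\<in>S. \<Union>C \<subseteq> U}) < real (card F)" using pos by linarith
    moreover have "F \<subseteq> {f\<in>G. f \<subseteq> U}" unfolding F_def by blast
    ultimately obtain C where C: "C \<in> \<C>" "C \<subseteq> F" "C \<notin> S" using find[OF U _ SC] by blast
    have "\<not> ok (insert C S)" using max[of "insert C S"] C(3) by blast
    then obtain J where J: "J \<subseteq> G" "J \<noteq> {}" "card J < k"
        "B < real (card {C'\<in>insert C S. J \<subseteq> C'}) * \<sigma> ^ (k - card J)"
      unfolding ok_def using C(1) SC by (auto simp: not_le)
    have JC: "J \<subseteq> C"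
    proof (rule ccontr)
      assume "\<not> J \<subseteq> C"
      then have "{C'\<in>insert C S. J \<subseteq> C'} = {C'\<in>S. J \<subseteq> C'}" by auto
      then show False using J S unfolding ok_def by (metis not_le)
    qed
    then have "{C'\<in>insert C S. J \<subseteq> C'} = insert C {C'\<in>S. J \<subseteq> C'}" by auto
    then have "real (card {C'\<in>insert C S. J \<subseteq> C'}) = deg J + 1"
      unfolding deg_def using finS C(3) by simp
    then have "J \<in> sat" using J unfolding sat_def by simp
    moreover have "\<Union>J \<subseteq> U" using JC C(2) unfolding F_def by blast
    ultimately have "pick J \<notin> F" unfolding F_def by blast
    then show False using pick[OF \<open>J \<in> sat\<close>] JC C(2) by blast
  qed
  moreover have "real (card {C\<in>S. J \<subseteq> C}) * \<sigma> ^ (k - card J) \<le> B" if J: "J \<subseteq> G" "J \<noteq> {}" "card J \<le> k" for J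
  proof (cases "card J < k")
    case True then show ?thesis using S J unfolding ok_def by blast
  next
    case False
    then have cJ: "card J = k" using J by simp
    have "{C\<in>S. J \<subseteq> C} \<subseteq> {J}"
    proof
      fix C assume "C \<in> {C\<in>S. J \<subseteq> C}"
      then have "finite C" "J \<subseteq> C" "card C = card J" using finC SC cJ by auto
      then show "C \<in> {J}" using card_subset_eq[of C J] by simp
    qed
    then have "card {C\<in>S. J \<subseteq> C} \<le> card {J}" by (intro card_mono) auto
    then show ?thesis using B(1) cJ by simp
  qed
  ultimately show ?thesis using SC by blast
qed

section \<open>Balanced families of loose cycles\<close>

text \<open>For one edge the bound is a constant multiple of the average number of cycles through an
  edge; each further edge gains a factor \<open>\<sigma>\<close>.\<close>

definition balanced :: "nat \<Rightarrow> nat \<Rightarrow> real \<Rightarrow> real \<Rightarrow> 'a set set \<Rightarrow> bool" where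
  "balanced s k b \<sigma> G \<longleftrightarrow> (\<exists>S \<subseteq> {C. C \<subseteq> G \<and> loose_cycle s k C}. S \<noteq> {} \<and>
     (\<forall>J\<subseteq>G. J \<noteq> {} \<longrightarrow> card J \<le> k \<longrightarrow>
        real (card {C\<in>S. J \<subseteq> C}) \<le> b / real (card G) * real (card S) * \<sigma> ^ (card J - 1)))"

text \<open>Multiplying the absolute codegree bound by
  \<open>card G \<le> \<sigma> ^ (k - 1) * card S\<close> makes it relative to
  \<open>card S\<close>.\<close>

lemma balanced_loose_cycles:
  fixes V :: "'a set" and G :: "'a set set" and p \<sigma> \<mu> :: real
  assumes V: "finite V" and G: "\<And>f. f \<in> G \<Longrightarrow> f \<subseteq> V \<and> card f = s" "G \<noteq> {}" and s: "s \<ge> 2" and k: "k \<ge> 3"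
    and p: "0 < p" "p \<le> 1" and \<sigma>: "0 < \<sigma>" "\<sigma> \<le> 1" "p ^ (s - 1) \<le> \<sigma>"
    and \<mu>: "0 \<le> \<mu>" "4 * \<mu> * p ^ (k * (s - 1)) \<le> \<sigma> ^ (k - 1) * p ^ s"
    and \<Psi>: "4 * bavg p V \<Psi> \<le> p ^ s * real (card G)"
    and find: "\<And>U F S. U \<subseteq> V \<Longrightarrow> F \<subseteq> {f\<in>G. f \<subseteq> U} \<Longrightarrow> S \<subseteq> {C. C \<subseteq> G \<and> loose_cycle s k C} \<Longrightarrow>
        \<Psi> U + \<mu> * real (card {C\<in>S. \<Union>C \<subseteq> U}) < real (card F) \<Longrightarrow>
        \<exists>C. loose_cycle s k C \<and> C \<subseteq> F \<and> C \<notin> S"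
  shows "balanced s k (2 ^ (k + 3)) \<sigma> G"
proof -
  have finG: "finite G" using V G(1) by (meson PowI finite_Pow_iff finite_subset subsetI)
  let ?C = "{C. C \<subseteq> G \<and> loose_cycle s k C}"
  have "\<exists>S\<subseteq>?C. real (card G) \<le> \<sigma> ^ (k - 1) * real (card S) \<and>
     (\<forall>J\<subseteq>G. J \<noteq> {} \<longrightarrow> card J \<le> k \<longrightarrow> real (card {C\<in>S. J \<subseteq> C}) * \<sigma> ^ (k - card J) \<le> 2 ^ (k + 3))"
  proof (rule balanced_family[where V = V and s = s and p = p and \<mu> = \<mu> and \<Psi> = \<Psi>])
    fix C assume "C \<in> ?C"
    then show "C \<subseteq> G \<and> card C = k" using loose_cycle_card k by auto
  next
    fix C J assume "C \<in> ?C" "J \<subseteq> C" "J \<noteq> {}"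
    then show "card J * (s - 1) + (if J = C then 0 else 1) \<le> card (\<Union>J)"
      using loose_cycle_span[of s k C J] k s by auto
  next
    fix U F S assume *: "U \<subseteq> V" "F \<subseteq> {f\<in>G. f \<subseteq> U}" "S \<subseteq> ?C" "\<Psi> U + \<mu> * real (card {C\<in>S. \<Union>C \<subseteq> U}) < real (card F)"
    show "\<exists>C\<in>?C. C \<subseteq> F \<and> C \<notin> S" using find[OF *] *(2) by blast
  qed (use assms in auto)
  then obtain S where S: "S \<subseteq> ?C" and le: "real (card G) \<le> \<sigma> ^ (k - 1) * real (card S)"
    and deg: "\<And>J. J \<subseteq> G \<Longrightarrow> J \<noteq> {} \<Longrightarrow> card J \<le> k \<Longrightarrow> real (card {C\<in>S. J \<subseteq> C}) * \<sigma> ^ (k - card J) \<le> 2 ^ (k + 3)"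
    by blast
  have N: "0 < real (card G)" using G(2) finG by (simp add: card_gt_0_iff)
  have "S \<noteq> {}" using le N by auto
  moreover have "real (card {C\<in>S. J \<subseteq> C}) \<le> 2 ^ (k + 3) / real (card G) * real (card S) * \<sigma> ^ (card J - 1)"
    if J: "J \<subseteq> G" "J \<noteq> {}" "card J \<le> k" for J
  proof -
    have "1 \<le> card J" using J(1,2) finG by (metis Suc_leI card_gt_0_iff finite_subset One_nat_def)
    then have e: "\<sigma> ^ (k - 1) = \<sigma> ^ (k - card J) * \<sigma> ^ (card J - 1)" using J(3) by (simp flip: power_add)
    have "real (card {C\<in>S. J \<subseteq> C}) * \<sigma> ^ (k - card J) * real (card G)
        \<le> 2 ^ (k + 3) * (\<sigma> ^ (k - 1) * real (card S))"
      using deg[OF J] le by (intro mult_mono) auto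
    then have "(real (card {C\<in>S. J \<subseteq> C}) * real (card G)) * \<sigma> ^ (k - card J)
        \<le> (2 ^ (k + 3) * real (card S) * \<sigma> ^ (card J - 1)) * \<sigma> ^ (k - card J)"
      unfolding e by (simp add: mult_ac)
    then have "real (card {C\<in>S. J \<subseteq> C}) * real (card G) \<le> 2 ^ (k + 3) * real (card S) * \<sigma> ^ (card J - 1)"
      using \<sigma>(1) by (meson mult_le_cancel_right_pos zero_less_power)
    then show ?thesis using N by (simp add: field_simps)
  qed
  ultimately show ?thesis unfolding balanced_def using S by blast
qed

text \<open>\<open>p\<close> is of order \<open>1 / X\<close>, about the density at which the
  expected number of edges in \<open>U\<close> overtakes a multiple of the expected number of shadow
  sets in \<open>U\<close>. The exponent \<open>e\<close> solves
  \<open>(p powr e) ^ (k - 1) * p ^ s = p ^ (k * (s - 1))\<close>, so the condition on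
  \<open>\<mu> = 1\<close> holds with nothing lost but constants.\<close>

lemma balanced_dense_shadow:
  fixes X :: real
  assumes V: "finite V" and G: "\<And>f. f \<in> G \<Longrightarrow> f \<subseteq> V \<and> card f = s" "G \<noteq> {}" and s: "s \<ge> 3" and k: "k \<ge> 3"
    and dense: "X * real (card (shadow G)) \<le> 2 * real (card G)"
    and X: "32 * real (k * s + 1) \<le> X"
  shows "balanced s k (2 ^ (k + 3)) (4 * (8 * real (k * s + 1) / X) powr ((real k * (real s - 1) - real s) / (real k - 1))) G"
proof -
  define m where "m = k * s + 1"
  define p where "p = 8 * real m / X"
  define e where "e = (real k * (real s - 1) - real s) / (real k - 1)"
  define \<sigma> where "\<sigma> = 4 * p powr e"
  have "0 < m" unfolding m_def by simp
  then have m: "0 < real m" by (rule of_nat_0_less_iff[THEN iffD2])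
  have Xm: "32 * real m \<le> X" using X by (simp add: m_def)
  then have X0: "0 < X" using m by linarith
  \<comment> \<open>The 32 in the hypothesis on \<open>X\<close> is spent here:
    \<open>p \<le> 1 / 4\<close> and \<open>1 \<le> e\<close> absorb the factor 4 in
    \<open>\<sigma>\<close>.\<close>
  have p: "0 < p" "p \<le> 1 / 4" unfolding p_def using m X0 Xm by (auto simp: field_simps)
  have finG: "finite G" using V G(1) by (meson PowI finite_Pow_iff finite_subset subsetI)
  have finf: "finite f" if "f \<in> G" for f using G(1)[OF that] V finite_subset by blast
  have k1: "0 < real k - 1" using k by simp
  have "real k - 1 \<le> real k * (real s - 1) - real s"
  proof -
    have "0 \<le> (real k - 1) * (real s - 3) + (real k - 2)" using k s by (intro add_nonneg_nonneg mult_nonneg_nonneg) auto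
    then show ?thesis by (simp add: algebra_simps)
  qed
  then have e1: "1 \<le> e" unfolding e_def using k1 by (simp add: field_simps)
  have e2: "e \<le> real (s - 1)" unfolding e_def using k1 s k by (simp add: field_simps of_nat_diff)
  have ek: "e * (real k - 1) = real k * (real s - 1) - real s" unfolding e_def using k1 by simp
  have \<sigma>0: "0 < \<sigma>" unfolding \<sigma>_def using p by simp
  have "p powr e \<le> p powr 1" using e1 p by (intro powr_mono') auto
  then have \<sigma>1: "\<sigma> \<le> 1" unfolding \<sigma>_def using p by simp
  have "p ^ (s - 1) = p powr real (s - 1)" using p by (simp add: powr_realpow)
  also have "\<dots> \<le> p powr e" using e2 p by (intro powr_mono') auto
  also have "\<dots> \<le> \<sigma>" unfolding \<sigma>_def using p by simp
  finally have \<sigma>p: "p ^ (s - 1) \<le> \<sigma>" .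
  have "balanced s k (2 ^ (k + 3)) \<sigma> G"
  proof (rule balanced_loose_cycles[OF V G(1) G(2) _ k p(1) _ \<sigma>0 \<sigma>1 \<sigma>p, where \<mu> = 1
       and \<Psi> = "\<lambda>U. real m * real (card {g\<in>shadow G. g \<subseteq> U})"])
    have pe: "(p powr e) ^ (k - 1) * p ^ s = p ^ (k * (s - 1))"
    proof -
      have "(p powr e) ^ (k - 1) * p ^ s = p powr (e * (real k - 1)) * p powr real s"
        using p k by (simp add: powr_realpow[symmetric] powr_powr of_nat_diff)
      also have "\<dots> = p powr (real (k * (s - 1)))" unfolding ek using s by (simp add: of_nat_diff flip: powr_add)
      also have "\<dots> = p ^ (k * (s - 1))" using p by (intro powr_realpow) auto
      finally show ?thesis .
    qed
    have "4 * 1 * p ^ (k * (s - 1)) = 4 ^ 1 * ((p powr e) ^ (k - 1) * p ^ s)" unfolding pe by simp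
    also have "\<dots> \<le> 4 ^ (k - 1) * ((p powr e) ^ (k - 1) * p ^ s)"
      using k p by (intro mult_right_mono power_increasing) auto
    also have "\<dots> = \<sigma> ^ (k - 1) * p ^ s" unfolding \<sigma>_def by (simp add: power_mult_distrib)
    finally show "4 * 1 * p ^ (k * (s - 1)) \<le> \<sigma> ^ (k - 1) * p ^ s" .
    have sub: "g \<subseteq> V \<and> card g = s - 1" if "g \<in> shadow G" for g
      using that G(1) finf unfolding shadow_def by (auto simp: card_Diff_singleton_if)
    have "bavg p V (\<lambda>U. real (card {g\<in>shadow G. g \<subseteq> U})) = (\<Sum>g\<in>shadow G. p ^ card g)"
      using sub by (intro bavg_count[OF V finite_shadow[OF finG finf]]) auto
    also have "\<dots> = real (card (shadow G)) * p ^ (s - 1)" using sub by simp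
    finally have "4 * bavg p V (\<lambda>U. real m * real (card {g\<in>shadow G. g \<subseteq> U}))
      = 4 * real m * p ^ (s - 1) * real (card (shadow G))" by (simp add: bavg_cmult)
    also have "\<dots> = 4 * real m * p ^ (s - 1) * (X * real (card (shadow G))) / X" using X0 by simp
    also have "\<dots> \<le> 4 * real m * p ^ (s - 1) * (2 * real (card G)) / X"
      using dense m p X0 by (intro divide_right_mono mult_left_mono) auto
    also have "\<dots> = p * p ^ (s - 1) * real (card G)" by (simp add: p_def)
    also have "p * p ^ (s - 1) = p ^ s" using s by (cases s) auto
    finally show "4 * bavg p V (\<lambda>U. real m * real (card {g\<in>shadow G. g \<subseteq> U})) \<le> p ^ s * real (card G)" .
  next
    fix U F S assume U: "U \<subseteq> V" "F \<subseteq> {f\<in>G. f \<subseteq> U}" and S: "S \<subseteq> {C. C \<subseteq> G \<and> loose_cycle s k C}"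
      and big: "real m * real (card {g\<in>shadow G. g \<subseteq> U}) + 1 * real (card {C\<in>S. \<Union>C \<subseteq> U}) < real (card F)"
    define pick where "pick C = (SOME f. f \<in> C)" for C :: "'a set set"
    define T where "T = {C\<in>S. C \<subseteq> F}"
    have pick: "pick C \<in> C" if "C \<in> T" for C
    proof -
      have "card C = k" using that S k loose_cycle_card unfolding T_def by blast
      then have "C \<noteq> {}" using k by auto
      then show ?thesis unfolding pick_def some_in_eq .
    qed
    have finF: "finite F" by (rule finite_subset[OF U(2)]) (use finG in simp)
    have finS: "finite S" by (rule finite_subset[OF S]) (use finG in simp)
    \<comment> \<open>A cycle that avoids one edge of every chosen cycle inside \<open>F\<close> is
      new.\<close>
    define H where "H = F - pick ` T"
    have "card F - card (pick ` T) \<le> card H" unfolding H_def T_def using finS by (intro diff_card_le_card_Diff) auto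
    moreover have "card (pick ` T) \<le> card T" unfolding T_def using finS by (intro card_image_le) auto
    moreover have "card T \<le> card {C\<in>S. \<Union>C \<subseteq> U}"
      using finS U(2) unfolding T_def by (intro card_mono) auto
    ultimately have cH: "real (card F) \<le> real (card H) + real (card {C\<in>S. \<Union>C \<subseteq> U})" by linarith
    have HG: "H \<subseteq> G" using U(2) unfolding H_def by blast
    have "shadow H \<subseteq> {g\<in>shadow G. g \<subseteq> U}"
      using U(2) HG unfolding shadow_def H_def by blast
    then have "card (shadow H) \<le> card {g\<in>shadow G. g \<subseteq> U}"
      using finite_shadow[OF finG finf] by (intro card_mono) auto
    then have "real m * real (card (shadow H)) \<le> real m * real (card {g\<in>shadow G. g \<subseteq> U})"
      using m by (intro mult_left_mono of_nat_mono) auto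
    then have "real (m * card (shadow H)) < real (card H)" using big cH by simp
    then have "m * card (shadow H) < card H" by (simp only: of_nat_less_iff)
    moreover have "finite H" using HG finG finite_subset by blast
    ultimately obtain C where C: "C \<subseteq> H" "loose_cycle s k C"
      using loose_cycle_of_dense_shadow[of H s k] G(1) HG s k unfolding m_def by blast
    have CF: "C \<subseteq> F" using C(1) unfolding H_def by blast
    moreover have "C \<notin> S"
    proof
      assume "C \<in> S"
      then have "C \<in> T" using CF by (simp add: T_def)
      then have "pick C \<notin> H" unfolding H_def by blast
      then show False using pick[OF \<open>C \<in> T\<close>] C(1) by blast
    qed
    ultimately show "\<exists>C. loose_cycle s k C \<and> C \<subseteq> F \<and> C \<notin> S" using C(2) by blast
  qed (use s p in auto)
  then show ?thesis unfolding \<sigma>_def p_def e_def m_def .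
qed

text \<open>The scale \<open>m\<close> is the expected size of a random subset \<open>U\<close>.  The hypothesis is quadratic in
  \<open>card U\<close> and the conclusion linear in \<open>card F\<close>, so that both can be averaged over \<open>U\<close> without a
  concentration inequality.\<close>

lemma supersaturated_graph_cycles:
  fixes F :: "'a set set" and m :: real
  assumes U: "finite U" and F: "\<And>e. e \<in> F \<Longrightarrow> e \<subseteq> U \<and> card e = 2" and l: "l \<ge> 2" and m: "m > 0"
    and dense: "16 * (real l)\<^sup>2 * m powr (1 + 1 / real l) * (1 + (real (card U) / m)\<^sup>2) < real (card F)"
  shows "real (card F) * m powr (1 - 1 / real l) / (32 * (real l)\<^sup>2 * (4 * real l) ^ (2 * l))
     \<le> real (card {C. C \<subseteq> F \<and> loose_cycle 2 (2 * l) C})"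
proof -
  define K where "K = 16 * (real l)\<^sup>2"
  define u where "u = real (card U)"
  \<comment> \<open>\<open>v\<close> compares \<open>U\<close> with the scale \<open>m\<close>, and
    \<open>y \<ge> 1\<close> is the excess over the threshold. The degree \<open>\<delta>\<close>
    then factorises with a factor \<open>v + 1 / v\<close>, which is at least both 1 and
    \<open>v powr (1 / l)\<close>; this makes the cycle count applicable to sets \<open>U\<close> of
    every size.\<close>
  define v where "v = u / m"
  define f where "f = real (card F)"
  define \<delta> where "\<delta> = f / (2 * u)"
  define y where "y = f / (K * m powr (1 + 1 / real l) * (1 + v\<^sup>2))"
  have "4 \<le> (real l)\<^sup>2" using l power_mono[of 2 "real l" 2] by simp
  then have K: "64 \<le> K" unfolding K_def by simp
  have den: "0 < K * m powr (1 + 1 / real l) * (1 + v\<^sup>2)" using K m by (intro mult_pos_pos) (auto intro: add_pos_nonneg)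
  have big: "K * m powr (1 + 1 / real l) * (1 + v\<^sup>2) < f" using dense by (simp add: K_def f_def v_def u_def)
  then have f0: "0 < f" using den by linarith
  have "F \<noteq> {}" using f0 unfolding f_def by auto
  then obtain e where "e \<in> F" by blast
  then have "card U \<noteq> 0" using F[of e] U by auto
  then have u1: "1 \<le> u" unfolding u_def by simp
  have v0: "0 < v" unfolding v_def using u1 m by simp
  have y1: "1 \<le> y" unfolding y_def using big den by simp
  have f_eq: "f = y * (K * m powr (1 + 1 / real l) * (1 + v\<^sup>2))"     using y_def den nonzero_eq_divide_eq[of "K * m powr (1 + 1 / real l) * (1 + v\<^sup>2)" y f] by linarith
  have u_eq: "u = v * m" unfolding v_def using m by simp
  have mp: "m powr (1 + 1 / real l) = m powr (1 / real l) * m" using m by (simp add: powr_add)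
  have \<delta>_eq: "\<delta> = y * (K / 2) * m powr (1 / real l) * (v + 1 / v)"
    unfolding \<delta>_def f_eq u_eq mp using m v0 by (simp add: field_simps power2_eq_square)
  have vv: "1 \<le> v + 1 / v" using v0
  proof (cases "v \<le> 1")
    case True
    then have "1 \<le> 1 / v" using v0 by simp
    then show ?thesis using v0 by linarith
  next
    case False
    then have "0 < 1 / v" using v0 by simp
    then show ?thesis using False by linarith
  qed
  have vl: "v powr (1 / real l) \<le> v + 1 / v"
  proof (cases "v \<le> 1")
    case True
    then have "v powr (1 / real l) \<le> 1 powr (1 / real l)" using v0 by (intro powr_mono2) auto
    then show ?thesis using vv by simp
  next
    case False
    then have "v powr (1 / real l) \<le> v powr 1" using l by (intro powr_mono) auto
    moreover have "0 < 1 / v" using v0 by simp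
    moreover have "v powr 1 = v" using v0 by simp
    ultimately show ?thesis by linarith
  qed
  have \<delta>0: "0 < \<delta>" unfolding \<delta>_def using f0 u1 by simp
  have "root l u = u powr (1 / real l)" using u1 l by (simp add: root_powr_inverse)
  also have "\<dots> = m powr (1 / real l) * v powr (1 / real l)" unfolding u_eq using m v0 by (simp add: powr_mult)
  also have "\<dots> \<le> m powr (1 / real l) * (v + 1 / v)" using vl by (intro mult_left_mono) auto
  finally have r: "root l u \<le> m powr (1 / real l) * (v + 1 / v)" .
  have "8 * (real l)\<^sup>2 * root l u \<le> (K / 2) * (m powr (1 / real l) * (v + 1 / v))"
    unfolding K_def using r by (simp add: mult_left_mono)
  also have "\<dots> \<le> y * ((K / 2) * (m powr (1 / real l) * (v + 1 / v)))"
    using y1 K vv mult_right_mono[of 1 y "(K / 2) * (m powr (1 / real l) * (v + 1 / v))"] by simp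
  also have "\<dots> = \<delta>" unfolding \<delta>_eq by simp
  finally have bigd: "8 * (real l)\<^sup>2 * root l (real (card U)) \<le> \<delta>" by (simp add: u_def)
  have "\<delta> * real (card U) < real (card F)" unfolding \<delta>_def u_def[symmetric] f_def[symmetric] using u1 f0 by simp
  from many_loose_graph_cycles[OF U F l \<delta>0 this bigd]
  have many: "\<delta> ^ (2 * l) / (2 * (4 * real l) ^ (2 * l)) \<le> real (card {C. C \<subseteq> F \<and> loose_cycle 2 (2 * l) C})" .
  have "f * m powr (1 - 1 / real l) / K = y * (1 + v\<^sup>2) * (m powr (1 + 1 / real l) * m powr (1 - 1 / real l))"
    unfolding f_eq using K by simp
  also have "m powr (1 + 1 / real l) * m powr (1 - 1 / real l) = m\<^sup>2" using m
    by (simp add: powr_add[symmetric] powr_numeral)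
  \<comment> \<open>Replacing \<open>y ^ (2 * l)\<close> by \<open>y\<close> is wasteful for a large
    excess, but it is what makes the count linear in \<open>card F\<close>.\<close>
  also have "y * (1 + v\<^sup>2) * m\<^sup>2 \<le> \<delta> ^ (2 * l)"
  proof -
    have "(m powr (1 / real l)) ^ (2 * l) = m powr (1 / real l * real (2 * l))"
      using m by (simp add: powr_realpow[symmetric] powr_powr)
    also have "\<dots> = m\<^sup>2" using m l by (simp add: powr_numeral)
    finally have ml: "(m powr (1 / real l)) ^ (2 * l) = m\<^sup>2" .
    have 1: "y \<le> y ^ (2 * l)" using y1 l by (intro self_le_power) auto
    have 2: "1 \<le> (K / 2) ^ (2 * l)" using K by (intro one_le_power) simp
    have "1 + v\<^sup>2 \<le> (v + 1 / v)\<^sup>2" using v0 by (simp add: power2_eq_square field_simps)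
    also have "\<dots> \<le> (v + 1 / v) ^ (2 * l)" using vv l by (intro power_increasing) auto
    finally have 3: "1 + v\<^sup>2 \<le> (v + 1 / v) ^ (2 * l)" .
    have "y * 1 * (1 + v\<^sup>2) * m\<^sup>2 \<le> y ^ (2 * l) * (K / 2) ^ (2 * l) * (v + 1 / v) ^ (2 * l) * m\<^sup>2"
      using 1 2 3 y1 K by (intro mult_mono mult_nonneg_nonneg) auto
    also have "\<dots> = \<delta> ^ (2 * l)" unfolding \<delta>_eq power_mult_distrib ml by (simp add: mult_ac)
    finally show ?thesis by simp
  qed
  finally have "f * m powr (1 - 1 / real l) / K \<le> \<delta> ^ (2 * l)" .
  then have "f * m powr (1 - 1 / real l) / K / (2 * (4 * real l) ^ (2 * l)) \<le> \<delta> ^ (2 * l) / (2 * (4 * real l) ^ (2 * l))"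
    by (intro divide_right_mono) auto
  also note many
  finally show ?thesis by (simp add: K_def f_def)
qed

lemma bavg_const: assumes "finite V" shows "bavg p V (\<lambda>_. c) = c"
  using bavg_superset[OF assms, of "{}" p] bavg_cmult[of p V c "\<lambda>_. 1"] by simp

lemma bavg_card_square_le:
  assumes V: "finite V" and p: "0 \<le> p"
  shows "bavg p V (\<lambda>U. (real (card U))\<^sup>2) \<le> real (card V) * p + (real (card V) * p)\<^sup>2"
proof -
  define h where "h a = {fst a, snd a}" for a :: "'a \<times> 'a"
  have "real (card U) ^ 2 = real (card {a \<in> V \<times> V. h a \<subseteq> U})" if "U \<in> Pow V" for U
  proof -
    have "{a \<in> V \<times> V. h a \<subseteq> U} = U \<times> U" using that by (auto simp: h_def)
    then show ?thesis by (simp add: card_cartesian_product power2_eq_square)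
  qed
  then have "bavg p V (\<lambda>U. (real (card U))\<^sup>2) = bavg p V (\<lambda>U. real (card {a \<in> V \<times> V. h a \<subseteq> U}))"
    unfolding bavg_def by (intro sum.cong) auto
  also have "\<dots> = (\<Sum>a\<in>V \<times> V. p ^ card (h a))"
    using V by (intro bavg_count) (auto simp: h_def)
  also have "\<dots> \<le> (\<Sum>a\<in>V \<times> V. (if fst a = snd a then p else 0) + p\<^sup>2)"
    using p by (intro sum_mono) (auto simp: h_def power2_eq_square)
  also have "\<dots> = (\<Sum>x\<in>V. \<Sum>y\<in>V. (if x = y then p else 0) + p\<^sup>2)"
    unfolding sum.cartesian_product by (simp add: case_prod_unfold)
  also have "\<dots> = real (card V) * p + (real (card V) * p)\<^sup>2"
    using V by (simp add: sum.distrib power2_eq_square algebra_simps)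
  finally show ?thesis .
qed

text \<open>\<open>p\<close> solves \<open>p powr (1 - 1 / l) = b / \<kappa>\<close>: a random set
  of expected size \<open>m = p * n\<close> then has just enough edges to force cycles. The
  condition \<open>p \<le> \<sigma>\<close> produces the first term of the maximum, the condition on
  \<open>\<mu>\<close> the second.\<close>

lemma balanced_graph:
  fixes V :: "'a set" and \<kappa> :: real
  defines "K \<equiv> \<lambda>l. 16 * (real l)\<^sup>2" and "M \<equiv> \<lambda>l. 32 * (real l)\<^sup>2 * (4 * real l) ^ (2 * l)"
  assumes V: "finite V" and G: "\<And>f. f \<in> G \<Longrightarrow> f \<subseteq> V \<and> card f = 2" "G \<noteq> {}" and l: "l \<ge> 2"
    and \<kappa>: "\<kappa> * real (card V) powr (1 + 1 / real l) \<le> real (card G)"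
    and large: "4 * M l * (12 * K l)\<^sup>2 \<le> \<kappa>"
  shows "balanced 2 (2 * l) (2 ^ (2 * l + 3)) (4 * M l * (12 * K l)\<^sup>2 *
      max (\<kappa> powr (- (real l / (real l - 1))))
          (\<kappa> powr (- 1) * real (card V) powr (- ((real l - 1) / (real l * (2 * real l - 1)))))) G"
proof -
  define n where "n = real (card V)"
  \<comment> \<open>12 is 4 times 3: the 4 stands in the requirement on \<open>\<Psi>\<close>, and 3
    bounds the average of \<open>1 + (card U / m)\<^sup>2\<close>.\<close>
  define b where "b = 12 * K l"
  define a where "a = 1 - 1 / real l"
  define g where "g = (real l - 1) / (real l * (2 * real l - 1))"
  define c where "c = 4 * M l * b\<^sup>2"
  define p where "p = (b / \<kappa>) powr (1 / a)"
  define m where "m = p * n"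
  define \<sigma> where "\<sigma> = c * max (\<kappa> powr (- (1 / a))) (\<kappa> powr (- 1) * n powr (- g))"
  have l2: "2 \<le> real l" using l by simp
  have a: "1 / 2 \<le> a" "a < 1" "0 < a" unfolding a_def using l2 by (auto simp: field_simps)
  have ia: "1 / a = real l / (real l - 1)" unfolding a_def using l2 by (simp add: field_simps)
  have ia2: "1 / a \<le> 2" "1 \<le> 1 / a" using a by (auto simp: field_simps)
  have ga: "g * (2 * real l - 1) = a" unfolding g_def a_def using l2 by (simp add: field_simps)
  have g0: "0 \<le> g" unfolding g_def using l2 by simp
  have "4 \<le> (real l)\<^sup>2" using l2 power_mono[of 2 "real l" 2] by simp
  then have K: "64 \<le> K l" unfolding K_def by simp
  then have b: "768 \<le> b" unfolding b_def by simp
  have M: "1 \<le> M l"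
  proof -
    have "1 * 1 \<le> (32 * (real l)\<^sup>2) * (4 * real l) ^ (2 * l)"
      using l2 \<open>4 \<le> (real l)\<^sup>2\<close> by (intro mult_mono one_le_power) auto
    then show ?thesis by (simp add: M_def)
  qed
  have b2: "b * 768 \<le> b\<^sup>2" unfolding power2_eq_square using b by (intro mult_left_mono) auto
  have "1 * b\<^sup>2 \<le> 4 * M l * b\<^sup>2" using M by (intro mult_right_mono) auto
  then have c_ge: "b\<^sup>2 \<le> c" unfolding c_def by simp
  have c\<kappa>: "c \<le> \<kappa>" using large by (simp add: c_def b_def)
  have \<kappa>0: "0 < \<kappa>" "b \<le> \<kappa>" "1 \<le> \<kappa>" using c\<kappa> c_ge b2 b by auto
  have c0: "1 \<le> c" using c_ge b2 b by linarith
  have finG: "finite G" using V G(1) by (meson PowI finite_Pow_iff finite_subset subsetI)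
  have n1: "1 \<le> n"
  proof -
    obtain f where "f \<in> G" using G(2) by blast
    then have "V \<noteq> {}" using G(1)[of f] by auto
    then show ?thesis unfolding n_def using V by (simp add: Suc_le_eq card_gt_0_iff)
  qed
  have p0: "0 < p" unfolding p_def using b \<kappa>0 by simp
  have pa: "p powr a = b / \<kappa>" unfolding p_def powr_powr using a b \<kappa>0 by simp
  have "p \<le> 1 powr (1 / a)" unfolding p_def using b \<kappa>0 a by (intro powr_mono2) auto
  then have p1: "p \<le> 1" by simp
  \<comment> \<open>The trivial bound on the number of edges caps \<open>\<kappa>\<close> and so
    gives \<open>1 \<le> m\<close>, by which \<open>m\<close> is at most \<open>m\<^sup>2\<close> in
    the second moment.\<close>
  have "real (card G) \<le> n\<^sup>2"
  proof -
    have "G \<subseteq> (\<lambda>(x, y). {x, y}) ` (V \<times> V)"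
    proof
      fix f assume f: "f \<in> G"
      then obtain x y where "f = {x, y}" using G(1)[of f] by (auto simp: card_2_iff)
      then show "f \<in> (\<lambda>(x, y). {x, y}) ` (V \<times> V)" using G(1)[OF f] by auto
    qed
    then have "card G \<le> card (V \<times> V)" using V by (intro surj_card_le) auto
    then have "real (card G) \<le> real (card V * card V)" unfolding card_cartesian_product by (rule of_nat_mono)
    then show ?thesis by (simp add: n_def power2_eq_square)
  qed
  then have "\<kappa> * n powr (1 + 1 / real l) \<le> n powr a * n powr (1 + 1 / real l)"
    using \<kappa> n1 by (simp add: n_def[symmetric] a_def powr_add[symmetric])
  then have \<kappa>n: "\<kappa> \<le> n powr a" using n1 by (simp add: mult_le_cancel_right)
  have m1: "1 \<le> m"
  proof -
    have "1 \<le> b / \<kappa> * n powr a" using \<kappa>n b \<kappa>0 mult_mono[of 1 b \<kappa> "n powr a"] by (simp add: field_simps)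
    also have "\<dots> = m powr a" unfolding m_def pa[symmetric] using p0 n1 by (simp add: powr_mult)
    finally have "1 powr (1 / a) \<le> (m powr a) powr (1 / a)" using a by (intro powr_mono2) auto
    then show ?thesis using a p0 n1 by (simp add: powr_powr m_def)
  qed
  have \<sigma>0: "0 < \<sigma>" unfolding \<sigma>_def using c0 \<kappa>0 n1 by (intro mult_pos_pos) (auto simp: less_max_iff_disj)
  have \<sigma>1: "\<sigma> \<le> 1"
  proof -
    have "\<kappa> powr (- (1 / a)) \<le> \<kappa> powr (- 1)" using \<kappa>0 ia2 by (intro powr_mono) auto
    moreover have "\<kappa> powr (- 1) * n powr (- g) \<le> \<kappa> powr (- 1) * 1"
      using n1 g0 powr_mono[of "- g" 0 n] by (intro mult_left_mono) auto
    ultimately have "\<sigma> \<le> c * \<kappa> powr (- 1)" unfolding \<sigma>_def using c0 by (intro mult_left_mono) auto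
    also have "\<dots> = c / \<kappa>" using \<kappa>0 by (simp add: powr_minus divide_inverse)
    also have "\<dots> \<le> 1" using c\<kappa> \<kappa>0 by simp
    finally show ?thesis .
  qed
  have \<sigma>p: "p ^ (2 - 1) \<le> \<sigma>"
  proof -
    have "p = b powr (1 / a) * \<kappa> powr (- (1 / a))" unfolding p_def using b \<kappa>0 by (simp add: powr_divide powr_minus_divide)
    also have "\<dots> \<le> b powr 2 * \<kappa> powr (- (1 / a))" using b ia2 by (intro mult_right_mono powr_mono) auto
    also have "\<dots> \<le> c * \<kappa> powr (- (1 / a))" using c_ge b by (intro mult_right_mono) (auto simp: powr_numeral)
    also have "\<dots> \<le> \<sigma>" unfolding \<sigma>_def using c0 by (intro mult_left_mono) auto
    finally show ?thesis by simp
  qed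
  have ma: "m powr a = b / \<kappa> * n powr a" unfolding m_def using pa p0 n1 by (simp add: powr_mult)
  define \<mu> where "\<mu> = M l / m powr a"
  define \<Psi> where "\<Psi> = (\<lambda>U :: 'a set. K l * m powr (1 + 1 / real l) * (1 + (real (card U) / m)\<^sup>2))"
  have "balanced 2 (2 * l) (2 ^ (2 * l + 3)) \<sigma> G"
  proof (rule balanced_loose_cycles[OF V G(1) G(2) _ _ p0 p1 \<sigma>0 \<sigma>1 \<sigma>p, where \<mu> = \<mu> and \<Psi> = \<Psi>])
    show "0 \<le> \<mu>" unfolding \<mu>_def using M by simp
    show "4 * \<mu> * p ^ (2 * l * (2 - 1)) \<le> \<sigma> ^ (2 * l - 1) * p\<^sup>2"
    proof -
      \<comment> \<open>Since \<open>2 * l - 2 = a * (2 * l)\<close>, this power of \<open>p\<close>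
        is a power of \<open>b / \<kappa>\<close>. What is left over, \<open>n powr (- a)\<close>,
        becomes \<open>n powr (- g)\<close> under the root of order
        \<open>2 * l - 1\<close>.\<close>
      have "p ^ (2 * l - 2) = p powr (a * (2 * real l))"
        using p0 l2 l by (simp add: powr_realpow[symmetric] of_nat_diff a_def algebra_simps)
      also have "\<dots> = (b / \<kappa>) powr (2 * real l)" unfolding pa[symmetric] powr_powr ..
      also have "\<dots> = (b / \<kappa>) ^ (2 * l)" using b \<kappa>0 by (subst powr_realpow[symmetric]) auto
      finally have pl: "p ^ (2 * l - 2) = (b / \<kappa>) ^ (2 * l)" .
      have e: "2 * l = Suc (2 * l - 1)" using l by simp
      have "4 * \<mu> * p ^ (2 * l - 2) = 4 * M l / (b / \<kappa> * n powr a) * ((b / \<kappa>) * (b / \<kappa>) ^ (2 * l - 1))"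
        unfolding pl \<mu>_def ma by (subst e) simp
      also have "\<dots> = 4 * M l * (b / \<kappa>) ^ (2 * l - 1) * n powr (- a)"
        using b \<kappa>0 n1 by (simp add: powr_minus field_simps)
      also have "\<dots> \<le> (4 * M l) ^ (2 * l - 1) * (b / \<kappa>) ^ (2 * l - 1) * n powr (- a)"
        using M l b \<kappa>0 by (intro mult_right_mono self_le_power) auto
      also have "n powr (- a) = (n powr (- g)) ^ (2 * l - 1)"
        using n1 l ga by (simp add: powr_realpow[symmetric] powr_powr of_nat_diff)
      also have "(4 * M l) ^ (2 * l - 1) * (b / \<kappa>) ^ (2 * l - 1) * (n powr (- g)) ^ (2 * l - 1)
         = (4 * M l * b * (\<kappa> powr (- 1) * n powr (- g))) ^ (2 * l - 1)"
        using \<kappa>0 by (simp add: power_mult_distrib powr_minus divide_inverse)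
      also have "\<dots> \<le> \<sigma> ^ (2 * l - 1)"
      proof (rule power_mono)
        have "4 * M l * b \<le> c" unfolding c_def using b2 b M by (intro mult_left_mono) auto
        then show "4 * M l * b * (\<kappa> powr (- 1) * n powr (- g)) \<le> \<sigma>"
          unfolding \<sigma>_def using c0 by (intro mult_mono) auto
      qed (use M b in auto)
      finally have "4 * \<mu> * p ^ (2 * l - 2) * p\<^sup>2 \<le> \<sigma> ^ (2 * l - 1) * p\<^sup>2" by (rule mult_right_mono) simp
      moreover have "p ^ (2 * l * (2 - 1)) = p ^ (2 * l - 2) * p\<^sup>2"
        unfolding power_add[symmetric] using l by (intro arg_cong[where f = "(^) p"]) simp
      ultimately show ?thesis by (simp add: mult_ac)
    qed
    show "4 * bavg p V \<Psi> \<le> p\<^sup>2 * real (card G)"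
    proof -
      have "bavg p V \<Psi> = K l * m powr (1 + 1 / real l) * (1 + bavg p V (\<lambda>U. (real (card U))\<^sup>2) / m\<^sup>2)"
        unfolding \<Psi>_def bavg_cmult bavg_add bavg_const[OF V] power_divide
        using bavg_cmult[of p V "1 / m\<^sup>2" "\<lambda>U. (real (card U))\<^sup>2"] by simp
      also have "\<dots> \<le> K l * m powr (1 + 1 / real l) * 3"
      proof (rule mult_left_mono)
        have "bavg p V (\<lambda>U. (real (card U))\<^sup>2) \<le> m + m\<^sup>2"
          using bavg_card_square_le[OF V, of p] p0 by (simp add: m_def n_def mult.commute)
        also have "\<dots> \<le> 2 * m\<^sup>2" using m1 self_le_power[of m 2] by simp
        finally show "1 + bavg p V (\<lambda>U. (real (card U))\<^sup>2) / m\<^sup>2 \<le> 3" using m1 by (simp add: divide_le_eq)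
      qed (use K in simp)
      finally have "4 * bavg p V \<Psi> \<le> b * (p powr (1 + 1 / real l) * n powr (1 + 1 / real l))"
        unfolding b_def m_def using p0 n1 by (simp add: powr_mult mult_ac)
      also have "\<dots> = (\<kappa> * p powr a) * p powr (1 + 1 / real l) * n powr (1 + 1 / real l)"
        unfolding pa using \<kappa>0 by simp
      also have "\<dots> = p\<^sup>2 * (\<kappa> * n powr (1 + 1 / real l))"
      proof -
        have "p powr a * p powr (1 + 1 / real l) = p\<^sup>2" using p0 by (simp add: a_def powr_numeral flip: powr_add)
        then show ?thesis by (simp add: mult_ac)
      qed
      also have "\<dots> \<le> p\<^sup>2 * real (card G)" using \<kappa> by (intro mult_left_mono) (auto simp: n_def)
      finally show ?thesis .
    qed
    fix U F S assume U: "U \<subseteq> V" "F \<subseteq> {f\<in>G. f \<subseteq> U}" and S: "S \<subseteq> {C. C \<subseteq> G \<and> loose_cycle 2 (2 * l) C}"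
      and big: "\<Psi> U + \<mu> * real (card {C\<in>S. \<Union>C \<subseteq> U}) < real (card F)"
    have finU: "finite U" using U(1) V finite_subset by blast
    have finS: "finite S" by (rule finite_subset[OF S]) (use finG in simp)
    have F: "e \<subseteq> U \<and> card e = 2" if "e \<in> F" for e using that U(2) G(1) by auto
    have m0: "0 < m" using m1 by simp
    have "0 \<le> \<mu> * real (card {C\<in>S. \<Union>C \<subseteq> U})" unfolding \<mu>_def using M by simp
    then have dense: "16 * (real l)\<^sup>2 * m powr (1 + 1 / real l) * (1 + (real (card U) / m)\<^sup>2) < real (card F)"
      using big unfolding \<Psi>_def K_def by linarith
    have "0 \<le> \<Psi> U" unfolding \<Psi>_def using K by simp
    then have "\<mu> * real (card {C\<in>S. \<Union>C \<subseteq> U}) < real (card F)" using big by linarith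
    then have "real (card {C\<in>S. \<Union>C \<subseteq> U}) < real (card F) * m powr a / M l"
      unfolding \<mu>_def using M m0 by (simp add: field_simps)
    also have "\<dots> \<le> real (card {C. C \<subseteq> F \<and> loose_cycle 2 (2 * l) C})"
      using supersaturated_graph_cycles[OF finU F l m0 dense] unfolding a_def M_def .
    \<comment> \<open>Nothing is deleted here, unlike over a small shadow: \<open>F\<close> holds
      more cycles than \<open>S\<close> has inside \<open>U\<close>, so counting alone yields a new
      one.\<close>
    finally have less: "card {C\<in>S. \<Union>C \<subseteq> U} < card {C. C \<subseteq> F \<and> loose_cycle 2 (2 * l) C}" by simp
    show "\<exists>C. loose_cycle 2 (2 * l) C \<and> C \<subseteq> F \<and> C \<notin> S"
    proof (rule ccontr)
      assume "\<not> ?thesis"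
      then have "{C. C \<subseteq> F \<and> loose_cycle 2 (2 * l) C} \<subseteq> {C\<in>S. \<Union>C \<subseteq> U}" using U(2) by blast
      then have "card {C. C \<subseteq> F \<and> loose_cycle 2 (2 * l) C} \<le> card {C\<in>S. \<Union>C \<subseteq> U}"
        using finS by (intro card_mono) auto
      then show False using less by simp
    qed
  qed (use l in auto)
  then show ?thesis unfolding \<sigma>_def c_def b_def ia g_def n_def .
qed

section \<open>Reduction of the uniformity\<close>

lemma sum_card_fibres_le:
  assumes "finite D" "finite T"
  shows "(\<Sum>g\<in>T. card {f\<in>D. \<phi> f = g}) \<le> card D"
proof -
  have "(\<Sum>g\<in>T. card {f\<in>D. \<phi> f = g}) = card (\<Union>g\<in>T. {f\<in>D. \<phi> f = g})"
    using assms by (intro card_UN_disjoint[symmetric]) auto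
  also have "\<dots> \<le> card D" using assms by (intro card_mono) auto
  finally show ?thesis .
qed

text \<open>Take a maximal set of edges assigned to subsets with fibres at most \<open>X\<close>. If
  it is less than half of \<open>G\<close>, every shadow set of the remaining edges has a fibre of
  size at least \<open>X / 2\<close>, as otherwise it could receive another edge. These fibres are
  disjoint parts of the assigned minority, so the shadow is small.\<close>

lemma shadow_assignment:
  fixes X :: real
  assumes G: "finite G" "\<forall>f\<in>G. finite f" and X: "1 \<le> X"
  obtains (sparse) D \<phi> where "D \<subseteq> G" "card G \<le> 2 * card D" "\<And>f. f \<in> D \<Longrightarrow> \<exists>x\<in>f. \<phi> f = f - {x}"
      "\<And>g. real (card {f\<in>D. \<phi> f = g}) \<le> X"
  | (dense) R where "R \<subseteq> G" "card G \<le> 2 * card R" "X * real (card (shadow R)) \<le> 2 * real (card R)"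
proof -
  define ok where "ok \<phi> D \<longleftrightarrow> D \<subseteq> G \<and> (\<forall>f\<in>D. \<exists>x\<in>f. \<phi> f = f - {x}) \<and> (\<forall>g. real (card {f\<in>D. \<phi> f = g}) \<le> X)"
    for D and \<phi> :: "'a set \<Rightarrow> 'a set"
  have "ok \<phi> {}" for \<phi> unfolding ok_def using X by simp
  moreover have "finite {D. \<exists>\<phi>. ok \<phi> D}" by (rule finite_subset[of _ "Pow G"]) (use G(1) in \<open>auto simp: ok_def\<close>)
  moreover have "{D. \<exists>\<phi>. ok \<phi> D} \<noteq> {}" using \<open>\<And>\<phi>. ok \<phi> {}\<close> by auto
  ultimately obtain D where D: "D \<in> {D. \<exists>\<phi>. ok \<phi> D}" and "\<forall>D'\<in>{D. \<exists>\<phi>. ok \<phi> D}. D \<subseteq> D' \<longrightarrow> D = D'"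
    using finite_has_maximal[of "{D. \<exists>\<phi>. ok \<phi> D}"] by auto
  then have max: "D = D'" if "ok \<phi> D'" "D \<subseteq> D'" for D' \<phi> using that by simp metis
  obtain \<phi> where \<phi>: "ok \<phi> D" using D by auto
  have DG: "D \<subseteq> G" using \<phi> by (simp add: ok_def)
  have finD: "finite D" using DG G(1) finite_subset by blast
  show ?thesis
  proof (cases "card G \<le> 2 * card D")
    case True
    then show ?thesis using sparse[of D \<phi>] \<phi> unfolding ok_def by blast
  next
    case False
    define R where "R = G - D"
    have cR: "card G = card R + card D" unfolding R_def using DG G(1) finD
      by (simp add: card_Diff_subset card_mono)
    have fs: "finite (shadow R)" using G by (intro finite_shadow) (auto simp: R_def)
    have full: "X / 2 \<le> real (card {f\<in>D. \<phi> f = g})" if g: "g \<in> shadow R" for g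
    proof (rule ccontr)
      let ?c = "card {f\<in>D. \<phi> f = g}"
      assume "\<not> X / 2 \<le> real ?c"
      \<comment> \<open>A nonempty fibre of size c has c + 1 at most 2c; the empty fibre is covered
        by \<open>1 \<le> X\<close>.\<close>
      then have small: "real ?c + 1 \<le> X" using X by (cases "?c = 0") auto
      obtain f x where f: "f \<in> R" "x \<in> f" "g = f - {x}" using g unfolding shadow_def by blast
      have fD: "f \<notin> D" using f(1) by (simp add: R_def)
      have "real (card {f'\<in>insert f D. (\<phi>(f := g)) f' = h}) \<le> X" for h
      proof (cases "h = g")
        case True
        have "{f'\<in>insert f D. (\<phi>(f := g)) f' = h} = insert f {f'\<in>D. \<phi> f' = g}" using True fD by auto
        then show ?thesis using small finD fD by simp
      next
        case False
        then have "{f'\<in>insert f D. (\<phi>(f := g)) f' = h} = {f'\<in>D. \<phi> f' = h}" using fD by auto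
        then show ?thesis using \<phi> unfolding ok_def by simp
      qed
      moreover have "\<exists>x\<in>f'. (\<phi>(f := g)) f' = f' - {x}" if "f' \<in> insert f D" for f'
        using that f \<phi> fD unfolding ok_def by (cases "f' = f") auto
      moreover have "insert f D \<subseteq> G" using DG f(1) by (auto simp: R_def)
      ultimately have "ok (\<phi>(f := g)) (insert f D)" unfolding ok_def by blast
      from max[OF this] show False using fD by blast
    qed
    have "X / 2 * real (card (shadow R)) = (\<Sum>g\<in>shadow R. X / 2)" by simp
    also have "\<dots> \<le> (\<Sum>g\<in>shadow R. real (card {f\<in>D. \<phi> f = g}))" by (intro sum_mono full)
    also have "\<dots> \<le> real (card D)"
      using sum_card_fibres_le[OF finD fs, of \<phi>] by (simp flip: of_nat_sum)
    finally have "X * real (card (shadow R)) \<le> 2 * real (card R)" using cR False by simp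
    then show ?thesis using dense[of R] cR False by (simp add: R_def)
  qed
qed

text \<open>Fibres below \<open>2 ^ m\<close> fall into \<open>m\<close> dyadic classes, and one of
  the classes carries at least a fraction \<open>1 / m\<close> of \<open>D\<close>.\<close>

lemma dyadic_class:
  assumes D: "finite D" and bound: "\<And>g. card {f\<in>D. \<phi> f = g} < 2 ^ m" and ne: "D \<noteq> {}"
  obtains a where "card D \<le> m * (2 ^ (a + 1) * card {g\<in>\<phi> ` D. 2 ^ a \<le> card {f\<in>D. \<phi> f = g} \<and> card {f\<in>D. \<phi> f = g} < 2 ^ (a + 1)})"
    "{g\<in>\<phi> ` D. 2 ^ a \<le> card {f\<in>D. \<phi> f = g} \<and> card {f\<in>D. \<phi> f = g} < 2 ^ (a + 1)} \<noteq> {}"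
proof -
  define c where "c g = card {f\<in>D. \<phi> f = g}" for g
  define A where "A a = {g\<in>\<phi> ` D. 2 ^ a \<le> c g \<and> c g < 2 ^ (a + 1)}" for a
  have finA: "finite (A a)" for a unfolding A_def using D by simp
  have "\<phi> ` D \<subseteq> (\<Union>a<m. A a)"
  proof
    fix g assume g: "g \<in> \<phi> ` D"
    then have "{f\<in>D. \<phi> f = g} \<noteq> {}" by blast
    then have "1 \<le> c g" unfolding c_def using D by (simp add: Suc_le_eq card_gt_0_iff)
    then obtain a where a: "2 ^ a \<le> c g" "c g < 2 ^ (a + 1)" using ex_power_ivl1[of 2 "c g"] by auto
    then have "(2::nat) ^ a < 2 ^ m" using bound[of g] unfolding c_def by linarith
    then have "a < m" by simp
    then show "g \<in> (\<Union>a<m. A a)" using a g unfolding A_def by blast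
  qed
  then have "(\<Union>a<m. A a) = \<phi> ` D" unfolding A_def by blast
  have "card D = (\<Sum>g\<in>\<phi> ` D. c g)" unfolding c_def using sum.group[OF D, of "\<phi> ` D" \<phi> "\<lambda>_. 1::nat"] D by simp
  also have "\<dots> = real (\<Sum>g\<in>(\<Union>a<m. A a). c g)" unfolding \<open>(\<Union>a<m. A a) = \<phi> ` D\<close> ..
  also have "\<dots> = (\<Sum>g\<in>(\<Union>a<m. A a). real (c g))" by simp
  also have "\<dots> \<le> (\<Sum>a<m. \<Sum>g\<in>A a. real (c g))" using finA by (intro sum_UN_le) auto
  also have "\<dots> = real (\<Sum>a<m. \<Sum>g\<in>A a. c g)" by simp
  finally have tot: "card D \<le> (\<Sum>a<m. \<Sum>g\<in>A a. c g)" by linarith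
  have "\<exists>a<m. card D \<le> m * (\<Sum>g\<in>A a. c g)"
  proof (rule ccontr)
    assume "\<not> ?thesis"
    then have no: "m * (\<Sum>g\<in>A a. c g) < card D" if "a < m" for a using that by (meson not_le)
    have "m \<noteq> 0" using tot ne D by (auto simp: card_eq_0_iff)
    then have "(\<Sum>a<m. m * (\<Sum>g\<in>A a. c g)) < (\<Sum>a<m. card D)"
      using no by (intro sum_strict_mono) auto
    then have "m * (\<Sum>a<m. \<Sum>g\<in>A a. c g) < m * card D" by (simp add: sum_distrib_left)
    then show False using tot by simp
  qed
  then obtain a where a: "card D \<le> m * (\<Sum>g\<in>A a. c g)" by blast
  have "(\<Sum>g\<in>A a. c g) \<le> (\<Sum>g\<in>A a. 2 ^ (a + 1))" by (intro sum_mono) (auto simp: A_def)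
  then have le: "(\<Sum>g\<in>A a. c g) \<le> 2 ^ (a + 1) * card (A a)" by (simp add: mult.commute)
  have 1: "card D \<le> m * (2 ^ (a + 1) * card (A a))" using a le by (meson le_trans mult_le_mono2)
  have "card D > 0" using ne D by (simp add: card_gt_0_iff)
  then have "A a \<noteq> {}" using 1 by auto
  with 1 show ?thesis using that[of a] unfolding A_def c_def by blast
qed

text \<open>Each \<open>f \<in> G\<close> stands for the edges of \<open>E\<close> in its fibre under \<open>\<pi>\<close>.  \<open>W\<close> is the common multiplicity,
  and \<open>Q\<close> collects the factors 2 lost in the dyadic classes.\<close>

definition fibred :: "'a set set \<Rightarrow> ('a set \<Rightarrow> 'a set) \<Rightarrow> 'a set set \<Rightarrow> nat \<Rightarrow> real \<Rightarrow> real \<Rightarrow> bool" where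
  "fibred E \<pi> G s W Q \<longleftrightarrow> finite E \<and> \<pi> ` E = G \<and> (\<forall>e\<in>E. \<pi> e \<subseteq> e \<and> card (\<pi> e) = s) \<and>
     (\<forall>f\<in>G. W \<le> real (card {e\<in>E. \<pi> e = f}) \<and> real (card {e\<in>E. \<pi> e = f}) \<le> Q * W)"

lemma fibred_restrict:
  assumes "fibred E \<pi> G s W Q" "G' \<subseteq> G"
  shows "fibred {e\<in>E. \<pi> e \<in> G'} \<pi> G' s W Q"
proof -
  have "{e \<in> {e\<in>E. \<pi> e \<in> G'}. \<pi> e = f} = {e\<in>E. \<pi> e = f}" if "f \<in> G'" for f using that by auto
  moreover have "\<pi> ` {e\<in>E. \<pi> e \<in> G'} = G'" using assms unfolding fibred_def by auto
  ultimately show ?thesis using assms unfolding fibred_def by auto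
qed

text \<open>Multiplicities multiply under composition, and the spread from \<open>b\<close> to
  \<open>2 * b\<close> within a dyadic class is what doubles \<open>Q\<close>.\<close>

lemma fibred_comp:
  assumes fib: "fibred E \<pi> G s W Q" and D: "D \<subseteq> G" and W: "0 \<le> W" "0 \<le> Q"
    and \<phi>: "\<And>f. f \<in> D \<Longrightarrow> \<exists>x\<in>f. \<phi> f = f - {x}"
    and A: "A \<subseteq> \<phi> ` D" and b: "\<And>g. g \<in> A \<Longrightarrow> b \<le> card {f\<in>D. \<phi> f = g} \<and> card {f\<in>D. \<phi> f = g} \<le> 2 * b"
  shows "fibred {e\<in>E. \<pi> e \<in> D \<and> \<phi> (\<pi> e) \<in> A} (\<lambda>e. \<phi> (\<pi> e)) A (s - 1) (real b * W) (2 * Q)"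
proof -
  let ?E = "{e\<in>E. \<pi> e \<in> D \<and> \<phi> (\<pi> e) \<in> A}"
  have finE: "finite E" and im: "\<pi> ` E = G" and e: "\<And>e. e \<in> E \<Longrightarrow> \<pi> e \<subseteq> e \<and> card (\<pi> e) = s"
    and c: "\<And>f. f \<in> G \<Longrightarrow> W \<le> real (card {e\<in>E. \<pi> e = f}) \<and> real (card {e\<in>E. \<pi> e = f}) \<le> Q * W"
    using fib unfolding fibred_def by auto
  have finD: "finite D" using D im finE by (metis finite_imageI finite_subset)
  have "(\<lambda>e. \<phi> (\<pi> e)) ` ?E = A"
  proof
    show "A \<subseteq> (\<lambda>e. \<phi> (\<pi> e)) ` ?E"
    proof
      fix g assume g: "g \<in> A"
      then obtain f where f: "f \<in> D" "g = \<phi> f" using A by blast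
      then obtain x where "x \<in> E" "f = \<pi> x" using D im by blast
      then show "g \<in> (\<lambda>e. \<phi> (\<pi> e)) ` ?E" using f g by blast
    qed
  qed auto
  moreover have "\<phi> (\<pi> e) \<subseteq> e \<and> card (\<phi> (\<pi> e)) = s - 1" if "e \<in> ?E" for e
  proof -
    have pe: "\<pi> e \<in> D" "\<pi> e \<subseteq> e" "card (\<pi> e) = s" using that assms e by auto
    then obtain x where "x \<in> \<pi> e" "\<phi> (\<pi> e) = \<pi> e - {x}" using \<phi> by blast
    then show ?thesis using pe by (auto simp: card_Diff_singleton_if)
  qed
  moreover have "real b * W \<le> real (card {e\<in>?E. \<phi> (\<pi> e) = g}) \<and> real (card {e\<in>?E. \<phi> (\<pi> e) = g}) \<le> 2 * Q * (real b * W)"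
    if g: "g \<in> A" for g
  proof -
    let ?T = "{f\<in>D. \<phi> f = g}"
    have "{e\<in>?E. \<phi> (\<pi> e) = g} = (\<Union>f\<in>?T. {e\<in>E. \<pi> e = f})" using g by auto
    moreover have "card (\<Union>f\<in>?T. {e\<in>E. \<pi> e = f}) = (\<Sum>f\<in>?T. card {e\<in>E. \<pi> e = f})"
      using finD finE by (intro card_UN_disjoint) auto
    ultimately have eq: "real (card {e\<in>?E. \<phi> (\<pi> e) = g}) = (\<Sum>f\<in>?T. real (card {e\<in>E. \<pi> e = f}))" by simp
    have "real b * W \<le> real (card ?T) * W" using b[OF g] W by (intro mult_right_mono) auto
    also have "\<dots> = (\<Sum>f\<in>?T. W)" by simp
    also have "\<dots> \<le> (\<Sum>f\<in>?T. real (card {e\<in>E. \<pi> e = f}))" using c D by (intro sum_mono) auto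
    finally have 1: "real b * W \<le> real (card {e\<in>?E. \<phi> (\<pi> e) = g})" unfolding eq .
    have "(\<Sum>f\<in>?T. real (card {e\<in>E. \<pi> e = f})) \<le> (\<Sum>f\<in>?T. Q * W)" using c D by (intro sum_mono) auto
    also have "\<dots> = real (card ?T) * (Q * W)" by simp
    also have "\<dots> \<le> real (2 * b) * (Q * W)" using b[OF g] W by (intro mult_right_mono of_nat_mono) auto
    finally show ?thesis using 1 unfolding eq by (simp add: mult_ac)
  qed
  ultimately show ?thesis unfolding fibred_def using finE by auto
qed

section \<open>Lifting cycles and their codegrees through the fibres\<close>

lemma card_lifts_ge:
  assumes fib: "fibred E \<pi> G s W Q" and C: "C \<subseteq> G" "card C = k" and W: "0 \<le> W"
  shows "W ^ k \<le> real (card {D. D \<subseteq> E \<and> inj_on \<pi> D \<and> \<pi> ` D = C})"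
proof -
  let ?F = "\<lambda>f. {e\<in>E. \<pi> e = f}"
  have finE: "finite E" and im: "\<pi> ` E = G" and c: "\<And>f. f \<in> G \<Longrightarrow> W \<le> real (card (?F f))"
    using fib unfolding fibred_def by auto
  have finC: "finite C" using C im finE by (metis finite_imageI finite_subset)
  have h: "h f \<in> E \<and> \<pi> (h f) = f" if "h \<in> Pi\<^sub>E C ?F" "f \<in> C" for h f using PiE_mem[OF that] by simp
  have "W ^ k = (\<Prod>f\<in>C. W)" using C by simp
  also have "\<dots> \<le> (\<Prod>f\<in>C. real (card (?F f)))" using c C W by (intro prod_mono) auto
  also have "\<dots> = real (card (Pi\<^sub>E C ?F))" using finC by (simp add: card_PiE)
  also have "\<dots> \<le> real (card {D. D \<subseteq> E \<and> inj_on \<pi> D \<and> \<pi> ` D = C})"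
  proof (intro of_nat_mono card_inj_on_le[of "\<lambda>h. h ` C"])
    show "inj_on (\<lambda>h. h ` C) (Pi\<^sub>E C ?F)"
    proof (rule inj_onI)
      fix h h' assume hh: "h \<in> Pi\<^sub>E C ?F" "h' \<in> Pi\<^sub>E C ?F" "h ` C = h' ` C"
      show "h = h'"
      proof (rule PiE_ext[OF hh(1,2)])
        fix f assume f: "f \<in> C"
        then obtain f' where f': "f' \<in> C" "h f = h' f'" using hh(3) by blast
        then have "f = f'" using h[OF hh(1) f] h[OF hh(2) f'(1)] by simp
        then show "h f = h' f" using f' by simp
      qed
    qed
    show "(\<lambda>h. h ` C) ` Pi\<^sub>E C ?F \<subseteq> {D. D \<subseteq> E \<and> inj_on \<pi> D \<and> \<pi> ` D = C}"
    proof (rule image_subsetI)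
      fix hh assume hh: "hh \<in> Pi\<^sub>E C ?F"
      have "inj_on \<pi> (hh ` C)" using h[OF hh] by (auto simp: inj_on_def)
      moreover have "\<pi> ` hh ` C = C" using h[OF hh] by (auto simp: image_iff)
      ultimately show "hh ` C \<in> {D. D \<subseteq> E \<and> inj_on \<pi> D \<and> \<pi> ` D = C}" using h[OF hh] by auto
    qed
  qed (use finE in auto)
  finally show ?thesis .
qed

text \<open>Prescribing \<open>J\<close> settles the choice in \<open>card J\<close> fibres; the
  other \<open>k - card J\<close> fibres stay free, with at most \<open>Q * W\<close> options
  each.\<close>

lemma card_lifts_le:
  assumes fib: "fibred E \<pi> G s W Q" and C: "C \<subseteq> G" "card C = k" and W: "0 \<le> Q * W"
    and J: "inj_on \<pi> J" "\<pi> ` J \<subseteq> C" "finite J"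
  shows "real (card {D. D \<subseteq> E \<and> inj_on \<pi> D \<and> \<pi> ` D = C \<and> J \<subseteq> D}) \<le> (Q * W) ^ (k - card J)"
proof -
  let ?F = "\<lambda>f. {e\<in>E. \<pi> e = f}"
  let ?C = "C - \<pi> ` J"
  have finE: "finite E" and im: "\<pi> ` E = G" and c: "\<And>f. f \<in> G \<Longrightarrow> real (card (?F f)) \<le> Q * W"
    using fib unfolding fibred_def by auto
  have finC: "finite C" using C im finE by (metis finite_imageI finite_subset)
  have cC: "card ?C = k - card J" using J C by (simp add: card_Diff_subset card_image)
  have "{D. D \<subseteq> E \<and> inj_on \<pi> D \<and> \<pi> ` D = C \<and> J \<subseteq> D} \<subseteq> (\<lambda>h. J \<union> h ` ?C) ` Pi\<^sub>E ?C ?F"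
  proof
    fix D assume "D \<in> {D. D \<subseteq> E \<and> inj_on \<pi> D \<and> \<pi> ` D = C \<and> J \<subseteq> D}"
    then have D: "D \<subseteq> E" "inj_on \<pi> D" "\<pi> ` D = C" "J \<subseteq> D" by auto
    define h where "h = restrict (inv_into D \<pi>) ?C"
    have "inv_into D \<pi> f \<in> D \<and> \<pi> (inv_into D \<pi> f) = f" if "f \<in> C" for f
      using that D(3) by (metis f_inv_into_f inv_into_into)
    then have hf: "h f \<in> D \<and> \<pi> (h f) = f" if "f \<in> ?C" for f using that by (simp add: h_def)
    have "h \<in> Pi\<^sub>E ?C ?F" using hf D(1) by (auto simp: h_def)
    moreover have "D = J \<union> h ` ?C"
    proof
      show "J \<union> h ` ?C \<subseteq> D" using D(4) hf by blast
      show "D \<subseteq> J \<union> h ` ?C"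
      proof
        fix x assume x: "x \<in> D"
        show "x \<in> J \<union> h ` ?C"
        proof (cases "\<pi> x \<in> \<pi> ` J")
          case True then show ?thesis using D(2,4) x by (auto simp: inj_on_def)
        next
          case False
          then have "\<pi> x \<in> ?C" using x D(3) by blast
          moreover from hf[OF this] have "h (\<pi> x) = x" using D(2) x by (auto simp: inj_on_def)
          ultimately show ?thesis by (metis UnI2 image_eqI)
        qed
      qed
    qed
    ultimately show "D \<in> (\<lambda>h. J \<union> h ` ?C) ` Pi\<^sub>E ?C ?F" by blast
  qed
  moreover have "finite (Pi\<^sub>E ?C ?F)" using finC finE by (intro finite_PiE) auto
  ultimately have "card {D. D \<subseteq> E \<and> inj_on \<pi> D \<and> \<pi> ` D = C \<and> J \<subseteq> D} \<le> card (Pi\<^sub>E ?C ?F)"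
    by (intro surj_card_le)
  then have "real (card {D. D \<subseteq> E \<and> inj_on \<pi> D \<and> \<pi> ` D = C \<and> J \<subseteq> D}) \<le> real (card (Pi\<^sub>E ?C ?F))" by simp
  also have "\<dots> = (\<Prod>f\<in>?C. real (card (?F f)))" using finC by (simp add: card_PiE)
  also have "\<dots> \<le> (\<Prod>f\<in>?C. Q * W)" using c C by (intro prod_mono) auto
  also have "\<dots> = (Q * W) ^ (k - card J)" using cC by simp
  finally show ?thesis .
qed

lemma fibred_mono: "fibred E \<pi> G s W Q \<Longrightarrow> 0 \<le> W \<Longrightarrow> Q \<le> Q' \<Longrightarrow> fibred E \<pi> G s W Q'"
  unfolding fibred_def by (meson mult_right_mono order_trans)

text \<open>All lifts of all cycles of the family are taken. A cycle has at least
  \<open>W ^ k\<close> lifts, but at most \<open>(Q * W) ^ (k - j)\<close> through \<open>j\<close>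
  given edges, so a further edge gains \<open>\<theta>\<close> from \<open>G\<close> and
  \<open>1 / W\<close> from its fibre. The spread enters only through the constant
  \<open>Q ^ k\<close>.\<close>

lemma balanced_lift:
  assumes fib: "fibred E' \<pi> G s W Q" and E: "E' \<subseteq> E" "finite E" "\<And>e. e \<in> E \<Longrightarrow> card e = r"
    and bal: "balanced s k b \<theta> G" and k: "k \<ge> 3" and W: "0 < W" "1 \<le> Q" and \<theta>: "0 \<le> \<theta>" "0 \<le> b"
  shows "\<exists>S. S \<noteq> {} \<and> S \<subseteq> berge_copies r k E \<and> (\<forall>j\<in>{1..k}.
    real (max_codegree E j S) \<le> Q ^ k * b / (real (card G) * W) * real (card S) * (\<theta> / W) ^ (j - 1))"
proof -
  obtain S0 where S0': "S0 \<subseteq> {C. C \<subseteq> G \<and> loose_cycle s k C}" and S0_ne: "S0 \<noteq> {}"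
    and deg': "\<forall>J\<subseteq>G. J \<noteq> {} \<longrightarrow> card J \<le> k \<longrightarrow>
        real (card {C\<in>S0. J \<subseteq> C}) \<le> b / real (card G) * real (card S0) * \<theta> ^ (card J - 1)"
    using bal unfolding balanced_def by (elim exE conjE) (rule that)
  have S0: "C \<subseteq> G \<and> loose_cycle s k C" if "C \<in> S0" for C using that S0' by auto
  have deg: "real (card {C\<in>S0. J \<subseteq> C}) \<le> b / real (card G) * real (card S0) * \<theta> ^ (card J - 1)"
    if "J \<subseteq> G" "J \<noteq> {}" "card J \<le> k" for J using deg' that by simp
  have finE': "finite E'" and im: "\<pi> ` E' = G" and e: "\<And>e. e \<in> E' \<Longrightarrow> \<pi> e \<subseteq> e"
    using fib unfolding fibred_def by auto
  have finG: "finite G" using im finE' by blast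
  have finS0: "finite S0" by (rule finite_subset[of _ "Pow G"]) (use S0 finG in auto)
  define L where "L C = {D. D \<subseteq> E' \<and> inj_on \<pi> D \<and> \<pi> ` D = C}" for C
  define S where "S = (\<Union>C\<in>S0. L C)"
  have finL: "finite (L C)" for C unfolding L_def using finE' by simp
  have finS: "finite S" unfolding S_def using finS0 finL by simp
  have cC: "card C = k" if "C \<in> S0" for C using S0[OF that] loose_cycle_card k by blast
  have "card S = (\<Sum>C\<in>S0. card (L C))"
    unfolding S_def using finS0 finL by (intro card_UN_disjoint) (auto simp: L_def)
  then have "real (card S) = (\<Sum>C\<in>S0. real (card (L C)))" by simp
  moreover have "(\<Sum>C\<in>S0. W ^ k) \<le> (\<Sum>C\<in>S0. real (card (L C)))"
    using card_lifts_ge[OF fib] S0 cC W unfolding L_def by (intro sum_mono) auto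
  ultimately have cS: "real (card S0) * W ^ k \<le> real (card S)" by simp
  have "0 < real (card S0) * W ^ k" using S0_ne finS0 W by (simp add: card_gt_0_iff)
  then have Sne: "S \<noteq> {}" using cS by auto
  have Sb: "S \<subseteq> berge_copies r k E"
  proof
    fix D assume "D \<in> S"
    then obtain C where C: "C \<in> S0" "D \<subseteq> E'" "inj_on \<pi> D" "\<pi> ` D = C" unfolding S_def L_def by auto
    then have "D \<in> berge_cycles r k"
      using S0[OF C(1)] E(1,3) e by (intro loose_cycle_lift_berge[OF _ k C(3,4)]) blast+
    then show "D \<in> berge_copies r k E" unfolding berge_copies_def using C(2) E(1) by auto
  qed
  have cD: "card D = k \<and> D \<subseteq> E'" if "D \<in> S" for D
    using that cC[of "\<pi> ` D"] card_image[of \<pi> D] unfolding S_def L_def by auto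
  have main: "real (card {D\<in>S. J \<subseteq> D}) \<le> Q ^ k * b / (real (card G) * W) * real (card S) * (\<theta> / W) ^ (j - 1)"
    (is "_ \<le> ?R") if J: "J \<subseteq> E" "card J = j" and j: "1 \<le> j" "j \<le> k" for J j
  proof (cases "\<exists>D\<in>S. J \<subseteq> D")
    case False
    then have "{D\<in>S. J \<subseteq> D} = {}" by blast
    moreover have "0 \<le> ?R" using W \<theta> by simp
    ultimately show ?thesis by (simp only: card.empty of_nat_0)
  next
    case True
    then obtain D where D: "D \<in> S" "J \<subseteq> D" by blast
    \<comment> \<open>As part of a lift, \<open>J\<close> is mapped injectively, so its image has
      \<open>j\<close> elements and the codegree bound in \<open>G\<close> applies at the same
      \<open>j\<close>.\<close>
    then have Jinj: "inj_on \<pi> J" and JG: "\<pi> ` J \<subseteq> G" using S0 unfolding S_def L_def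
      by (blast intro: inj_on_subset)+
    have finJ: "finite J" using J(1) E(2) finite_subset by blast
    have cJ: "card (\<pi> ` J) = j" using Jinj J(2) by (simp add: card_image)
    let ?T = "{C\<in>S0. \<pi> ` J \<subseteq> C}"
    have "{D\<in>S. J \<subseteq> D} \<subseteq> (\<Union>C\<in>?T. {D. D \<subseteq> E' \<and> inj_on \<pi> D \<and> \<pi> ` D = C \<and> J \<subseteq> D})"
      unfolding S_def L_def by blast
    then have "card {D\<in>S. J \<subseteq> D} \<le> card (\<Union>C\<in>?T. {D. D \<subseteq> E' \<and> inj_on \<pi> D \<and> \<pi> ` D = C \<and> J \<subseteq> D})"
      using finS0 finE' by (intro card_mono) auto
    also have "\<dots> \<le> (\<Sum>C\<in>?T. card {D. D \<subseteq> E' \<and> inj_on \<pi> D \<and> \<pi> ` D = C \<and> J \<subseteq> D})"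
      using finS0 by (intro card_UN_le) auto
    finally have "real (card {D\<in>S. J \<subseteq> D}) \<le> (\<Sum>C\<in>?T. real (card {D. D \<subseteq> E' \<and> inj_on \<pi> D \<and> \<pi> ` D = C \<and> J \<subseteq> D}))"
      by (simp flip: of_nat_sum)
    also have "\<dots> \<le> (\<Sum>C\<in>?T. (Q * W) ^ (k - card J))"
      using W Jinj finJ S0 cC by (intro sum_mono card_lifts_le[OF fib]) auto
    also have "\<dots> = real (card ?T) * (Q * W) ^ (k - j)" using J by simp
    also have "\<dots> \<le> (b / real (card G) * real (card S0) * \<theta> ^ (j - 1)) * (Q * W) ^ (k - j)"
    proof (rule mult_right_mono)
      have "\<pi> ` J \<noteq> {}" using cJ j by auto
      from deg[OF JG this] show "real (card ?T) \<le> b / real (card G) * real (card S0) * \<theta> ^ (j - 1)"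
        using cJ j by simp
    qed (use W in auto)
    also have "\<dots> \<le> (b / real (card G) * real (card S0) * \<theta> ^ (j - 1)) * (Q ^ k * W ^ (k - j))"
      unfolding power_mult_distrib using W \<theta>
      by (intro mult_left_mono mult_right_mono power_increasing) auto
    also have "W ^ (k - j) = W ^ k / W ^ j" using W j by (simp add: power_diff)
    also have "(b / real (card G) * real (card S0) * \<theta> ^ (j - 1)) * (Q ^ k * (W ^ k / W ^ j))
      = (b / real (card G) * \<theta> ^ (j - 1) * Q ^ k / W ^ j) * (real (card S0) * W ^ k)" by simp
    also have "\<dots> \<le> (b / real (card G) * \<theta> ^ (j - 1) * Q ^ k / W ^ j) * real (card S)"
      using cS W \<theta> by (intro mult_left_mono) auto
    also have "\<dots> = ?R"
    proof -
      have "W ^ j = W * W ^ (j - 1)" using j by (cases j) auto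
      then show ?thesis by (simp add: power_divide mult_ac)
    qed
    finally show ?thesis .
  qed
  have "real (max_codegree E j S) \<le> Q ^ k * b / (real (card G) * W) * real (card S) * (\<theta> / W) ^ (j - 1)"
    if j: "j \<in> {1..k}" for j
  proof -
    \<comment> \<open>A lift has \<open>k \<ge> j\<close> edges, so sets \<open>J\<close> of size
      \<open>j\<close> exist and \<open>Max\<close> is attained rather than unspecified.\<close>
    let ?M = "{card {C \<in> S. J \<subseteq> C} | J. J \<subseteq> E \<and> card J = j}"
    have "?M = (\<lambda>J. card {C \<in> S. J \<subseteq> C}) ` {J. J \<subseteq> E \<and> card J = j}" by blast
    then have "finite ?M" using E(2) by simp
    moreover obtain D where "D \<in> S" using Sne by blast
    then have "j \<le> card D" "D \<subseteq> E" using cD[of D] j E(1) by auto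
    then obtain J where "J \<subseteq> E" "card J = j" by (meson obtain_subset_with_card_n order_trans)
    then have "?M \<noteq> {}" by blast
    ultimately have "Max ?M \<in> ?M" by (rule Max_in)
    then obtain J where "J \<subseteq> E" "card J = j" "Max ?M = card {C \<in> S. J \<subseteq> C}" by blast
    then show ?thesis unfolding max_codegree_def using main[of J j] j by simp
  qed
  then show ?thesis using Sne Sb by blast
qed

text \<open>The state after \<open>r - s\<close> reductions. Each costs a factor
  \<open>4 * m\<close>: 2 for keeping half of the sets, \<open>m\<close> for the pigeonhole, 2 for
  the width of a dyadic class. Each also raises the bound on \<open>W\<close> by a factor
  \<open>D\<close>.\<close>

definition level :: "'a set set \<Rightarrow> real \<Rightarrow> nat \<Rightarrow> nat \<Rightarrow> nat \<Rightarrow> 'a set set \<Rightarrow> ('a set \<Rightarrow> 'a set) \<Rightarrow> 'a set set \<Rightarrow> real \<Rightarrow> bool" where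
  "level E D m r s E' \<pi> G W \<longleftrightarrow> fibred E' \<pi> G s W (2 ^ (r - s)) \<and> E' \<subseteq> E \<and> G \<noteq> {} \<and> 1 \<le> W \<and>
     W \<le> D ^ (r - s) \<and> real (card E) \<le> (4 * real m) ^ (r - s) * (real (card G) * W)"

text \<open>The relevant ratio is \<open>\<theta> / W\<close> because fixing one more edge of a lifted cycle also fixes one
  of about \<open>W\<close> choices in a fibre.\<close>

definition outcome :: "'a set set \<Rightarrow> real \<Rightarrow> nat \<Rightarrow> nat \<Rightarrow> nat \<Rightarrow> bool" where
  "outcome E \<tau> m r k \<longleftrightarrow> (\<exists>s E' \<pi> G W \<theta>. fibred E' \<pi> G s W (2 ^ r) \<and> E' \<subseteq> E \<and> 1 \<le> W \<and> 0 \<le> \<theta> \<and>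
     balanced s k (2 ^ (k + 3)) \<theta> G \<and> \<theta> / W \<le> \<tau> \<and>
     real (card E) \<le> 2 * (4 * real m) ^ (r - 2) * (real (card G) * W))"

text \<open>\<open>X\<close> is the solution of \<open>X powr e * W = D powr (r - 1 - \<beta>)\<close>: a dense shadow at uniformity \<open>s\<close>
  with codegrees about \<open>X\<close> then gives the same ratio \<open>\<theta> / W\<close> for every \<open>s\<close> and \<open>W\<close>.\<close>

lemma threshold:
  fixes D W \<beta> e :: real
  assumes D: "1 \<le> D" and W: "1 \<le> W" "W \<le> D ^ (r - s)" and s: "3 \<le> s" "s \<le> r" and \<beta>: "0 \<le> \<beta>" "\<beta> \<le> 1"
  defines "e \<equiv> real s - 1 - \<beta>"
  defines "X \<equiv> (D powr (real r - 1 - \<beta>) / W) powr (1 / e)"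
  shows "D \<le> X" and "W * X \<le> D ^ (r - (s - 1))" and "X powr e = D powr (real r - 1 - \<beta>) / W"
proof -
  have e: "1 \<le> e" unfolding e_def using s \<beta> by simp
  have re: "real r - 1 - \<beta> = e + (real r - real s)" unfolding e_def by simp
  have W': "W \<le> D powr (real r - real s)"
    using W D s powr_realpow[of D "r - s"] by (simp add: of_nat_diff)
  show "X powr e = D powr (real r - 1 - \<beta>) / W" unfolding X_def powr_powr using e D W by simp
  have "D powr e * W \<le> D powr e * D powr (real r - real s)" using W' by (intro mult_left_mono) auto
  also have "\<dots> = D powr (real r - 1 - \<beta>)" unfolding re by (simp add: powr_add)
  finally have "D powr e \<le> D powr (real r - 1 - \<beta>) / W" using W by (simp add: field_simps)
  then have "(D powr e) powr (1 / e) \<le> X" unfolding X_def using e by (intro powr_mono2) auto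
  then show "D \<le> X" using e D by (simp add: powr_powr)
  \<comment> \<open>\<open>W\<close> enters with the exponent \<open>1 - 1 / e\<close>, which is
    nonnegative, so the worst case is \<open>W = D ^ (r - s)\<close>. There \<open>X = D\<close>,
    and the bound is attained.\<close>
  have "W * X = D powr ((real r - 1 - \<beta>) / e) * (W powr 1 / W powr (1 / e))"
    unfolding X_def using D W by (simp add: powr_divide powr_powr)
  also have "W powr 1 / W powr (1 / e) = W powr (1 - 1 / e)" using W by (simp add: powr_diff)
  also have "D powr ((real r - 1 - \<beta>) / e) * W powr (1 - 1 / e)
     \<le> D powr ((real r - 1 - \<beta>) / e) * (D powr (real r - real s)) powr (1 - 1 / e)"
    using W W' e by (intro mult_left_mono powr_mono2) auto
  also have "\<dots> = D powr ((real r - 1 - \<beta>) / e + (real r - real s) * (1 - 1 / e))"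
    by (simp add: powr_powr powr_add)
  also have "(real r - 1 - \<beta>) / e + (real r - real s) * (1 - 1 / e) = real (r - (s - 1))"
    unfolding re using e s by (simp add: field_simps of_nat_diff)
  also have "D powr real (r - (s - 1)) = D ^ (r - (s - 1))" using D by (intro powr_realpow) auto
  finally show "W * X \<le> D ^ (r - (s - 1))" .
qed

text \<open>A dense shadow ends the descent: by the choice of \<open>X\<close> the ratio
  \<open>\<theta> / W\<close> is, up to constants, the power of \<open>D\<close> in the hypothesis
  on \<open>\<tau>\<close>. A sparse assignment, made regular by one dyadic class, leads to
  uniformity \<open>s - 1\<close> with \<open>W\<close> multiplied by at most
  \<open>X\<close>.\<close>

lemma reduction_step:
  fixes E :: "'a set set"
  assumes V: "finite V" "card V < 2 ^ m" and E: "\<And>e. e \<in> E \<Longrightarrow> e \<subseteq> V"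
    and lev: "level E D m r s E' \<pi> G W" and s: "3 \<le> s" "s \<le> r" and k: "3 \<le> k"
    and D: "32 * real (k * r + 1) \<le> D"
    and out: "4 * (8 * real (k * r + 1)) ^ r * D powr (- (real r - 1 - 1 / (real k - 1))) \<le> \<tau>"
  shows "outcome E \<tau> m r k \<or> (\<exists>E' \<pi> G W. level E D m r (s - 1) E' \<pi> G W)"
proof -
  define \<beta> where "\<beta> = 1 / (real k - 1)"
  define e where "e = real s - 1 - \<beta>"
  define X where "X = (D powr (real r - 1 - \<beta>) / W) powr (1 / e)"
  have k3: "3 \<le> real k" using k by simp
  have \<beta>: "0 \<le> \<beta>" "\<beta> \<le> 1" unfolding \<beta>_def using k3 by auto
  have "32 * 1 \<le> 32 * real (k * r + 1)" by simp
  then have D1: "1 \<le> D" using D by linarith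
  have fib: "fibred E' \<pi> G s W (2 ^ (r - s))" and E': "E' \<subseteq> E" and Gne: "G \<noteq> {}" and W: "1 \<le> W" "W \<le> D ^ (r - s)"
    and cE: "real (card E) \<le> (4 * real m) ^ (r - s) * (real (card G) * W)"
    using lev unfolding level_def by auto
  have X: "D \<le> X" "W * X \<le> D ^ (r - (s - 1))" "X powr e = D powr (real r - 1 - \<beta>) / W"
    using threshold[OF D1 W s \<beta>] unfolding X_def e_def by auto
  have "finite E'" "\<pi> ` E' = G" and pe: "\<And>x. x \<in> E' \<Longrightarrow> \<pi> x \<subseteq> x \<and> card (\<pi> x) = s"
    using fib unfolding fibred_def by auto
  have GV: "f \<subseteq> V \<and> card f = s" if f: "f \<in> G" for f
  proof -
    obtain x where "x \<in> E'" "f = \<pi> x" using f \<open>\<pi> ` E' = G\<close> by blast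
    then show ?thesis using pe[of x] E[of x] E' by blast
  qed
  have finG: "finite G" using \<open>finite E'\<close> \<open>\<pi> ` E' = G\<close> by blast
  have finf: "finite f" if "f \<in> G" for f using GV[OF that] V(1) finite_subset by blast
  have "V \<noteq> {}"
  proof
    assume "V = {}"
    obtain f where "f \<in> G" using Gne by blast
    then show False using GV[of f] \<open>V = {}\<close> s by auto
  qed
  then have "m \<noteq> 0" using V by (auto simp: card_eq_0_iff)
  then have m1: "1 \<le> 4 * real m" by simp
  have "1 \<le> X" using X(1) D1 by linarith
  have "\<forall>f\<in>G. finite f" using finf by blast
  show ?thesis
  proof (cases rule: shadow_assignment[OF finG \<open>\<forall>f\<in>G. finite f\<close> \<open>1 \<le> X\<close>, case_names sparse dense])
    case (dense R)
    have "card R \<noteq> 0" using dense(2) Gne finG by auto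
    then have Rne: "R \<noteq> {}" by auto
    define q where "q = 8 * real (k * s + 1)"
    define \<theta> where "\<theta> = 4 * (q / X) powr e"
    \<comment> \<open>With \<open>\<beta> = 1 / (k - 1)\<close>, the exponent of the dense case is
      exactly the \<open>e\<close> that defines \<open>X\<close>.\<close>
    have ke: "(real k * (real s - 1) - real s) / (real k - 1) = e"
      unfolding e_def \<beta>_def using k3 by (simp add: field_simps)
    have qs: "q \<le> 8 * real (k * r + 1)" unfolding q_def using s by (simp add: mult_left_mono)
    have q8: "8 \<le> q" unfolding q_def by simp
    have "32 * real (k * s + 1) \<le> X" using qs X(1) D unfolding q_def by linarith
    then have bal: "balanced s k (2 ^ (k + 3)) \<theta> R"
      using balanced_dense_shadow[OF V(1) _ Rne s(1) k dense(3)] GV dense(1) unfolding ke \<theta>_def q_def by blast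
    have "\<theta> / W = 4 * q powr e / (X powr e * W)"
      unfolding \<theta>_def using q8 \<open>1 \<le> X\<close> by (simp add: powr_divide)
    also have "\<dots> = 4 * q powr e * D powr (- (real r - 1 - \<beta>))"
    proof -
      have "X powr e * W = D powr (real r - 1 - \<beta>)" unfolding X(3) using W by simp
      then show ?thesis by (simp only: powr_minus[of D "real r - 1 - \<beta>"] divide_inverse)
    qed
    also have "\<dots> \<le> 4 * (8 * real (k * r + 1)) ^ r * D powr (- (real r - 1 - \<beta>))"
    proof -
      have "q powr e \<le> q powr real r" using q8 s \<beta> by (intro powr_mono) (auto simp: e_def)
      also have "\<dots> = q ^ r" using q8 by (intro powr_realpow) auto
      also have "\<dots> \<le> (8 * real (k * r + 1)) ^ r" using qs q8 by (intro power_mono) auto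
      finally show ?thesis by (intro mult_right_mono mult_left_mono) auto
    qed
    also have "\<dots> \<le> \<tau>" using out unfolding \<beta>_def .
    finally have \<theta>: "\<theta> / W \<le> \<tau>" .
    have "real (card E) \<le> (4 * real m) ^ (r - s) * (real (2 * card R) * W)"
      using dense(2) W m1 by (intro order_trans[OF cE] mult_left_mono mult_right_mono of_nat_mono) auto
    also have "\<dots> \<le> (4 * real m) ^ (r - 2) * (real (2 * card R) * W)"
      using m1 s W by (intro mult_right_mono power_increasing) auto
    finally have "real (card E) \<le> 2 * (4 * real m) ^ (r - 2) * (real (card R) * W)" by simp
    moreover have "fibred {x\<in>E'. \<pi> x \<in> R} \<pi> R s W (2 ^ r)"
      using fibred_mono[OF fibred_restrict[OF fib dense(1)]] W by (simp add: power_increasing)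
    moreover have "{x\<in>E'. \<pi> x \<in> R} \<subseteq> E" using E' by blast
    moreover have "0 \<le> \<theta>" unfolding \<theta>_def by simp
    ultimately show ?thesis unfolding outcome_def using W(1) bal \<theta> by blast
  next
    case (sparse D' \<phi>)
    have finD': "finite D'" using sparse(1) finG finite_subset by blast
    have "card D' \<noteq> 0" using sparse(2) Gne finG by auto
    then have Dne: "D' \<noteq> {}" by auto
    \<comment> \<open>A set assigned to \<open>g\<close> is \<open>g\<close> with one more vertex,
      so fibres have at most \<open>card V\<close> elements. This is why logarithmically many dyadic
      classes suffice.\<close>
    have "card {f\<in>D'. \<phi> f = g} < 2 ^ m" for g
    proof -
      have "{f\<in>D'. \<phi> f = g} \<subseteq> (\<lambda>x. insert x g) ` V"
      proof
        fix f assume f: "f \<in> {f\<in>D'. \<phi> f = g}"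
        then obtain x where "x \<in> f" "g = f - {x}" using sparse(3)[of f] by auto
        then have "f = insert x g" "x \<in> V" using f GV sparse(1) by blast+
        then show "f \<in> (\<lambda>x. insert x g) ` V" by blast
      qed
      then have "card {f\<in>D'. \<phi> f = g} \<le> card V" by (rule surj_card_le[OF V(1)])
      then show ?thesis using V(2) by linarith
    qed
    from dyadic_class[OF finD' this Dne] obtain a where
      a: "card D' \<le> m * (2 ^ (a + 1) * card {g\<in>\<phi> ` D'. 2 ^ a \<le> card {f\<in>D'. \<phi> f = g} \<and> card {f\<in>D'. \<phi> f = g} < 2 ^ (a + 1)})"
      "{g\<in>\<phi> ` D'. 2 ^ a \<le> card {f\<in>D'. \<phi> f = g} \<and> card {f\<in>D'. \<phi> f = g} < 2 ^ (a + 1)} \<noteq> {}" .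
    define A where "A = {g\<in>\<phi> ` D'. 2 ^ a \<le> card {f\<in>D'. \<phi> f = g} \<and> card {f\<in>D'. \<phi> f = g} < 2 ^ (a + 1)}"
    define W' where "W' = real (2 ^ a) * W"
    have "fibred {x\<in>E'. \<pi> x \<in> D' \<and> \<phi> (\<pi> x) \<in> A} (\<lambda>x. \<phi> (\<pi> x)) A (s - 1) W' (2 * 2 ^ (r - s))"
      unfolding W'_def using W by (intro fibred_comp[OF fib sparse(1)] sparse(3)) (auto simp: A_def)
    moreover have "2 * 2 ^ (r - s) = (2::real) ^ (r - (s - 1))"
    proof -
      have "r - (s - 1) = Suc (r - s)" using s by simp
      then show ?thesis by simp
    qed
    ultimately have 1: "fibred {x\<in>E'. \<pi> x \<in> D' \<and> \<phi> (\<pi> x) \<in> A} (\<lambda>x. \<phi> (\<pi> x)) A (s - 1) W' (2 ^ (r - (s - 1)))" by simp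
    have 2: "{x\<in>E'. \<pi> x \<in> D' \<and> \<phi> (\<pi> x) \<in> A} \<subseteq> E" using E' by blast
    have 3: "A \<noteq> {}" using a(2) unfolding A_def .
    have "1 * 1 \<le> W'" unfolding W'_def using W by (intro mult_mono) auto
    then have 4: "1 \<le> W'" by simp
    obtain g where "g \<in> A" using 3 by blast
    then have "2 ^ a \<le> card {f\<in>D'. \<phi> f = g}" unfolding A_def by simp
    then have "real (2 ^ a) \<le> real (card {f\<in>D'. \<phi> f = g})" by (rule of_nat_mono)
    also have "\<dots> \<le> X" by (rule sparse(4))
    finally have "W' \<le> X * W" unfolding W'_def using W by (intro mult_right_mono) auto
    then have 5: "W' \<le> D ^ (r - (s - 1))" using X(2) by (simp add: mult.commute)
    have "card G \<le> 2 * (m * (2 ^ (a + 1) * card A))" using sparse(2) a(1) unfolding A_def by linarith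
    then have "real (card G) \<le> real (2 * (m * (2 ^ (a + 1) * card A)))" by (rule of_nat_mono)
    then have cG: "real (card G) \<le> 4 * real m * (real (card A) * 2 ^ a)" by (simp add: mult_ac)
    have "real (card E) \<le> (4 * real m) ^ (r - s) * ((4 * real m * (real (card A) * 2 ^ a)) * W)"
      using cG W by (intro order_trans[OF cE] mult_left_mono mult_right_mono) auto
    also have "\<dots> = (4 * real m) ^ Suc (r - s) * (real (card A) * W')" unfolding W'_def by simp
    also have "Suc (r - s) = r - (s - 1)" using s by simp
    finally have 6: "real (card E) \<le> (4 * real m) ^ (r - (s - 1)) * (real (card A) * W')" .
    show ?thesis unfolding level_def using 1 2 3 4 5 6 by blast
  qed
qed

lemma reduction:
  fixes E :: "'a set set"
  assumes V: "finite V" "card V < 2 ^ m" and E: "\<And>e. e \<in> E \<Longrightarrow> e \<subseteq> V \<and> card e = r" "E \<noteq> {}"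
    and r: "2 \<le> r" and k: "3 \<le> k" and D: "32 * real (k * r + 1) \<le> D"
    and out: "4 * (8 * real (k * r + 1)) ^ r * D powr (- (real r - 1 - 1 / (real k - 1))) \<le> \<tau>"
  shows "outcome E \<tau> m r k \<or> (\<exists>E' \<pi> G W. level E D m r 2 E' \<pi> G W)"
proof -
  have finE: "finite E" using V(1) E(1) by (meson PowI finite_Pow_iff finite_subset subsetI)
  have "outcome E \<tau> m r k \<or> (\<exists>E' \<pi> G W. level E D m r (r - i) E' \<pi> G W)" if "i \<le> r - 2" for i
    using that
  proof (induction i)
    case 0
    have "{e\<in>E. id e = f} = {f}" if "f \<in> E" for f using that by auto
    then have "fibred E id E r 1 1" unfolding fibred_def using finE E(1) by simp
    then have "level E D m r r E id E 1" unfolding level_def using E(2) by simp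
    then show ?case by (metis minus_nat.diff_0)
  next
    case (Suc i)
    then have "outcome E \<tau> m r k \<or> (\<exists>E' \<pi> G W. level E D m r (r - i) E' \<pi> G W)" by simp
    then show ?case
    proof
      assume "\<exists>E' \<pi> G W. level E D m r (r - i) E' \<pi> G W"
      then obtain E' \<pi> G W where "level E D m r (r - i) E' \<pi> G W" by blast
      from reduction_step[OF V _ this _ _ k D out] have "outcome E \<tau> m r k \<or> (\<exists>E' \<pi> G W. level E D m r (r - i - 1) E' \<pi> G W)"
        using E(1) Suc.prems by auto
      then show ?thesis by simp
    qed simp
  qed
  from this[of "r - 2"] show ?thesis using r by simp
qed

section \<open>Conclusion\<close>

text \<open>A dense shadow gives the exponent \<open>y * (r - 1 - 1 / (2 * l - 1))\<close>, and the
  graph case with the largest multiplicity \<open>A powr (y * (r - 2))\<close> gives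
  \<open>(l - y * (r - 2)) / (l - 1)\<close>. Equating the two determines \<open>y\<close>, with
  common value \<open>\<alpha>\<close>. The last inequality lets the density of the final graph
  still grow with \<open>A\<close>.\<close>

lemma exponent_identities:
  fixes r l :: real
  assumes "3 \<le> r" "2 \<le> l"
  defines "Q \<equiv> 2 * (r - 1) * l\<^sup>2 - (r + 2) * l + 2"
  defines "y \<equiv> l * (2 * l - 1) / Q" and "\<alpha> \<equiv> (2 * (r - 1) * l\<^sup>2 - r * l) / Q"
  shows "0 < y" and "y * (r - 1 - 1 / (2 * l - 1)) = \<alpha>"
    and "(l - y * (r - 2)) / (l - 1) = \<alpha>" and "0 < 1 - y * (r - 2)"
proof -
  have Q: "Q = 2 * (l - 1)\<^sup>2 + (r - 2) * (l * (2 * l - 1))"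
    unfolding Q_def by (simp add: power2_eq_square algebra_simps)
  have pos: "0 < (l - 1)\<^sup>2" "0 \<le> (r - 2) * (l * (2 * l - 1))" "0 < l * (2 * l - 1)" using assms by auto
  then have Q0: "0 < Q" unfolding Q by linarith
  then show "0 < y" unfolding y_def using pos by simp
  define z where "z = 2 * l - 1"
  have z: "0 < z" using assms(2) by (simp add: z_def)
  have "r - 1 - 1 / z = ((r - 1) * z - 1) / z" using z by (simp add: field_simps)
  then have "y * (r - 1 - 1 / z) = l * ((r - 1) * z - 1) / Q"
    unfolding y_def z_def[symmetric] using z by simp
  also have "l * ((r - 1) * z - 1) = 2 * (r - 1) * l\<^sup>2 - r * l"
    by (simp add: z_def power2_eq_square algebra_simps)
  finally show "y * (r - 1 - 1 / (2 * l - 1)) = \<alpha>" unfolding \<alpha>_def z_def .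
  have "l - y * (r - 2) = (l * Q - l * (2 * l - 1) * (r - 2)) / Q" unfolding y_def using Q0 by (simp add: field_simps)
  also have "l * Q - l * (2 * l - 1) * (r - 2) = (l - 1) * (2 * (r - 1) * l\<^sup>2 - r * l)"
    unfolding Q_def by (simp add: power2_eq_square algebra_simps)
  finally show "(l - y * (r - 2)) / (l - 1) = \<alpha>" unfolding \<alpha>_def using assms by simp
  have "1 - y * (r - 2) = (Q - l * (2 * l - 1) * (r - 2)) / Q" unfolding y_def using Q0 by (simp add: field_simps)
  also have "Q - l * (2 * l - 1) * (r - 2) = 2 * (l - 1)\<^sup>2" unfolding Q by (simp add: algebra_simps)
  finally show "0 < 1 - y * (r - 2)" using Q0 pos by simp
qed

lemma outcome_exists:
  fixes r l :: nat
  assumes r: "3 \<le> r" and l: "2 \<le> l"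
  defines "\<alpha> \<equiv> (2 * (real r - 1) * real l ^ 2 - real r * real l) /
                (2 * (real r - 1) * real l ^ 2 - (real r + 2) * real l + 2)"
    and "g \<equiv> (real l - 1) / (real l * (2 * real l - 1))"
  shows "\<exists>K C. 0 < K \<and> 1 \<le> C \<and> (\<forall>A (V :: 'a set) E m. K \<le> A \<longrightarrow> finite V \<longrightarrow> card V < 2 ^ m \<longrightarrow>
     real m \<le> 3 * ln (real (card V)) \<longrightarrow> 1 \<le> ln (real (card V)) \<longrightarrow> (\<forall>e\<in>E. e \<subseteq> V \<and> card e = r) \<longrightarrow>
     real (card E) = A * ln (real (card V)) ^ (r - 2) * real (card V) powr (1 + 1 / real l) \<longrightarrow>
     outcome E (C * max (A powr (- \<alpha>)) (A powr (- 1) * real (card V) powr (- g))) m r (2 * l))"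
proof -
  define y where "y = real l * (2 * real l - 1) / (2 * (real r - 1) * real l ^ 2 - (real r + 2) * real l + 2)"
  define d where "d = 32 * real (2 * l * r + 1)"
  define C1 where "C1 = 4 * (8 * real (2 * l * r + 1)) ^ r"
  define c0 where "c0 = 4 * (32 * (real l)\<^sup>2 * (4 * real l) ^ (2 * l)) * (12 * (16 * (real l)\<^sup>2))\<^sup>2"
  \<comment> \<open>This is the loss of \<open>r - 2\<close> reductions once the logarithms are
    taken out, since \<open>4 * m \<le> 12 * ln n\<close>.\<close>
  define h where "h = (12::real) ^ (r - 2)"
  define C where "C = C1 + c0 * h\<^sup>2"
  define u where "u = 1 - y * (real r - 2)"
  \<comment> \<open>The first bound ensures \<open>d \<le> D\<close>, as the descent requires; the
    second ensures \<open>c0 \<le> \<kappa>\<close> in the graph case, even for the largest possible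
    \<open>W\<close>.\<close>
  define K where "K = max (d powr (1 / y)) ((h * c0) powr (1 / u))"
  define lam where "lam = real l / (real l - 1)"
  have l2: "2 \<le> real l" and r3: "3 \<le> real r" using l r by auto
  note ids = exponent_identities[OF r3 l2, folded y_def \<alpha>_def]
  have y0: "0 < y" and y\<alpha>: "y * (real r - 1 - 1 / (2 * real l - 1)) = \<alpha>"
    and yl: "(real l - y * (real r - 2)) / (real l - 1) = \<alpha>" and u0: "0 < u"
    using ids unfolding u_def by auto
  have d1: "1 \<le> d" unfolding d_def by simp
  have h1: "1 \<le> h" unfolding h_def by simp
  have c00: "0 \<le> c0" unfolding c0_def by simp
  have "1 \<le> (8 * real (2 * l * r + 1)) ^ r" by (rule one_le_power) simp
  then have "1 \<le> C1" unfolding C1_def by linarith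
  moreover have "0 \<le> c0 * h\<^sup>2" using c00 by simp
  ultimately have C:  "1 \<le> C" "C1 \<le> C" "c0 * h\<^sup>2 \<le> C" unfolding C_def by auto
  have "0 < d powr (1 / y)" using d1 by simp
  then have K0: "0 < K" unfolding K_def by (simp add: less_max_iff_disj)
  have lam: "1 \<le> lam" "lam \<le> 2" unfolding lam_def using l2 by (auto simp: field_simps)
  have "outcome E (C * max (A powr (- \<alpha>)) (A powr (- 1) * real (card V) powr (- g))) m r (2 * l)"
    if A: "K \<le> A" and V: "finite V" "card V < 2 ^ m" and m: "real m \<le> 3 * ln (real (card V))"
      and L: "1 \<le> ln (real (card V))" and E: "\<forall>e\<in>E. e \<subseteq> V \<and> card e = r"
      and cE: "real (card E) = A * ln (real (card V)) ^ (r - 2) * real (card V) powr (1 + 1 / real l)"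
    for A m and V :: "'a set" and E
  proof -
    define n where "n = real (card V)"
    define \<tau> where "\<tau> = C * max (A powr (- \<alpha>)) (A powr (- 1) * n powr (- g))"
    define D where "D = A powr y"
    have n1: "1 \<le> n" using L unfolding n_def by (cases "card V") auto
    have Ad: "d powr (1 / y) \<le> A" "(h * c0) powr (1 / u) \<le> A" using A by (auto simp: K_def)
    have "1 powr (1 / y) \<le> d powr (1 / y)" using d1 y0 by (intro powr_mono2) auto
    then have A1: "1 \<le> A" using Ad(1) by simp
    have "(d powr (1 / y)) powr y \<le> D" unfolding D_def using Ad(1) y0 by (intro powr_mono2) auto
    then have Dd: "d \<le> D" using y0 d1 by (simp add: powr_powr)
    have "0 < real (card E)" unfolding cE       by (intro mult_pos_pos zero_less_power, use A1 in linarith, use L in linarith, use n1 in \<open>simp add: n_def\<close>)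
    then have Ene: "E \<noteq> {}" by auto
    have D\<alpha>: "D powr (- (real r - 1 - 1 / (real (2 * l) - 1))) = A powr (- \<alpha>)"
    proof -
      have "real (2 * l) = 2 * real l" by simp
      then show ?thesis unfolding D_def powr_powr mult_minus_right by (simp only: y\<alpha>)
    qed
    have "C1 * A powr (- \<alpha>) \<le> C * max (A powr (- \<alpha>)) (A powr (- 1) * n powr (- g))"
      using C by (intro mult_mono) auto
    then have out: "4 * (8 * real (2 * l * r + 1)) ^ r * D powr (- (real r - 1 - 1 / (real (2 * l) - 1))) \<le> \<tau>"
      unfolding D\<alpha> \<tau>_def C1_def .
    have "outcome E \<tau> m r (2 * l) \<or> (\<exists>E' \<pi> G W. level E D m r 2 E' \<pi> G W)"
      using E Ene r l Dd out by (intro reduction[OF V]) (auto simp: d_def)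
    then have "outcome E \<tau> m r (2 * l)"
    proof
      assume "\<exists>E' \<pi> G W. level E D m r 2 E' \<pi> G W"
      then obtain E' \<pi> G W where "level E D m r 2 E' \<pi> G W" by blast
      then have fib: "fibred E' \<pi> G 2 W (2 ^ (r - 2))" and E': "E' \<subseteq> E" and Gne: "G \<noteq> {}"
        and W: "1 \<le> W" "W \<le> D ^ (r - 2)"
        and cG: "real (card E) \<le> (4 * real m) ^ (r - 2) * (real (card G) * W)"
        unfolding level_def by auto
      have im: "\<pi> ` E' = G" and pe: "\<And>x. x \<in> E' \<Longrightarrow> \<pi> x \<subseteq> x \<and> card (\<pi> x) = 2"
        using fib unfolding fibred_def by auto
      have GV: "f \<subseteq> V \<and> card f = 2" if f: "f \<in> G" for f
      proof -
        obtain x where "x \<in> E'" "f = \<pi> x" using f im by blast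
        then show ?thesis using pe[of x] E E' by blast
      qed
      define \<kappa> where "\<kappa> = A / (h * W)"
      have W': "W \<le> A powr (y * (real r - 2))"
        using W(2) A1 r by (simp add: D_def powr_powr of_nat_diff flip: powr_realpow)
      have "A * ln n ^ (r - 2) * n powr (1 + 1 / real l) \<le> (4 * real m) ^ (r - 2) * (real (card G) * W)"
        using cG unfolding cE n_def .
      also have "\<dots> \<le> (12 * ln n) ^ (r - 2) * (real (card G) * W)"
        using m W unfolding n_def by (intro mult_right_mono power_mono) auto
      also have "\<dots> = ln n ^ (r - 2) * (h * W * real (card G))" by (simp add: h_def power_mult_distrib)
      finally have "ln n ^ (r - 2) * (A * n powr (1 + 1 / real l)) \<le> ln n ^ (r - 2) * (h * W * real (card G))"
        by (simp add: mult_ac)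
      moreover have "0 < ln n ^ (r - 2)" using L unfolding n_def by simp
      ultimately have "A * n powr (1 + 1 / real l) \<le> h * W * real (card G)" by (simp only: mult_le_cancel_left_pos)
      then have \<kappa>G: "\<kappa> * n powr (1 + 1 / real l) \<le> real (card G)"
        unfolding \<kappa>_def using h1 W by (simp add: field_simps)
      have "c0 * (h * W) \<le> c0 * h * A powr (y * (real r - 2))"
        using mult_left_mono[OF W', of "c0 * h"] c00 h1 by (simp add: mult.assoc)
      also have "h * c0 \<le> A powr u"
      proof -
        have "((h * c0) powr (1 / u)) powr u \<le> A powr u" using Ad(2) u0 by (intro powr_mono2) auto
        then show ?thesis using u0 h1 c00 by (simp add: powr_powr)
      qed
      then have "c0 * h * A powr (y * (real r - 2)) \<le> A powr u * A powr (y * (real r - 2))"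
        by (intro mult_right_mono) (auto simp: mult.commute)
      also have "\<dots> = A" unfolding u_def using A1 by (simp flip: powr_add)
      finally have large: "c0 \<le> \<kappa>" unfolding \<kappa>_def using h1 W by (simp add: field_simps)
      define \<theta> where "\<theta> = c0 * max (\<kappa> powr (- lam)) (\<kappa> powr (- 1) * n powr (- g))"
      have bal: "balanced 2 (2 * l) (2 ^ (2 * l + 3)) \<theta> G"
        unfolding \<theta>_def c0_def lam_def g_def n_def
        using V(1) GV Gne l \<kappa>G large unfolding c0_def n_def by (intro balanced_graph) auto
      have \<theta>0: "0 \<le> \<theta>" unfolding \<theta>_def using c00 by (intro mult_nonneg_nonneg) (auto simp: le_max_iff_disj)
      have \<kappa>0: "0 < \<kappa>" unfolding \<kappa>_def using A1 h1 W by simp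
      have h2: "h powr lam \<le> h\<^sup>2" using powr_mono[OF lam(2) h1] h1 by (simp add: powr_numeral)
      \<comment> \<open>The left side does not decrease in \<open>W\<close> because
        \<open>1 \<le> lam\<close>, so the largest \<open>W\<close> is the worst case, and there the
        exponent of \<open>A\<close> is \<open>- \<alpha>\<close>.\<close>
      have b1: "\<kappa> powr (- lam) / W \<le> h\<^sup>2 * A powr (- \<alpha>)"
      proof -
        have "\<kappa> powr (- lam) / W = h powr lam * (A powr (- lam) * (W powr lam / W powr 1))"
          unfolding \<kappa>_def using A1 h1 W by (simp add: powr_divide powr_mult powr_minus field_simps)
        also have "W powr lam / W powr 1 = W powr (lam - 1)" using W by (simp add: powr_diff)
        also have "h powr lam * (A powr (- lam) * W powr (lam - 1))
            \<le> h\<^sup>2 * (A powr (- lam) * (A powr (y * (real r - 2))) powr (lam - 1))"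
        proof (rule mult_mono[OF h2 mult_left_mono])
          show "W powr (lam - 1) \<le> (A powr (y * (real r - 2))) powr (lam - 1)"
            using W W' lam by (intro powr_mono2) auto
        qed auto
        also have "A powr (- lam) * (A powr (y * (real r - 2))) powr (lam - 1) = A powr (- \<alpha>)"
        proof -
          have "- lam + y * (real r - 2) * (lam - 1) = - ((real l - y * (real r - 2)) / (real l - 1))"
          proof -
            have "lam - 1 = 1 / (real l - 1)" unfolding lam_def using l2 by (simp add: field_simps)
            then show ?thesis by (simp add: lam_def diff_divide_distrib)
          qed
          then show ?thesis unfolding powr_powr yl by (simp flip: powr_add)
        qed
        finally show ?thesis .
      qed
      \<comment> \<open>The multiplicity cancels in this term, since
        \<open>\<kappa> powr (- 1) = h * W / A\<close>.\<close>
      have b2: "\<kappa> powr (- 1) * n powr (- g) / W \<le> h\<^sup>2 * (A powr (- 1) * n powr (- g))"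
      proof -
        have "\<kappa> powr (- 1) * n powr (- g) / W = h * (A powr (- 1) * n powr (- g))"
          unfolding \<kappa>_def using A1 h1 W by (simp add: powr_minus field_simps)
        also have "\<dots> \<le> h\<^sup>2 * (A powr (- 1) * n powr (- g))"
          using h1 self_le_power[OF h1, of 2] by (intro mult_right_mono) auto
        finally show ?thesis .
      qed
      have "\<theta> / W = c0 * max (\<kappa> powr (- lam) / W) (\<kappa> powr (- 1) * n powr (- g) / W)"
      proof -
        have "max a b / W = max (a / W) (b / W)" for a b :: real
          using W by (auto simp: max_def divide_right_mono field_simps)
        then show ?thesis unfolding \<theta>_def times_divide_eq_right[symmetric] by simp
      qed
      also have "\<dots> \<le> c0 * (h\<^sup>2 * max (A powr (- \<alpha>)) (A powr (- 1) * n powr (- g)))"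
      proof (intro mult_left_mono max.boundedI)
        show "\<kappa> powr (- lam) / W \<le> h\<^sup>2 * max (A powr (- \<alpha>)) (A powr (- 1) * n powr (- g))"
          using b1 by (rule order_trans) (intro mult_left_mono, auto)
        show "\<kappa> powr (- 1) * n powr (- g) / W \<le> h\<^sup>2 * max (A powr (- \<alpha>)) (A powr (- 1) * n powr (- g))"
          using b2 by (rule order_trans) (intro mult_left_mono, auto)
      qed (use c00 in auto)
      also have "\<dots> = (c0 * h\<^sup>2) * max (A powr (- \<alpha>)) (A powr (- 1) * n powr (- g))" by simp
      also have "\<dots> \<le> \<tau>" unfolding \<tau>_def using C by (intro mult_right_mono) (auto simp: le_max_iff_disj)
      finally have \<theta>W: "\<theta> / W \<le> \<tau>" .
      have "0 \<le> (4 * real m) ^ (r - 2) * (real (card G) * W)" using W by simp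
      then have "real (card E) \<le> 2 * (4 * real m) ^ (r - 2) * (real (card G) * W)" using cG by linarith
      moreover have "fibred E' \<pi> G 2 W (2 ^ r)" using fib W by (rule_tac fibred_mono) (auto intro: power_increasing)
      ultimately show ?thesis unfolding outcome_def using E' W(1) \<theta>0 bal \<theta>W by blast
    qed
    then show ?thesis unfolding \<tau>_def n_def .
  qed
  then show ?thesis using K0 C(1) by blast
qed

theorem theorem5p1:
  fixes r l :: nat
  assumes "r \<ge> 3" and "l \<ge> 2"
  shows "\<exists>(K::real) (c::real). K > 0 \<and> c > 0 \<and>
    (\<forall>\<^sub>F n in sequentially. \<forall>t::real. t \<ge> K * ln (real n) ^ (r - 2) \<longrightarrow>
      (\<forall>(V :: 'a set) (E :: 'a set set).
        r_graph r V E \<and> card V = n \<and>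
        real (card E) = t * real n powr (1 + 1 / real l) \<longrightarrow>
        (\<exists>S. S \<noteq> {} \<and> S \<subseteq> berge_copies r (2 * l) E \<and>
          (\<forall>j\<in>{1..2 * l}.
            real (max_codegree E j S) \<le>
              c * real (card S) * ln (real n) ^ (r - 2) / (t * real n powr (1 + 1 / real l)) *
              max ((t / ln (real n) ^ (r - 2)) powr
                     (- ((2 * (real r - 1) * real l ^ 2 - real r * real l) /
                         (2 * (real r - 1) * real l ^ 2 - (real r + 2) * real l + 2))))
                  ((t / ln (real n) ^ (r - 2)) powr (- 1) *
                     real n powr (- ((real l - 1) / (real l * (2 * real l - 1)))))
              ^ (j - 1)))))"
proof -
  define \<alpha> where "\<alpha> = (2 * (real r - 1) * real l ^ 2 - real r * real l) /
                (2 * (real r - 1) * real l ^ 2 - (real r + 2) * real l + 2)"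
  define g where "g = (real l - 1) / (real l * (2 * real l - 1))"
  obtain K C where K: "0 < K" and C: "1 \<le> C" and out: "\<forall>A (V :: 'a set) E m. K \<le> A \<longrightarrow> finite V \<longrightarrow> card V < 2 ^ m \<longrightarrow>
     real m \<le> 3 * ln (real (card V)) \<longrightarrow> 1 \<le> ln (real (card V)) \<longrightarrow> (\<forall>e\<in>E. e \<subseteq> V \<and> card e = r) \<longrightarrow>
     real (card E) = A * ln (real (card V)) ^ (r - 2) * real (card V) powr (1 + 1 / real l) \<longrightarrow>
     outcome E (C * max (A powr (- \<alpha>)) (A powr (- 1) * real (card V) powr (- g))) m r (2 * l)"
    using outcome_exists[OF assms, where 'a = 'a, folded \<alpha>_def g_def] by (elim exE conjE) (rule that)
  \<comment> \<open>The factors are the spread of the fibres, the constant of the greedy choice, the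
    loss in the reductions, and a bound for the powers of \<open>C\<close>.\<close>
  define c where "c = (2 ^ r) ^ (2 * l) * 2 ^ (2 * l + 3) * (2 * 12 ^ (r - 2)) * C ^ (2 * l)"
  have c: "0 < c" unfolding c_def using C by simp
  have main: "\<exists>S. S \<noteq> {} \<and> S \<subseteq> berge_copies r (2 * l) E \<and>
          (\<forall>j\<in>{1..2 * l}. real (max_codegree E j S) \<le>
              c * real (card S) * ln (real n) ^ (r - 2) / (t * real n powr (1 + 1 / real l)) *
              max ((t / ln (real n) ^ (r - 2)) powr (- \<alpha>))
                  ((t / ln (real n) ^ (r - 2)) powr (- 1) * real n powr (- g)) ^ (j - 1))"
    if n: "nat \<lceil>exp (1::real)\<rceil> \<le> n" and t: "K * ln (real n) ^ (r - 2) \<le> t" and H: "r_graph r V E" "card V = n"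
      and cE: "real (card E) = t * real n powr (1 + 1 / real l)" for n t and V :: "'a set" and E
  proof -
    have "exp 1 \<le> real n" using n by linarith
    then have n0: "0 < real n" by (meson exp_gt_zero less_le_trans)
    then have L: "1 \<le> ln (real n)" using \<open>exp 1 \<le> real n\<close> by (simp add: ln_ge_iff)
    \<comment> \<open>\<open>n < 2 ^ m\<close> follows from \<open>ln 2 > 1 / 2\<close>, and
      rounding up keeps \<open>m \<le> 3 * ln n\<close> because \<open>1 \<le> ln n\<close>.\<close>
    define m where "m = nat \<lceil>2 * ln (real n)\<rceil>"
    have m1: "2 * ln (real n) \<le> real m" unfolding m_def by linarith
    have m2: "real m \<le> 3 * ln (real n)" unfolding m_def using L by linarith
    have "real n < 2 ^ m"
    proof -
      have "exp 1 < exp (ln (2 ^ 2 :: real))" using exp_le by simp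
      then have "1 < ln (2 ^ 2 :: real)" by (simp only: exp_less_cancel_iff)
      also have "\<dots> = 2 * ln 2" by (subst ln_realpow) simp_all
      finally have ln2: "1 / 2 < ln (2::real)" by simp
      have "ln (real n) = 2 * ln (real n) * (1 / 2)" by simp
      also have "\<dots> < 2 * ln (real n) * ln 2" using ln2 L by (intro mult_strict_left_mono) auto
      also have "\<dots> \<le> real m * ln 2" using m1 by (intro mult_right_mono) auto
      finally have "exp (ln (real n)) < exp (real m * ln 2)" by simp
      also have "exp (real m * ln 2) = 2 ^ m" by (simp add: exp_of_nat_mult)
      finally show ?thesis using n0 by simp
    qed
    then have m3: "card V < 2 ^ m" using H(2) by (metis of_nat_less_numeral_power_cancel_iff of_nat_numeral of_nat_power of_nat_less_iff)
    define A where "A = t / ln (real n) ^ (r - 2)"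
    have Lp: "0 < ln (real n) ^ (r - 2)" using L by simp
    have AK: "K \<le> A" unfolding A_def using t Lp by (simp add: field_simps)
    have tA: "t = A * ln (real n) ^ (r - 2)"     proof -
      have "t = t / P * P" if "0 < P" for P :: real using that by simp
      from this[OF Lp] show ?thesis unfolding A_def .
    qed
    have V: "finite V" and E: "\<forall>e\<in>E. e \<subseteq> V \<and> card e = r" using H(1) unfolding r_graph_def by auto
    have finE: "finite E" using V E by (meson PowI finite_Pow_iff finite_subset subsetI)
    define \<tau> where "\<tau> = max (A powr (- \<alpha>)) (A powr (- 1) * real n powr (- g))"
    have "outcome E (C * \<tau>) m r (2 * l)"
      unfolding \<tau>_def H(2)[symmetric] using AK V m3 m2 L E cE tA H(2) by (intro out[rule_format]) auto
    then obtain s E' \<pi> G W \<theta> where fib: "fibred E' \<pi> G s W (2 ^ r)" and E': "E' \<subseteq> E" and W: "1 \<le> W" and \<theta>: "0 \<le> \<theta>"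
      and bal: "balanced s (2 * l) (2 ^ (2 * l + 3)) \<theta> G" and \<theta>W: "\<theta> / W \<le> C * \<tau>"
      and cG: "real (card E) \<le> 2 * (4 * real m) ^ (r - 2) * (real (card G) * W)"
      unfolding outcome_def by (elim exE conjE) (rule that)
    have "\<exists>S. S \<noteq> {} \<and> S \<subseteq> berge_copies r (2 * l) E \<and> (\<forall>j\<in>{1..2 * l}.
        real (max_codegree E j S) \<le> (2 ^ r) ^ (2 * l) * 2 ^ (2 * l + 3) / (real (card G) * W) * real (card S) * (\<theta> / W) ^ (j - 1))"
      using assms E W \<theta> by (intro balanced_lift[OF fib E' finE _ bal]) auto
    then obtain S where S: "S \<noteq> {}" "S \<subseteq> berge_copies r (2 * l) E" and deg: "\<And>j. j \<in> {1..2 * l} \<Longrightarrow>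
        real (max_codegree E j S) \<le> (2 ^ r) ^ (2 * l) * 2 ^ (2 * l + 3) / (real (card G) * W) * real (card S) * (\<theta> / W) ^ (j - 1)"
      by blast
    have \<tau>0: "0 \<le> \<tau>" unfolding \<tau>_def by (simp add: le_max_iff_disj)
    have E0: "0 < real (card E)"
    proof -
      have "0 < A" using AK K by linarith
      then show ?thesis unfolding cE tA using Lp n0 by simp
    qed
    have "real (card E) \<le> 2 * (12 * ln (real n)) ^ (r - 2) * (real (card G) * W)"
      using m2 W by (intro order_trans[OF cG] mult_right_mono mult_left_mono power_mono) auto
    also have "\<dots> = (2 * 12 ^ (r - 2)) * ln (real n) ^ (r - 2) * (real (card G) * W)" by (simp add: power_mult_distrib)
    finally have cG': "real (card E) \<le> (2 * 12 ^ (r - 2)) * ln (real n) ^ (r - 2) * (real (card G) * W)" .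
    have G0: "0 < real (card G) * W"
    proof (rule ccontr)
      assume "\<not> ?thesis"
      then have "real (card G) * W = 0" using W by (simp add: not_less mult_le_0_iff)
      then have "real (card E) \<le> 0" using cG' by (simp only: mult_zero_right)
      then show False using E0 by linarith
    qed
    have inv: "1 / (real (card G) * W) \<le> (2 * 12 ^ (r - 2)) * ln (real n) ^ (r - 2) / real (card E)"
      using cG' G0 E0 by (simp add: field_simps)
    have "real (max_codegree E j S) \<le> c * real (card S) * ln (real n) ^ (r - 2) / (t * real n powr (1 + 1 / real l)) * \<tau> ^ (j - 1)"
      if j: "j \<in> {1..2 * l}" for j
    proof -
      have "(\<theta> / W) ^ (j - 1) \<le> (C * \<tau>) ^ (j - 1)" using \<theta>W \<theta> W by (intro power_mono) auto
      also have "\<dots> \<le> C ^ (2 * l) * \<tau> ^ (j - 1)" unfolding power_mult_distrib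
        using C \<tau>0 j by (intro mult_right_mono power_increasing) auto
      finally have p: "(\<theta> / W) ^ (j - 1) \<le> C ^ (2 * l) * \<tau> ^ (j - 1)" .
      have "real (max_codegree E j S) \<le> (2 ^ r) ^ (2 * l) * 2 ^ (2 * l + 3) * (1 / (real (card G) * W)) * real (card S) * (\<theta> / W) ^ (j - 1)"
        using deg[OF j] by simp
      also have "\<dots> \<le> (2 ^ r) ^ (2 * l) * 2 ^ (2 * l + 3) * ((2 * 12 ^ (r - 2)) * ln (real n) ^ (r - 2) / real (card E)) * real (card S)
          * (C ^ (2 * l) * \<tau> ^ (j - 1))"
        using p inv \<theta> W Lp C \<tau>0 by (intro mult_mono mult_left_mono) auto
      also have "\<dots> = c * real (card S) * ln (real n) ^ (r - 2) / real (card E) * \<tau> ^ (j - 1)"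
        unfolding c_def by simp
      finally show ?thesis unfolding cE .
    qed
    then show ?thesis using S unfolding \<tau>_def A_def by blast
  qed
  show ?thesis
  proof (rule exI[of _ K], rule exI[of _ c], intro conjI K c)
    show "\<forall>\<^sub>F n in sequentially. \<forall>t::real. t \<ge> K * ln (real n) ^ (r - 2) \<longrightarrow>
      (\<forall>(V :: 'a set) (E :: 'a set set).
        r_graph r V E \<and> card V = n \<and>
        real (card E) = t * real n powr (1 + 1 / real l) \<longrightarrow>
        (\<exists>S. S \<noteq> {} \<and> S \<subseteq> berge_copies r (2 * l) E \<and>
          (\<forall>j\<in>{1..2 * l}.
            real (max_codegree E j S) \<le>
              c * real (card S) * ln (real n) ^ (r - 2) / (t * real n powr (1 + 1 / real l)) *
              max ((t / ln (real n) ^ (r - 2)) powr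
                     (- ((2 * (real r - 1) * real l ^ 2 - real r * real l) /
                         (2 * (real r - 1) * real l ^ 2 - (real r + 2) * real l + 2))))
                  ((t / ln (real n) ^ (r - 2)) powr (- 1) *
                     real n powr (- ((real l - 1) / (real l * (2 * real l - 1)))))
              ^ (j - 1))))"
      using eventually_ge_at_top[of "nat \<lceil>exp (1::real)\<rceil>"]
    proof eventually_elim
      case (elim n)
      show ?case
      proof (intro allI impI, elim conjE)
        fix t :: real and V :: "'a set" and E :: "'a set set"
        assume "t \<ge> K * ln (real n) ^ (r - 2)" "r_graph r V E" "card V = n" "real (card E) = t * real n powr (1 + 1 / real l)"
        from main[OF elim this] show "\<exists>S. S \<noteq> {} \<and> S \<subseteq> berge_copies r (2 * l) E \<and>
          (\<forall>j\<in>{1..2 * l}.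
            real (max_codegree E j S) \<le>
              c * real (card S) * ln (real n) ^ (r - 2) / (t * real n powr (1 + 1 / real l)) *
              max ((t / ln (real n) ^ (r - 2)) powr
                     (- ((2 * (real r - 1) * real l ^ 2 - real r * real l) /
                         (2 * (real r - 1) * real l ^ 2 - (real r + 2) * real l + 2))))
                  ((t / ln (real n) ^ (r - 2)) powr (- 1) *
                     real n powr (- ((real l - 1) / (real l * (2 * real l - 1)))))
              ^ (j - 1))"
          unfolding \<alpha>_def g_def .
      qed
    qed
  qed
qed

end
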